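(* Let $b>a>0$ and $\sigma\in\mathbb R$, $\sigma\neq0$, and let $X=(X_t)_{t\ge0}$ be the (uniformly ergodic) Jacobi process on $S=(0,1)$ with generator $$\mathcal A^J=(a-bx)\frac{d}{dx}+\frac{\sigma^2}{2}x(1-x)\frac{d^2}{dx^2}$$ and stationary distribution $\pi$. Let $$t_{av}=\frac{2}{\sigma^2}\sum_{i=1}^\infty\frac{1}{i\left(i-1+\frac{2b}{\sigma^2}\right)},$$ which is the average hitting time of $X$. Then for any $\varepsilon>0$, any $t>\frac{4t_{av}}{\varepsilon}$, any $x\in S$ and any measurable subset $A\subseteq(0,1)$, $$\mathbb P_x\left(\frac1t\int_0^t \mathbf 1_A(X_s)\,ds-\pi(\mathbf 1_A)\ge\varepsilon\right)\le\exp\left\{\frac{-2\left(t\varepsilon-4t_{av}\right)^2}{(t+1)\left(4t_{av}+1\right)^2}\right\}.$$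
   Context: $\mathbb P_x(\cdot)=\mathbb P(\cdot\mid X_0=x)$ and $\mathbb E_x$ is the corresponding expectation. $\mathbf 1_A$ is the indicator function of $A$, and $\pi(f):=\int_S f(x)\,\pi(dx)$. With $\alpha:=\frac{2b}{\sigma^2}-\frac{2a}{\sigma^2}-1>-1$ and $\beta:=\frac{2a}{\sigma^2}-1>-1$, the Jacobi process is the ergodic diffusion on $(0,1)$ with the given generator whose stationary distribution $\pi$ is the Beta distribution with density $\pi(x)=\frac{x^\beta(1-x)^\alpha}{B(\alpha+1,\beta+1)}$ on $(0,1)$, where $B(\cdot,\cdot)$ is the Beta function. The eigenvalues of $-\mathcal A^J$ are $\lambda_i=\frac{\sigma^2}{2}i\left(i-1+\frac{2b}{\sigma^2}\right)$, $i=0,1,2,\dots$. Uniformly ergodic means that there are constants $C<\infty$, $c>0$ such that $\sup_{x\in S}\sup_{B}|P^t(x,B)-\pi(B)|\le Ce^{-ct}$ for all $t\ge0$ (supremum over measurable $B\subseteq S$), where $P^t$ is the transition semigroup of $X$. The average hitting time of $X$ is $t_{av}:=\int_{S\times S}\mathbb E_x[\tau_y]\,\pi(dx)\pi(dy)$, where $\tau_y:=\inf\{t\ge0: X_t=y\}$. *)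

theory Defs
  imports "HOL-Probability.Probability"
begin

definition natural_filtration :: "'w measure \<Rightarrow> (real \<Rightarrow> 'w \<Rightarrow> real) \<Rightarrow> real \<Rightarrow> 'w measure" where
  "natural_filtration \<Omega> X s =
     sigma (space \<Omega>) {X u -` B \<inter> space \<Omega> | u B. 0 \<le> u \<and> u \<le> s \<and> B \<in> sets borel}"

definition transition ::
    "(real \<Rightarrow> 'w measure) \<Rightarrow> (real \<Rightarrow> 'w \<Rightarrow> real) \<Rightarrow> real \<Rightarrow> real \<Rightarrow> real set \<Rightarrow> real" where
  "transition P X t x B = measure (P x) {\<omega> \<in> space (P x). X t \<omega> \<in> B}"

text \<open>
  A time-homogeneous Markov process with state space S, given by the family of laws \<open>P x\<close>
  (the law of the process started from x) on one measurable space.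
  Paths are continuous in the closure of S, while \<open>X t \<in> S\<close> is only required almost surely
  for each fixed t, so that a process on an open interval may touch an endpoint at exceptional
  times. A process whose paths never leave S is a special case.
\<close>

locale continuous_markov_process =
  fixes S :: "real set"
    and \<Omega> :: "'w measure"
    and P :: "real \<Rightarrow> 'w measure"
    and X :: "real \<Rightarrow> 'w \<Rightarrow> real"
  assumes prob_space_P: "x \<in> S \<Longrightarrow> prob_space (P x)"
    and sets_P: "x \<in> S \<Longrightarrow> sets (P x) = sets \<Omega>"
    and measurable_X: "0 \<le> t \<Longrightarrow> X t \<in> borel_measurable \<Omega>"
    and continuous_paths: "\<omega> \<in> space \<Omega> \<Longrightarrow> continuous_on {0..} (\<lambda>t. X t \<omega>)"
    and range_X: "\<omega> \<in> space \<Omega> \<Longrightarrow> 0 \<le> t \<Longrightarrow> X t \<omega> \<in> closure S"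
    and start: "x \<in> S \<Longrightarrow> AE \<omega> in P x. X 0 \<omega> = x"
    and AE_in_S: "x \<in> S \<Longrightarrow> 0 \<le> t \<Longrightarrow> AE \<omega> in P x. X t \<omega> \<in> S"
    and measurable_transition: "0 \<le> t \<Longrightarrow> B \<in> sets borel \<Longrightarrow>
      (\<lambda>x. transition P X t x B) \<in> borel_measurable (restrict_space borel S)"
    and markov: "x \<in> S \<Longrightarrow> 0 \<le> s \<Longrightarrow> 0 \<le> t \<Longrightarrow> B \<in> sets borel \<Longrightarrow>
      AE \<omega> in P x. real_cond_exp (P x) (natural_filtration \<Omega> X s)
                      (\<lambda>\<omega>. indicat_real B (X (s + t) \<omega>)) \<omega>
                    = transition P X t (X s \<omega>) B"

text \<open>\<open>f\<close> belongs to the domain of the infinitesimal generator, which maps it to \<open>g\<close>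
  (the limit of the difference quotients is taken in supremum norm on \<open>S\<close>).\<close>

definition generator_maps ::
    "real set \<Rightarrow> (real \<Rightarrow> 'w measure) \<Rightarrow> (real \<Rightarrow> 'w \<Rightarrow> real) \<Rightarrow> (real \<Rightarrow> real) \<Rightarrow> (real \<Rightarrow> real) \<Rightarrow> bool" where
  "generator_maps S P X f g \<longleftrightarrow>
     uniform_limit S (\<lambda>t x. ((\<integral>\<omega>. f (X t \<omega>) \<partial>P x) - f x) / t) g (at_right 0)"

text \<open>
  The generator is prescribed on all functions that are twice continuously differentiable on the
  closed interval. Using test functions up to the boundary, rather than compactly supported ones,
  fixes the behaviour at 0 and 1: the boundary may be reached when \<open>2 * a < \<sigma>\<^sup>2\<close> or
  \<open>2 * (b - a) < \<sigma>\<^sup>2\<close>, and it is then instantaneously reflecting, which is the case with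
  Beta stationary distribution.
\<close>

locale jacobi_process = continuous_markov_process "{0<..<1}" \<Omega> P X
  for a b \<sigma> :: real
    and \<Omega> :: "'w measure"
    and P :: "real \<Rightarrow> 'w measure"
    and X :: "real \<Rightarrow> 'w \<Rightarrow> real" +
  assumes generator:
    "\<lbrakk>\<And>x. x \<in> {0..1} \<Longrightarrow> (f has_real_derivative f' x) (at x within {0..1});
      \<And>x. x \<in> {0..1} \<Longrightarrow> (f' has_real_derivative f'' x) (at x within {0..1});
      continuous_on {0..1} f''\<rbrakk>
     \<Longrightarrow> generator_maps {0<..<1} P X f
           (\<lambda>x. (a - b * x) * f' x + \<sigma>\<^sup>2 / 2 * x * (1 - x) * f'' x)"

definition jacobi_distribution :: "real \<Rightarrow> real \<Rightarrow> real \<Rightarrow> real measure" where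
  "jacobi_distribution a b \<sigma> =
     (let \<alpha> = 2 * b / \<sigma>\<^sup>2 - 2 * a / \<sigma>\<^sup>2 - 1; \<beta> = 2 * a / \<sigma>\<^sup>2 - 1 in
      density lborel (\<lambda>x. ennreal (indicator {0<..<1} x *
        (x powr \<beta> * (1 - x) powr \<alpha> / Beta (\<alpha> + 1) (\<beta> + 1)))))"

definition stationary_distribution ::
    "real set \<Rightarrow> (real \<Rightarrow> 'w measure) \<Rightarrow> (real \<Rightarrow> 'w \<Rightarrow> real) \<Rightarrow> real measure \<Rightarrow> bool" where
  "stationary_distribution S P X \<pi> \<longleftrightarrow>
     (\<forall>t\<ge>0. \<forall>B\<in>sets borel. B \<subseteq> S \<longrightarrow> (LINT x:S|\<pi>. transition P X t x B) = measure \<pi> B)"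

definition uniformly_ergodic ::
    "real set \<Rightarrow> (real \<Rightarrow> 'w measure) \<Rightarrow> (real \<Rightarrow> 'w \<Rightarrow> real) \<Rightarrow> real measure \<Rightarrow> bool" where
  "uniformly_ergodic S P X \<pi> \<longleftrightarrow>
     (\<exists>C c. c > 0 \<and> (\<forall>t\<ge>0. \<forall>x\<in>S. \<forall>B\<in>sets borel. B \<subseteq> S \<longrightarrow>
        \<bar>transition P X t x B - measure \<pi> B\<bar> \<le> C * exp (- c * t)))"

definition hitting_time :: "(real \<Rightarrow> 'w \<Rightarrow> real) \<Rightarrow> real \<Rightarrow> 'w \<Rightarrow> ennreal" where
  "hitting_time X y \<omega> = (INF t\<in>{t. 0 \<le> t \<and> X t \<omega> = y}. ennreal t)"

definition average_hitting_time ::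
    "real set \<Rightarrow> (real \<Rightarrow> 'w measure) \<Rightarrow> (real \<Rightarrow> 'w \<Rightarrow> real) \<Rightarrow> real measure \<Rightarrow> ennreal" where
  "average_hitting_time S P X \<pi> =
     (\<integral>\<^sup>+ z \<in> S \<times> S. (\<integral>\<^sup>+ \<omega>. hitting_time X (snd z) \<omega> \<partial>P (fst z)) \<partial>(\<pi> \<Otimes>\<^sub>M \<pi>))"

end

theory Submission
  imports Defs "HOL-Real_Asymp.Real_Asymp"
begin

text \<open>
  Polynomials are the only test functions needed. With the Beta density \<open>rho\<close> and
  \<open>flux x = x (1 - x) rho x\<close>, the normalised generator \<open>L\<close> satisfies \<open>(flux u')' = rho L u\<close>.
  The power series \<open>G\<close> with \<open>L G = 1\<close> has \<open>G' = F / flux\<close>, \<open>F\<close> being the distribution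
  function, and Dynkin's formula applied to its truncations gives \<open>E\<^sub>x[\<tau>\<^sub>y] = 2 / \<sigma>\<^sup>2 (G y - G x)\<close> for
  \<open>x < y\<close>; the case \<open>x > y\<close> follows by the reflection \<open>z \<mapsto> 1 - z\<close>. Averaging over \<open>\<pi> \<otimes> \<pi>\<close> yields
  \<open>\<integral> F (1 - F) / flux = \<integral> (1 - F) G' = \<integral> G d\<pi>\<close>, which is the series, term by term.

  For a polynomial \<open>f\<close> with values in \<open>[0, 1]\<close>, the Poisson equation \<open>L g = f - \<pi>(f)\<close> has a polynomial
  solution, and \<open>\<bar>g'\<bar> \<le> F (1 - F) / flux\<close>, so the oscillation of \<open>2 / \<sigma>\<^sup>2 g\<close> is at most \<open>t_av\<close>. The Dynkin
  martingale of \<open>g\<close> on a grid of mesh at most 1 then has conditional increments in an interval of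
  length \<open>t_av + 1\<close>, and Hoeffding's lemma bounds the exponential moments of the occupation time.
  This bound is stable under bounded pointwise limits, hence passes to indicators of Borel sets.
\<close>

section \<open>The Jacobi operator and the Beta distribution\<close>

text \<open>Polynomials suffice because the operator is bidiagonal on monomials: it raises no degree
  and its diagonal vanishes only on constants, so Poisson's equation and \<open>L G = 1\<close>
  become recursions for coefficients. Being smooth up to 0 and 1, polynomials also carry the
  boundary behaviour. The quantity \<open>t_av\<close> enters a deviation bound because one density,
  \<open>F (1 - F) / flux\<close>, plays two parts: its integral gives the averaged hitting time,
  and it dominates the derivative of every Poisson solution. The main obstacle is that the Markov
  property is available at deterministic times only. Hitting times are therefore reached through the
  events \<open>s < \<tau>\<close>, which lie in the filtration at \<open>s\<close>, and through
  martingale sums over ever finer grids. Constants: \<open>t + 1\<close> bounds the number of grid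
  steps, the \<open>+ 1\<close> in the squared factor is the compensator over one step, and the
  amount subtracted from \<open>t \<epsilon>\<close> is the boundary term of the Poisson solution.
  The argument yields them with \<open>t_av\<close>; passing to \<open>4 t_av\<close> is a final
  monotonicity step.\<close>

text \<open>The generator divided by \<open>\<sigma>\<^sup>2 / 2\<close>, where \<open>p = 2 a / \<sigma>\<^sup>2\<close> and \<open>q = 2 (b - a) / \<sigma>\<^sup>2\<close>.\<close>

definition jacobi_op :: "real \<Rightarrow> real \<Rightarrow> real poly \<Rightarrow> real poly" where
  "jacobi_op p q u = [:p, -(p + q):] * pderiv u + [:0, 1, -1:] * pderiv (pderiv u)"

lemma poly_jacobi_op:
  "poly (jacobi_op p q u) x =
     (p - (p + q) * x) * poly (pderiv u) x + x * (1 - x) * poly (pderiv (pderiv u)) x"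
  by (simp add: jacobi_op_def algebra_simps)

lemma jacobi_op_add: "jacobi_op p q (u + v) = jacobi_op p q u + jacobi_op p q v"
  by (simp add: jacobi_op_def pderiv_add distrib_left del: mult_pCons_left)

lemma jacobi_op_smult: "jacobi_op p q (smult k u) = smult k (jacobi_op p q u)"
  by (simp add: jacobi_op_def pderiv_smult smult_add_right)

text \<open>The bidiagonal form on which all coefficient recursions rest. For
  \<open>p + q = 2 b / \<sigma>\<^sup>2\<close> the diagonal coefficient
  \<open>(n + 1) (p + q + n)\<close> is the eigenvalue of index \<open>n + 1\<close> divided by
  \<open>\<sigma>\<^sup>2 / 2\<close>.\<close>

lemma jacobi_op_monom_Suc:
  "jacobi_op p q (monom k (Suc n)) =
     monom (real (Suc n) * (p + real n) * k) n - monom (real (Suc n) * (p + q + real n) * k) (Suc n)"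
proof -
  have "poly (jacobi_op p q (monom k (Suc n))) x =
     poly (monom (real (Suc n) * (p + real n) * k) n - monom (real (Suc n) * (p + q + real n) * k) (Suc n)) x" for x
    by (cases n) (simp_all add: poly_jacobi_op pderiv_monom poly_monom algebra_simps)
  then show ?thesis
    by (simp add: poly_eq_poly_eq_iff[symmetric] fun_eq_iff)
qed
  
text \<open>The map \<open>z \<mapsto> 1 - z\<close> keeps the diffusion coefficient and exchanges
  the inward drifts at the two endpoints, hence the exchange of \<open>p\<close> and
  \<open>q\<close>.\<close>

lemma jacobi_op_reflect:
  "poly (jacobi_op p q (pcompose u [:1, -1:])) x = poly (jacobi_op q p u) (1 - x)"
  by (simp add: poly_jacobi_op pderiv_pcompose poly_pcompose pderiv_mult pderiv_pCons pderiv_minus algebra_simps)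

text \<open>Elimination from the top degree downwards: the diagonal coefficient is positive in every
  degree at least 1, so each such monomial can be removed and only a constant survives. That
  \<open>c\<close> is the mean of \<open>f\<close> is seen later.\<close>

lemma poisson_equation_solvable:
  assumes "p > 0" "q > 0"
  shows "\<exists>g c. jacobi_op p q g = f - [:c:]"
proof -
  have monom: "\<exists>g c. jacobi_op p q g = monom k n - [:c:]" for k n
  proof (induction n arbitrary: k)
    case 0
    then show ?case
      by (intro exI[of _ 0] exI[of _ k]) (simp add: jacobi_op_def monom_0)
  next
    case (Suc n)
    define l where "l = real (Suc n) * (p + q + real n)"
    have l: "l > 0" unfolding l_def using assms by (intro mult_pos_pos) auto
    \<comment> \<open>Here \<open>g\<close> absorbs the term of degree \<open>n\<close> that the
      correction \<open>- (k / l) x ^ (n + 1)\<close> creates.\<close>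
    obtain g c where g: "jacobi_op p q g = monom (real (Suc n) * (p + real n) * (k / l)) n - [:c:]"
      using Suc by blast
    have "jacobi_op p q (g + smult (-1) (monom (k / l) (Suc n))) = monom (l * (k / l)) (Suc n) - [:c:]"
      unfolding jacobi_op_add jacobi_op_smult g jacobi_op_monom_Suc l_def by simp
    then show ?case using l by auto
  qed
  have "\<exists>g c. jacobi_op p q g = (\<Sum>i\<le>n. monom (coeff f i) i) - [:c:]" for n
  proof (induction n)
    case 0
    then show ?case using monom by simp
  next
    case (Suc n)
    obtain g c where g: "jacobi_op p q g = (\<Sum>i\<le>n. monom (coeff f i) i) - [:c:]"
      using Suc by blast
    obtain g' c' where g': "jacobi_op p q g' = monom (coeff f (Suc n)) (Suc n) - [:c':]"
      using monom by blast
    show ?case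
      by (intro exI[of _ "g + g'"] exI[of _ "c + c'"])
        (simp add: jacobi_op_add g g' algebra_simps)
  qed
  from this[of "degree f"] show ?thesis
    by (simp add: poly_as_sum_of_monoms)
qed

lemma poly_bounded_unit: "\<exists>B\<ge>0. \<forall>x\<in>{0..1}. \<bar>poly (u :: real poly) x\<bar> \<le> B"
proof -
  have "compact (poly u ` {0..1})"
    by (intro compact_continuous_image continuous_intros) auto
  then obtain B where "\<forall>x\<in>{0..1}. norm (poly u x) \<le> B"
    by (meson bounded_iff compact_imp_bounded imageI)
  then show ?thesis by (intro exI[of _ "max 0 B"]) auto
qed

lemma borel_measurable_poly [measurable]: "poly (u :: real poly) \<in> borel_measurable borel"
  by (intro borel_measurable_continuous_onI continuous_intros)

section \<open>The Beta density in flux form and the derivative bound for Poisson solutions\<close>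

locale beta_params =
  fixes p q :: real
  assumes p_pos: "p > 0" and q_pos: "q > 0"
begin

definition rho :: "real \<Rightarrow> real" where
  "rho x = indicator {0<..<1} x * (x powr (p - 1) * (1 - x) powr (q - 1) / Beta p q)"

definition flux :: "real \<Rightarrow> real" where
  "flux x = x powr p * (1 - x) powr q / Beta p q"

definition \<pi> :: "real measure" where
  "\<pi> = density lborel (\<lambda>x. ennreal (rho x))"

definition beta_cdf :: "real \<Rightarrow> real" where
  "beta_cdf x = measure \<pi> {..x}"

lemma Beta_pos: "Beta p q > 0"
  using p_pos q_pos by (simp add: Beta_def Gamma_real_pos)

lemma rho_nonneg: "rho x \<ge> 0"
  using Beta_pos by (simp add: rho_def)

lemma rho_measurable [measurable]: "rho \<in> borel_measurable borel"
  unfolding rho_def by measurable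

lemma sets_\<pi> [measurable_cong, simp]: "sets \<pi> = sets borel"
  by (simp add: \<pi>_def)

lemma space_\<pi> [simp]: "space \<pi> = UNIV"
  by (simp add: \<pi>_def)

lemma nn_integral_rho: "(\<integral>\<^sup>+x. ennreal (rho x) \<partial>lborel) = 1"
proof -
  have "((\<lambda>x. x powr (p - 1) * (1 - x) powr (q - 1)) has_integral Beta p q) {0<..<1}"
    using has_integral_Beta_real[OF p_pos q_pos] by (simp add: has_integral_Icc_iff_Ioo)
  then have "((\<lambda>x. x powr (p - 1) * (1 - x) powr (q - 1) / Beta p q) has_integral (Beta p q / Beta p q)) {0<..<1}"
    by (rule has_integral_divide)
  then have "(\<integral>\<^sup>+x. ennreal (indicator {0<..<1} x * (x powr (p - 1) * (1 - x) powr (q - 1) / Beta p q)) \<partial>lborel)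
      = ennreal (Beta p q / Beta p q)"
    using Beta_pos by (intro nn_integral_has_integral_lebesgue) auto
  then show ?thesis using Beta_pos by (simp add: rho_def)
qed

sublocale pi: prob_space \<pi>
  by (rule prob_spaceI) (simp add: \<pi>_def emeasure_density nn_integral_rho)

lemma AE_\<pi>: "AE x in \<pi>. x \<in> {0<..<1}"
proof -
  have "AE x in lborel. 0 < ennreal (rho x) \<longrightarrow> x \<in> {0<..<1}"
    by (intro AE_I2) (simp add: rho_def indicator_def)
  then show ?thesis
    unfolding \<pi>_def by (subst AE_density) auto
qed

lemma integrable_poly [simp]: "integrable \<pi> (poly u)"
proof -
  obtain B where B: "\<And>x. x \<in> {0..1} \<Longrightarrow> \<bar>poly u x\<bar> \<le> B"
    using poly_bounded_unit[of u] by blast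
  show ?thesis
    by (rule pi.integrable_const_bound[where B = B])
      (auto intro!: eventually_mono[OF AE_\<pi>] B)
qed

lemma flux_nonneg: "flux x \<ge> 0"
  using Beta_pos by (simp add: flux_def)

lemma flux_pos: "0 < x \<Longrightarrow> x < 1 \<Longrightarrow> flux x > 0"
  using Beta_pos by (simp add: flux_def)

lemma flux_0 [simp]: "flux 0 = 0" and flux_1 [simp]: "flux 1 = 0"
  using p_pos q_pos by (simp_all add: flux_def)

text \<open>Pearson's equation of the Beta density; it makes \<open>rho * L u\<close> an exact
  derivative, namely that of \<open>flux * u'\<close>.\<close>

lemma flux_has_derivative:
  assumes "0 < x" "x < 1"
  shows "(flux has_real_derivative (p - (p + q) * x) * rho x) (at x)"
proof -
  have x: "x powr p = x * x powr (p - 1)" "(1 - x) powr q = (1 - x) * (1 - x) powr (q - 1)"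
    using assms by (simp_all add: powr_diff)
  show ?thesis
    unfolding flux_def rho_def using assms Beta_pos
    by (auto intro!: derivative_eq_intros simp: divide_simps x) (simp add: algebra_simps)?
qed

lemma continuous_on_flux: "continuous_on {0..1} flux"
  unfolding flux_def using p_pos q_pos Beta_pos
  by (intro continuous_intros continuous_on_powr') auto

lemma flux_rho: "x * (1 - x) * rho x = flux x" if "0 < x" "x < 1"
  using that by (simp add: rho_def flux_def powr_diff)

text \<open>The antiderivative of \<open>rho * L u\<close> is \<open>flux * u'\<close>, and
  \<open>flux\<close> vanishes at 0, so only the boundary term at \<open>z\<close> remains.\<close>

lemma flux_ftc:
  assumes "0 \<le> z" "z \<le> 1"
  shows "(\<integral>y. indicator {..z} y * poly (jacobi_op p q u) y \<partial>\<pi>) = flux z * poly (pderiv u) z"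
proof -
  let ?f = "\<lambda>x. rho x * poly (jacobi_op p q u) x"
  have "(?f has_integral flux z * poly (pderiv u) z - flux 0 * poly (pderiv u) 0) {0..z}"
  \<comment> \<open>At the endpoints \<open>rho\<close> may be unbounded and \<open>flux\<close>
    need not be differentiable; the interior form of the fundamental theorem asks only for
    continuity there.\<close>
  proof (rule fundamental_theorem_of_calculus_interior)
    show "continuous_on {0..z} (\<lambda>x. flux x * poly (pderiv u) x)"
      using assms by (intro continuous_intros continuous_on_subset[OF continuous_on_flux]) auto
    fix x assume x: "x \<in> {0<..<z}"
    show "((\<lambda>x. flux x * poly (pderiv u) x) has_vector_derivative ?f x) (at x)"
      unfolding has_real_derivative_iff_has_vector_derivative[symmetric]
      using x assms 
      by (auto intro!: derivative_eq_intros flux_has_derivative simp: poly_jacobi_op flux_rho[symmetric] algebra_simps)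
  qed fact
  moreover have int: "set_integrable lborel {0..z} ?f"
  proof -
    have "integrable lborel ?f"
      using integrable_poly[of "jacobi_op p q u"]
      unfolding \<pi>_def by (subst (asm) integrable_density) (auto simp: rho_nonneg)
    then show ?thesis unfolding set_integrable_def
      by (intro integrable_mult_indicator) auto
  qed
  ultimately have "(LINT x:{0..z}|lborel. ?f x) = flux z * poly (pderiv u) z"
    using set_borel_integral_eq_integral[OF int] by (simp add: integral_unique)
  also have "(LINT x:{0..z}|lborel. ?f x) = (LINT x|lborel. rho x * (indicator {..z} x * poly (jacobi_op p q u) x))"
    unfolding set_lebesgue_integral_def
    by (intro Bochner_Integration.integral_cong) (auto simp: rho_def indicator_def)
  also have "\<dots> = (\<integral>y. indicator {..z} y * poly (jacobi_op p q u) y \<partial>\<pi>)"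
    unfolding \<pi>_def by (subst integral_density) (auto simp: rho_nonneg)
  finally show ?thesis by simp
qed

text \<open>Since \<open>flux\<close> vanishes at 1 as well, this is the infinitesimal form of
  invariance of the Beta law on polynomials.\<close>

lemma integral_jacobi_op: "(\<integral>y. poly (jacobi_op p q u) y \<partial>\<pi>) = 0"
proof -
  have "(\<integral>y. poly (jacobi_op p q u) y \<partial>\<pi>) = (\<integral>y. indicator {..1} y * poly (jacobi_op p q u) y \<partial>\<pi>)"
    by (intro integral_cong_AE eventually_mono[OF AE_\<pi>]) auto
  then show ?thesis using flux_ftc[of 1 u] by simp
qed

text \<open>Split the mean of \<open>f\<close> into its parts \<open>I\<close> below and
  \<open>J\<close> above \<open>z\<close>. Then \<open>flux * g'\<close> becomes
  \<open>I (1 - F) - J F\<close>, a difference of two numbers in \<open>[0, F (1 - F)]\<close>, so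
  no factor 2 is lost.\<close>

lemma poisson_derivative_bound:
  assumes f: "\<And>x. x \<in> {0..1} \<Longrightarrow> 0 \<le> poly f x \<and> poly f x \<le> 1"
    and g: "jacobi_op p q g = f - [:c:]" and z: "0 \<le> z" "z \<le> 1"
  shows "c = (\<integral>y. poly f y \<partial>\<pi>)" "\<bar>flux z * poly (pderiv g) z\<bar> \<le> beta_cdf z * (1 - beta_cdf z)"
proof -
  have "(\<integral>y. poly f y - c \<partial>\<pi>) = 0"
    using integral_jacobi_op[of g] by (simp add: g del: Bochner_Integration.integral_diff)
  then show c: "c = (\<integral>y. poly f y \<partial>\<pi>)"
    using pi.prob_space by simp
  have i1: "integrable \<pi> (\<lambda>y. indicator {..z} y * poly f y)" 
    and i2: "integrable \<pi> (\<lambda>y. indicator {z<..} y * poly f y)"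
    using integrable_mult_indicator[OF _ integrable_poly] by auto
  define I J where "I = (\<integral>y. indicator {..z} y * poly f y \<partial>\<pi>)" 
    and "J = (\<integral>y. indicator {z<..} y * poly f y \<partial>\<pi>)"
  have cIJ: "c = I + J" unfolding c I_def J_def
    by (subst Bochner_Integration.integral_add[symmetric, OF i1 i2])
       (auto intro!: Bochner_Integration.integral_cong simp: indicator_def)
  have "flux z * poly (pderiv g) z = (\<integral>y. indicator {..z} y * poly f y - indicator {..z} y * c \<partial>\<pi>)"
    by (subst flux_ftc[symmetric]) (auto simp: z g algebra_simps)
  also have "\<dots> = I - beta_cdf z * c"
    by (subst Bochner_Integration.integral_diff[OF i1])
       (auto simp: I_def beta_cdf_def pi.emeasure_eq_measure intro!: integrable_mult_left integrable_real_indicator)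
  also have "\<dots> = I * (1 - beta_cdf z) - J * beta_cdf z"
    by (simp add: cIJ algebra_simps)
  finally have eq: "flux z * poly (pderiv g) z = I * (1 - beta_cdf z) - J * beta_cdf z" .
  have F: "0 \<le> beta_cdf z" "beta_cdf z \<le> 1" by (auto simp: beta_cdf_def)
  have f_AE: "AE y in \<pi>. 0 \<le> poly f y \<and> poly f y \<le> 1"
    using AE_\<pi> by eventually_elim (use f in auto)
  have ind: "integrable \<pi> (indicat_real A)" if "A \<in> sets borel" for A
    using that by (intro integrable_real_indicator) (auto simp: pi.emeasure_eq_measure)
  have I: "0 \<le> I"
    unfolding I_def using f_AE by (intro integral_nonneg_AE) (auto elim!: eventually_mono)
  have J: "0 \<le> J"
    unfolding J_def using f_AE by (intro integral_nonneg_AE) (auto elim!: eventually_mono)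
  have "I \<le> (\<integral>y. indicator {..z} y \<partial>\<pi>)"
    unfolding I_def
    by (intro integral_mono_AE i1 ind eventually_mono[OF f_AE]) (auto simp: indicator_def)
  then have I': "I \<le> beta_cdf z" by (simp add: beta_cdf_def)
  have "J \<le> (\<integral>y. indicator {z<..} y \<partial>\<pi>)"
    unfolding J_def
    by (intro integral_mono_AE i2 ind eventually_mono[OF f_AE]) (auto simp: indicator_def)
  also have "(\<integral>y. indicator {z<..} y \<partial>\<pi>) = 1 - beta_cdf z"
    unfolding beta_cdf_def using pi.prob_compl[of "{..z}"] by (simp add: Compl_eq_Diff_UNIV[symmetric])
  finally have J': "J \<le> 1 - beta_cdf z" .
  have "I * (1 - beta_cdf z) \<le> beta_cdf z * (1 - beta_cdf z)" "J * beta_cdf z \<le> (1 - beta_cdf z) * beta_cdf z" 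
    "0 \<le> I * (1 - beta_cdf z)" "0 \<le> J * beta_cdf z"
    using F I J I' J' by (auto intro!: mult_right_mono)
  then show "\<bar>flux z * poly (pderiv g) z\<bar> \<le> beta_cdf z * (1 - beta_cdf z)"
    unfolding eq by (simp add: abs_le_iff algebra_simps)
qed


section \<open>Distribution function of the Beta law, Green series and moments\<close>

lemma AE_\<pi>_neq: "AE y in \<pi>. y \<noteq> z"
  unfolding \<pi>_def using AE_lborel_singleton[of z]
  by (subst AE_density) (auto elim!: eventually_mono)

lemma beta_cdf_bounds: "0 \<le> beta_cdf z" "beta_cdf z \<le> 1"
  by (auto simp: beta_cdf_def)

lemma beta_cdf_measurable [measurable]: "beta_cdf \<in> borel_measurable borel"
  by (intro borel_measurable_mono monoI) (auto simp: beta_cdf_def intro!: pi.finite_measure_mono)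

lemma flux_measurable [measurable]: "flux \<in> borel_measurable borel"
  unfolding flux_def by measurable

lemma emeasure_\<pi>_greaterThan: "emeasure \<pi> {z<..} = ennreal (1 - beta_cdf z)"
  unfolding beta_cdf_def pi.emeasure_eq_measure
  using pi.prob_compl[of "{..z}"] by (simp add: Compl_eq_Diff_UNIV[symmetric])

lemma emeasure_\<pi>_atLeast: "emeasure \<pi> {z..} = ennreal (1 - beta_cdf z)"
proof -
  have "emeasure \<pi> {z..} = emeasure \<pi> {z<..}"
    by (intro emeasure_eq_AE eventually_mono[OF AE_\<pi>_neq[of z]]) auto
  then show ?thesis by (simp add: emeasure_\<pi>_greaterThan)
qed

text \<open>Solution of the recursion obtained by comparing coefficients in \<open>L G = 1\<close>;
  \<open>green_coeff n\<close> belongs to \<open>x ^ (n + 1)\<close>.\<close>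

definition green_coeff :: "nat \<Rightarrow> real" where
  "green_coeff n = pochhammer (p + q) n / (pochhammer p (Suc n) * real (Suc n))"

text \<open>Truncations of the power series solving \<open>L G = 1\<close>; the error is the single monomial
  \<open>green_rem N * x ^ N\<close>.\<close>

definition green_poly :: "nat \<Rightarrow> real poly" where
  "green_poly N = (\<Sum>n<N. monom (green_coeff n) (Suc n))"

definition green_rem :: "nat \<Rightarrow> real" where
  "green_rem N = pochhammer (p + q) N / pochhammer p N"

lemma green_coeff_pos: "0 < green_coeff n" and green_rem_pos: "0 < green_rem n"
  using p_pos q_pos by (auto simp: green_coeff_def green_rem_def intro!: divide_pos_pos mult_pos_pos pochhammer_pos)

lemma green_coeff_rem: "real (Suc n) * (p + real n) * green_coeff n = green_rem n"
proof -
  have "pochhammer p n > 0" "p + real n > 0" using p_pos by (auto intro: pochhammer_pos)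
  then show ?thesis
    by (simp add: green_coeff_def green_rem_def pochhammer_Suc divide_simps)
qed

lemma green_coeff_rem_Suc: "real (Suc n) * (p + q + real n) * green_coeff n = green_rem (Suc n)"
proof -
  have "pochhammer p n > 0" "p + real n > 0" using p_pos by (auto intro: pochhammer_pos)
  then show ?thesis
    by (simp add: green_coeff_def green_rem_def pochhammer_Suc divide_simps)
qed

text \<open>Telescoping: the top term of the image of one monomial cancels the low term of the next,
  as both have coefficient \<open>green_rem\<close>. The lowest term of all is the constant
  1.\<close>

lemma jacobi_op_green_poly: "jacobi_op p q (green_poly N) = 1 - monom (green_rem N) N"
proof (induction N)
  case 0
  then show ?case
    by (simp add: jacobi_op_def green_poly_def green_rem_def one_pCons monom_0)
next
  case (Suc N)
  have "jacobi_op p q (green_poly (Suc N)) = jacobi_op p q (green_poly N) + jacobi_op p q (monom (green_coeff N) (Suc N))"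
    by (simp add: green_poly_def jacobi_op_add)
  then show ?case
    unfolding jacobi_op_monom_Suc Suc green_coeff_rem green_coeff_rem_Suc by simp
qed

text \<open>The ratio of successive \<open>green_rem\<close> tends to 1, so the geometric factor
  wins at every \<open>z < 1\<close>.\<close>

lemma green_rem_tendsto:
  assumes "0 \<le> z" "z < 1"
  shows "(\<lambda>N. green_rem N * z ^ N) \<longlonglongrightarrow> 0"
proof -
  have "(\<lambda>n. (p + q + real n) / (p + real n) * z) \<longlonglongrightarrow> 1 * z"
    by (intro tendsto_mult tendsto_const) real_asymp
  then have "eventually (\<lambda>n. (p + q + real n) / (p + real n) * z < (1 + z) / 2) sequentially"
    using assms by (intro order_tendstoD) auto
  then obtain N0 where N0: "\<And>n. n \<ge> N0 \<Longrightarrow> (p + q + real n) / (p + real n) * z \<le> (1 + z) / 2"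
    unfolding eventually_sequentially by (meson less_imp_le)
  have "summable (\<lambda>N. green_rem N * z ^ N)"
  proof (rule summable_ratio_test[of "(1 + z) / 2" N0])
    fix n assume n: "n \<ge> N0"
    have "pochhammer p n > 0" "p + real n > 0" using p_pos by (auto intro: pochhammer_pos)
    then have "green_rem (Suc n) * z ^ Suc n = ((p + q + real n) / (p + real n) * z) * (green_rem n * z ^ n)"
      by (simp add: green_rem_def pochhammer_Suc mult_ac)
    also have "\<dots> \<le> (1 + z) / 2 * (green_rem n * z ^ n)"
      using N0[OF n] assms green_rem_pos[of n] by (intro mult_right_mono) auto
    finally show "norm (green_rem (Suc n) * z ^ Suc n) \<le> (1 + z) / 2 * norm (green_rem n * z ^ n)"
      using assms green_rem_pos[of n] green_rem_pos[of "Suc n"] by simp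
  qed (use assms in auto)
  then show ?thesis by (rule summable_LIMSEQ_zero)
qed

lemma poly_pderiv_green_poly: "poly (pderiv (green_poly N)) z = (\<Sum>n<N. real (Suc n) * green_coeff n * z ^ n)"
  by (induction N) (simp_all add: green_poly_def pderiv_add pderiv_monom poly_monom)

lemma pderiv_green_poly_nonneg: "0 \<le> z \<Longrightarrow> 0 \<le> poly (pderiv (green_poly N)) z"
  unfolding poly_pderiv_green_poly using green_coeff_pos by (intro sum_nonneg mult_nonneg_nonneg) (auto intro: less_imp_le)

lemma pderiv_green_poly_mono: "0 \<le> z \<Longrightarrow> incseq (\<lambda>N. poly (pderiv (green_poly N)) z)"
  unfolding poly_pderiv_green_poly using green_coeff_pos
  by (intro incseq_SucI) (auto intro!: mult_nonneg_nonneg simp: less_imp_le)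

text \<open>By \<open>flux_ftc\<close> the error \<open>flux * G_N' - F\<close> is minus the
  integral of the single remainder monomial over \<open>{..z}\<close>, hence at most
  \<open>green_rem N * z ^ N\<close> in absolute value.\<close>

lemma pderiv_green_poly_tendsto:
  assumes z: "0 < z" "z < 1"
  shows "(\<lambda>N. poly (pderiv (green_poly N)) z) \<longlonglongrightarrow> beta_cdf z / flux z"
proof -
  have "(\<lambda>N. flux z * poly (pderiv (green_poly N)) z - beta_cdf z) \<longlonglongrightarrow> 0"
  proof (rule tendsto_rabs_zero_cancel, rule tendsto_sandwich[OF _ _ tendsto_const green_rem_tendsto[of z]])
    have int: "integrable \<pi> (\<lambda>y. indicat_real {..z} y)"
      by (auto simp: pi.emeasure_eq_measure intro!: integrable_real_indicator)
    have "\<bar>flux z * poly (pderiv (green_poly N)) z - beta_cdf z\<bar> \<le> green_rem N * z ^ N" for N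
    proof -
      have "flux z * poly (pderiv (green_poly N)) z = (\<integral>y. indicat_real {..z} y * poly (jacobi_op p q (green_poly N)) y \<partial>\<pi>)"
        by (rule flux_ftc[symmetric]) (use z in auto)
      also have "\<dots> - beta_cdf z = (\<integral>y. indicat_real {..z} y * poly (jacobi_op p q (green_poly N)) y - indicat_real {..z} y \<partial>\<pi>)"
        using integrable_mult_indicator[OF _ integrable_poly, of "{..z}" "jacobi_op p q (green_poly N)"] int
        by (subst Bochner_Integration.integral_diff) (auto simp: beta_cdf_def)
      also have "\<dots> = (\<integral>y. - (indicat_real {..z} y * (green_rem N * y ^ N)) \<partial>\<pi>)"
        by (intro Bochner_Integration.integral_cong) (auto simp: jacobi_op_green_poly poly_monom indicator_def)
      also have "\<bar>\<dots>\<bar> \<le> (\<integral>y. green_rem N * z ^ N \<partial>\<pi>)"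
      proof (rule order_trans[OF integral_abs_bound], rule integral_mono_AE)
        have "integrable \<pi> (\<lambda>y. indicat_real {..z} y * poly (monom (green_rem N) N) y)"
          using integrable_mult_indicator[OF _ integrable_poly, of "{..z}" "monom (green_rem N) N"] by simp
        then show "integrable \<pi> (\<lambda>y. \<bar>- (indicat_real {..z} y * (green_rem N * y ^ N))\<bar>)"
          by (simp add: poly_monom)
        show "AE y in \<pi>. \<bar>- (indicat_real {..z} y * (green_rem N * y ^ N))\<bar> \<le> green_rem N * z ^ N"
          using green_rem_pos[of N] z
          by (intro eventually_mono[OF AE_\<pi>]) (auto simp: indicator_def abs_mult intro!: power_mono)
      qed simp
      finally show ?thesis using pi.prob_space by simp
    qed
    then show "\<forall>\<^sub>F N in sequentially. \<bar>flux z * poly (pderiv (green_poly N)) z - beta_cdf z\<bar> \<le> green_rem N * z ^ N" by simp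
  qed (use z in auto)
  then have "(\<lambda>N. flux z * poly (pderiv (green_poly N)) z) \<longlonglongrightarrow> beta_cdf z"
    by (simp add: LIM_zero_iff)
  then have "(\<lambda>N. flux z * poly (pderiv (green_poly N)) z / flux z) \<longlonglongrightarrow> beta_cdf z / flux z"
    by (intro tendsto_divide tendsto_const) (use flux_pos[of z] z in auto)
  then show ?thesis using flux_pos[of z] z by simp
qed

lemma integrable_power [simp]: "integrable \<pi> (\<lambda>y. y ^ n)"
  using integrable_poly[of "monom 1 n"] by (simp add: poly_monom[abs_def] del: integrable_poly)

lemma moment_Suc:
  "real (Suc n) * (p + q + real n) * (\<integral>y. y ^ Suc n \<partial>\<pi>) = real (Suc n) * (p + real n) * (\<integral>y. y ^ n \<partial>\<pi>)"
proof -
  have "(\<integral>y. (real (Suc n) * (p + real n)) * y ^ n - (real (Suc n) * (p + q + real n)) * y ^ Suc n \<partial>\<pi>) = 0"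
    using integral_jacobi_op[of "monom 1 (Suc n)"] unfolding jacobi_op_monom_Suc
    by (simp add: poly_monom del: Bochner_Integration.integral_diff)
  then show ?thesis
    by (subst (asm) Bochner_Integration.integral_diff) (auto simp del: power_Suc)
qed

text \<open>Invariance tested on \<open>x ^ (n + 1)\<close> gives a first-order recursion for the
  moments, reciprocal to that of \<open>green_rem\<close>.\<close>

lemma moment: "(\<integral>y. y ^ n \<partial>\<pi>) = 1 / green_rem n"
proof (induction n)
  case 0
  then show ?case using pi.prob_space by (simp add: green_rem_def)
next
  case (Suc n)
  have "pochhammer p n > 0" "p + real n > 0" "pochhammer (p + q) n > 0" "p + q + real n > 0" 
    using p_pos q_pos by (auto intro: pochhammer_pos)
  moreover from this have "(p + q + real n) * (\<integral>y. y ^ Suc n \<partial>\<pi>) = (p + real n) * (1 / green_rem n)"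
    using moment_Suc[of n] unfolding Suc mult.assoc by (subst (asm) mult_cancel_left) (simp del: power_Suc)
  ultimately show ?case
    by (simp add: green_rem_def pochhammer_Suc divide_simps mult_ac del: power_Suc of_nat_Suc)
qed

text \<open>In the product of \<open>green_coeff n\<close> with the moment of order
  \<open>n + 1\<close> the factor \<open>green_rem (n + 1)\<close> cancels, which leaves the inverse
  of the normalised eigenvalue of index \<open>n + 1\<close>.\<close>

lemma integral_green_poly: "(\<integral>y. poly (green_poly N) y \<partial>\<pi>) = (\<Sum>n<N. 1 / (real (Suc n) * (real n + p + q)))"
proof -
  have "(\<integral>y. poly (green_poly N) y \<partial>\<pi>) = (\<Sum>n<N. green_coeff n * (\<integral>y. y ^ Suc n \<partial>\<pi>))"
    unfolding green_poly_def poly_sum poly_monom by (subst Bochner_Integration.integral_sum) (auto simp del: power_Suc)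
  also have "\<dots> = (\<Sum>n<N. 1 / (real (Suc n) * (real n + p + q)))"
  proof (intro sum.cong refl)
    fix n
    have "p + q + real n > 0" using p_pos q_pos by simp
    then show "green_coeff n * (\<integral>y. y ^ Suc n \<partial>\<pi>) = 1 / (real (Suc n) * (real n + p + q))"
      using green_coeff_pos[of n] unfolding moment green_coeff_rem_Suc[symmetric] by (simp add: add_ac)
  qed
  finally show ?thesis .
qed

text \<open>The sum of the inverse nonzero eigenvalues of the negated normalised generator, with the
  index shifted to start at 0.\<close>

definition eigen_sum :: real where
  "eigen_sum = (\<Sum>n. 1 / (real (Suc n) * (real n + p + q)))"

lemma eigen_sum_sums: "(\<lambda>n. 1 / (real (Suc n) * (real n + p + q))) sums eigen_sum"
proof -
  have "(\<lambda>n. 1 / (real (Suc n) * (real n + p + q))) \<in> O(\<lambda>n. 1 / real n ^ 2)"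
    by real_asymp
  then have "summable (\<lambda>n. 1 / (real (Suc n) * (real n + p + q)))"
    by (rule summable_comparison_test_bigo[rotated]) (use inverse_power_summable[of 2, where 'a=real] in \<open>simp add: field_simps\<close>)
  then show ?thesis unfolding eigen_sum_def by (rule summable_sums)
qed

lemma eigen_sum_nonneg: "eigen_sum \<ge> 0"
  unfolding eigen_sum_def using p_pos q_pos eigen_sum_sums
  by (intro suminf_nonneg sums_summable[OF eigen_sum_sums]) auto


section \<open>Mean passage integrals and the oscillation of Poisson solutions\<close>

lemma nn_integral_pderiv_green_poly:
  assumes "0 \<le> x" "x \<le> y"
  shows "(\<integral>\<^sup>+z. ennreal (poly (pderiv (green_poly N)) z) * indicator {x..y} z \<partial>lborel) = ennreal (poly (green_poly N) y - poly (green_poly N) x)"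
  using assms by (intro nn_integral_FTC_Icc) (auto intro!: pderiv_green_poly_nonneg)

text \<open>Expected time to go up from \<open>x\<close> to \<open>y\<close>, resp. down from \<open>x\<close> to \<open>y\<close>, up to the factor \<open>2 / \<sigma>\<^sup>2\<close>.\<close>

definition mean_up :: "real \<Rightarrow> real \<Rightarrow> ennreal" where
  "mean_up x y = (\<integral>\<^sup>+z. ennreal (beta_cdf z / flux z) * indicator {x..y} z \<partial>lborel)"

definition mean_down :: "real \<Rightarrow> real \<Rightarrow> ennreal" where
  "mean_down x y = (\<integral>\<^sup>+z. ennreal ((1 - beta_cdf z) / flux z) * indicator {y..x} z \<partial>lborel)"

lemma green_poly_diff_tendsto:
  assumes "0 < x" "x \<le> y" "y < 1"
  shows "(\<lambda>N. ennreal (poly (green_poly N) y - poly (green_poly N) x)) \<longlonglongrightarrow> mean_up x y"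
proof -
  have "(\<lambda>N. \<integral>\<^sup>+z. ennreal (poly (pderiv (green_poly N)) z) * indicator {x..y} z \<partial>lborel) \<longlonglongrightarrow> mean_up x y"
    unfolding mean_up_def
  proof (rule nn_integral_LIMSEQ)
    show "incseq (\<lambda>i z. ennreal (poly (pderiv (green_poly i)) z) * indicator {x..y} z)"
      using assms pderiv_green_poly_mono
      by (auto simp: incseq_def le_fun_def indicator_def intro!: ennreal_leI)
    show "(\<lambda>i. ennreal (poly (pderiv (green_poly i)) z) * indicator {x..y} z) \<longlonglongrightarrow> ennreal (beta_cdf z / flux z) * indicator {x..y} z" for z
      using assms pderiv_green_poly_tendsto[of z] by (cases "z \<in> {x..y}") (auto intro: tendsto_ennrealI)
  qed simp
  then show ?thesis
    using assms by (simp add: nn_integral_pderiv_green_poly)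
qed

text \<open>The form in which Dynkin's formula consumes the Green series: test polynomials with
  generator nearly 1, uniformly on \<open>{0..y}\<close>, the region a path from below visits before
  it reaches \<open>y\<close>. Closer to 1 the remainder is not controlled.\<close>

lemma mean_up_approximation:
  assumes "0 < x" "x \<le> y" "y < 1"
  shows "\<exists>u \<delta>. \<delta> \<longlonglongrightarrow> 0 \<and> (\<forall>n. \<forall>z\<in>{0..y}. \<bar>poly (jacobi_op p q (u n)) z - 1\<bar> \<le> \<delta> n) \<and>
    (\<lambda>n::nat. ennreal (poly (u n) y - poly (u n) x)) \<longlonglongrightarrow> mean_up x y"
proof (intro exI conjI allI ballI)
  show "(\<lambda>N. green_rem N * y ^ N) \<longlonglongrightarrow> 0" using assms by (intro green_rem_tendsto) auto
  show "(\<lambda>N. ennreal (poly (green_poly N) y - poly (green_poly N) x)) \<longlonglongrightarrow> mean_up x y" using assms by (rule green_poly_diff_tendsto)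
  show "\<bar>poly (jacobi_op p q (green_poly n)) z - 1\<bar> \<le> green_rem n * y ^ n" if "z \<in> {0..y}" for z n
    using that green_rem_pos[of n]
    by (auto simp: jacobi_op_green_poly poly_monom abs_mult intro!: power_mono)
qed

text \<open>This identity serves twice: it evaluates the averaged hitting time, and it bounds the
  oscillation of Poisson solutions independently of \<open>f\<close>.\<close>

lemma nn_integral_hitting_density:
  "(\<integral>\<^sup>+z. ennreal (beta_cdf z * (1 - beta_cdf z) / flux z) * indicator {0<..<1} z \<partial>lborel) = ennreal eigen_sum"
proof (rule LIMSEQ_unique)
  have "(\<lambda>N. \<integral>\<^sup>+z. ennreal (poly (pderiv (green_poly N)) z * (1 - beta_cdf z)) * indicator {0<..<1} z \<partial>lborel) \<longlonglongrightarrow>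
      (\<integral>\<^sup>+z. ennreal (beta_cdf z / flux z * (1 - beta_cdf z)) * indicator {0<..<1} z \<partial>lborel)"
  proof (rule nn_integral_LIMSEQ)
    show "incseq (\<lambda>i z. ennreal (poly (pderiv (green_poly i)) z * (1 - beta_cdf z)) * indicator {0<..<1} z)"
      using pderiv_green_poly_mono beta_cdf_bounds
      by (auto simp: incseq_def le_fun_def indicator_def intro!: ennreal_leI mult_right_mono)
    show "(\<lambda>i. ennreal (poly (pderiv (green_poly i)) z * (1 - beta_cdf z)) * indicator {0<..<1} z) \<longlonglongrightarrow>
        ennreal (beta_cdf z / flux z * (1 - beta_cdf z)) * indicator {0<..<1} z" for z
      using pderiv_green_poly_tendsto[of z]
      by (cases "z \<in> {0<..<1}") (auto intro!: tendsto_ennrealI tendsto_mult simp del: times_divide_eq_left)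
  qed simp
  also have "(\<lambda>N. \<integral>\<^sup>+z. ennreal (poly (pderiv (green_poly N)) z * (1 - beta_cdf z)) * indicator {0<..<1} z \<partial>lborel) =
     (\<lambda>N. ennreal (\<Sum>n<N. 1 / (real (Suc n) * (real n + p + q))))"
  proof
    fix N
    \<comment> \<open>The factor \<open>1 - F z\<close> is the mass of \<open>{z..}\<close>; after
      exchanging the integrals the inner one is \<open>G_N y\<close>, as
      \<open>G_N 0 = 0\<close>.\<close>
    have "(\<integral>\<^sup>+z. ennreal (poly (pderiv (green_poly N)) z * (1 - beta_cdf z)) * indicator {0<..<1} z \<partial>lborel) =
       (\<integral>\<^sup>+z. (\<integral>\<^sup>+y. ennreal (poly (pderiv (green_poly N)) z) * indicator {0<..<1} z * (if z \<le> y then 1 else 0) \<partial>\<pi>) \<partial>lborel)"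
    proof (intro nn_integral_cong)
      fix z :: real
      have "(\<integral>\<^sup>+y. (if z \<le> y then 1 else 0) \<partial>\<pi>) = (\<integral>\<^sup>+y. indicator {z..} y \<partial>\<pi>)"
        by (intro nn_integral_cong) auto
      also have "\<dots> = ennreal (1 - beta_cdf z)" by (simp add: emeasure_\<pi>_atLeast)
      finally show "ennreal (poly (pderiv (green_poly N)) z * (1 - beta_cdf z)) * indicator {0<..<1} z =
        (\<integral>\<^sup>+y. ennreal (poly (pderiv (green_poly N)) z) * indicator {0<..<1} z * (if z \<le> y then 1 else 0) \<partial>\<pi>)"
        using pderiv_green_poly_nonneg[of z N] beta_cdf_bounds[of z]
        by (subst nn_integral_cmult) (auto simp: ennreal_mult indicator_def)
    qed
    also have "\<dots> = (\<integral>\<^sup>+y. (\<integral>\<^sup>+z. ennreal (poly (pderiv (green_poly N)) z) * indicator {0<..<1} z * (if z \<le> y then 1 else 0) \<partial>lborel) \<partial>\<pi>)"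
    proof -
      interpret pair_sigma_finite \<pi> "lborel :: real measure" ..
      show ?thesis by (rule Fubini') measurable
    qed
    also have "\<dots> = (\<integral>\<^sup>+y. ennreal (poly (green_poly N) y) \<partial>\<pi>)"
    proof (rule nn_integral_cong_AE, rule eventually_mono[OF AE_\<pi>])
      fix y :: real assume y: "y \<in> {0<..<1}"
      have "(\<integral>\<^sup>+z. ennreal (poly (pderiv (green_poly N)) z) * indicator {0<..<1} z * (if z \<le> y then 1 else 0) \<partial>lborel) =
        (\<integral>\<^sup>+z. ennreal (poly (pderiv (green_poly N)) z) * indicator {0..y} z \<partial>lborel)"
        using y by (intro nn_integral_cong_AE eventually_mono[OF AE_lborel_singleton[of "0::real"]]) (auto simp: indicator_def)
      also have "\<dots> = ennreal (poly (green_poly N) y)"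
        using y by (simp add: nn_integral_pderiv_green_poly) (simp add: green_poly_def poly_sum poly_monom)
      finally show "(\<integral>\<^sup>+z. ennreal (poly (pderiv (green_poly N)) z) * indicator {0<..<1} z * (if z \<le> y then 1 else 0) \<partial>lborel) = 
        ennreal (poly (green_poly N) y)" .
    qed
    also have "\<dots> = ennreal (\<integral>y. poly (green_poly N) y \<partial>\<pi>)"
      using green_coeff_pos
      by (intro nn_integral_eq_integral integrable_poly eventually_mono[OF AE_\<pi>])
        (auto simp: green_poly_def poly_sum poly_monom less_imp_le intro!: sum_nonneg mult_nonneg_nonneg)
    finally show "(\<integral>\<^sup>+z. ennreal (poly (pderiv (green_poly N)) z * (1 - beta_cdf z)) * indicator {0<..<1} z \<partial>lborel) =
      ennreal (\<Sum>n<N. 1 / (real (Suc n) * (real n + p + q)))"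
      by (simp add: integral_green_poly)
  qed
  finally show "(\<lambda>N. ennreal (\<Sum>n<N. 1 / (real (Suc n) * (real n + p + q)))) \<longlonglongrightarrow>
     (\<integral>\<^sup>+z. ennreal (beta_cdf z * (1 - beta_cdf z) / flux z) * indicator {0<..<1} z \<partial>lborel)"
    by simp
  show "(\<lambda>N. ennreal (\<Sum>n<N. 1 / (real (Suc n) * (real n + p + q)))) \<longlonglongrightarrow> ennreal eigen_sum"
    using eigen_sum_sums by (intro tendsto_ennrealI) (simp add: sums_def)
qed

text \<open>The pointwise bound on \<open>g'\<close> integrates over all of \<open>(0, 1)\<close> to
  \<open>eigen_sum\<close>, whatever \<open>f\<close> is.\<close>

lemma poisson_solution_oscillation:
  assumes f: "\<And>x. x \<in> {0..1} \<Longrightarrow> 0 \<le> poly f x \<and> poly f x \<le> 1"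
    and g: "jacobi_op p q g = f - [:c:]" and x: "0 \<le> x" "x \<le> 1" and y: "0 \<le> y" "y \<le> 1"
  shows "\<bar>poly g y - poly g x\<bar> \<le> eigen_sum"
  using x y
proof (induction x y rule: linorder_wlog)
  case (le x y)
  have *: "has_bochner_integral lborel (\<lambda>z. poly (pderiv g) z * indicator {x..y} z) (poly g y - poly g x)"
    using le by (intro has_bochner_integral_FTC_Icc_real) (auto intro!: derivative_eq_intros continuous_intros)
  have "ennreal \<bar>poly g y - poly g x\<bar> = ennreal (norm (\<integral>z. poly (pderiv g) z * indicator {x..y} z \<partial>lborel))"
    using * by (simp add: has_bochner_integral_iff)
  also have "\<dots> \<le> (\<integral>\<^sup>+z. norm (poly (pderiv g) z * indicator {x..y} z) \<partial>lborel)"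
    using * by (intro integral_norm_bound_ennreal) (simp add: has_bochner_integral_iff)
  also have "\<dots> \<le> (\<integral>\<^sup>+z. ennreal (beta_cdf z * (1 - beta_cdf z) / flux z) * indicator {0<..<1} z \<partial>lborel)"
  proof (intro nn_integral_mono_AE)
    show "AE z in lborel. ennreal (norm (poly (pderiv g) z * indicator {x..y} z)) \<le> 
       ennreal (beta_cdf z * (1 - beta_cdf z) / flux z) * indicator {0<..<1} z"
      \<comment> \<open>At 0 and 1 \<open>flux\<close> is 0 and the derivative bound cannot be
        divided by it; the two points form a null set.\<close>
      using AE_lborel_singleton[of "0::real"] AE_lborel_singleton[of "1::real"]
    proof eventually_elim
      case (elim z)
      show ?case
      proof (cases "z \<in> {x..y}")
        case True
        then have z: "0 < z" "z < 1" using le elim by auto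
        have "\<bar>poly (pderiv g) z\<bar> * flux z \<le> beta_cdf z * (1 - beta_cdf z)"
          using poisson_derivative_bound(2)[OF f g, of z] z by (simp add: abs_mult flux_nonneg mult.commute)
        then have "\<bar>poly (pderiv g) z\<bar> \<le> beta_cdf z * (1 - beta_cdf z) / flux z"
          using flux_pos[OF z] by (simp add: pos_le_divide_eq)
        then show ?thesis using z True by (simp add: ennreal_leI)
      qed auto
    qed
  qed
  also have "\<dots> = ennreal eigen_sum" by (rule nn_integral_hitting_density)
  finally show ?case using eigen_sum_nonneg by simp
next
  case (sym x y)
  then show ?case by (simp add: abs_minus_commute)
qed

end

section \<open>Reflection, which exchanges \<open>p\<close> and \<open>q\<close>, and the averaged
  hitting mean\<close>

sublocale beta_params \<subseteq> swap: beta_params q p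
  by unfold_locales (rule q_pos p_pos)+

context beta_params begin

lemma swap_rho: "swap.rho x = rho (1 - x)"
  unfolding swap.rho_def rho_def by (auto simp: indicator_def Beta_commute[of q p] mult.commute)

lemma swap_flux: "swap.flux x = flux (1 - x)"
  unfolding swap.flux_def flux_def by (simp add: Beta_commute[of q p] mult.commute)

text \<open>The half-line \<open>{..x}\<close> is mirrored to \<open>{1 - x..}\<close>, whose mass
  is \<open>1 - F (1 - x)\<close> because the Beta law has no atoms.\<close>

lemma swap_beta_cdf: "swap.beta_cdf x = 1 - beta_cdf (1 - x)"
proof -
  have "ennreal (swap.beta_cdf x) = (\<integral>\<^sup>+y. ennreal (swap.rho y) * indicator {..x} y \<partial>lborel)"
    unfolding swap.beta_cdf_def swap.pi.emeasure_eq_measure[symmetric]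
    unfolding swap.\<pi>_def by (subst emeasure_density) auto
  also have "\<dots> = (\<integral>\<^sup>+y. ennreal (rho (1 - y)) * indicator {..x} y \<partial>lborel)"
    by (simp add: swap_rho)
  also have "\<dots> = (\<integral>\<^sup>+y. ennreal (rho y) * indicator {1 - x..} y \<partial>lborel)"
    by (subst nn_integral_real_affine[where c="-1" and t=1]) (auto intro!: nn_integral_cong simp: indicator_def)
  also have "\<dots> = ennreal (1 - beta_cdf (1 - x))"
    unfolding emeasure_\<pi>_atLeast[symmetric] unfolding \<pi>_def by (subst emeasure_density) auto
  finally show ?thesis
    using swap.beta_cdf_bounds[of x] beta_cdf_bounds[of "1 - x"] by simp
qed

lemma swap_mean_up: "swap.mean_up (1 - x) (1 - y) = mean_down x y"
  unfolding swap.mean_up_def mean_down_def swap_beta_cdf swap_flux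
  by (subst nn_integral_real_affine[where c="-1" and t=1]) (auto intro!: nn_integral_cong simp: indicator_def)

lemma mean_down_approximation:
  assumes "0 < y" "y \<le> x" "x < 1"
  shows "\<exists>u \<delta>. \<delta> \<longlonglongrightarrow> 0 \<and> (\<forall>n. \<forall>z\<in>{y..1}. \<bar>poly (jacobi_op p q (u n)) z - 1\<bar> \<le> \<delta> n) \<and>
    (\<lambda>n::nat. ennreal (poly (u n) y - poly (u n) x)) \<longlonglongrightarrow> mean_down x y"
proof -
  obtain u \<delta> where u: "\<delta> \<longlonglongrightarrow> 0" "\<forall>n. \<forall>z\<in>{0..1 - y}. \<bar>poly (jacobi_op q p (u n)) z - 1\<bar> \<le> \<delta> n"
    "(\<lambda>n::nat. ennreal (poly (u n) (1 - y) - poly (u n) (1 - x))) \<longlonglongrightarrow> swap.mean_up (1 - x) (1 - y)"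
    using swap.mean_up_approximation[of "1 - x" "1 - y"] assms by auto
  show ?thesis
    using u by (intro exI[of _ "\<lambda>n. pcompose (u n) [:1, -1:]"] exI[of _ \<delta>])
      (auto simp: jacobi_op_reflect poly_pcompose swap_mean_up)
qed

definition hitting_mean :: "real \<Rightarrow> real \<Rightarrow> ennreal" where
  "hitting_mean x y = (if x \<le> y then mean_up x y else mean_down x y)"

text \<open>Both one-sided terms may be kept at once: for \<open>x \<noteq> y\<close> one of the
  intervals is empty, and for \<open>x = y\<close> both are null sets. The symmetric form yields
  joint measurability and is ready for Tonelli.\<close>

lemma hitting_mean_eq:
  "hitting_mean x y = (\<integral>\<^sup>+z. ennreal (beta_cdf z / flux z) * (if x \<le> z \<and> z \<le> y then 1 else 0) +
      ennreal ((1 - beta_cdf z) / flux z) * (if y \<le> z \<and> z \<le> x then 1 else 0) \<partial>lborel)"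
proof -
  have "hitting_mean x y = (\<integral>\<^sup>+z. ennreal (beta_cdf z / flux z) * indicator {x..y} z +
      ennreal ((1 - beta_cdf z) / flux z) * indicator {y..x} z \<partial>lborel)"
  proof (cases "x \<le> y")
    case True
    have "mean_up x y = (\<integral>\<^sup>+z. ennreal (beta_cdf z / flux z) * indicator {x..y} z +
      ennreal ((1 - beta_cdf z) / flux z) * indicator {y..x} z \<partial>lborel)"
      unfolding mean_up_def
      using True by (intro nn_integral_cong_AE eventually_mono[OF AE_lborel_singleton[of x]]) (auto simp: indicator_def)
    then show ?thesis using True by (simp add: hitting_mean_def)
  next
    case False
    then show ?thesis by (simp add: hitting_mean_def mean_down_def)
  qed
  also have "\<dots> = (\<integral>\<^sup>+z. ennreal (beta_cdf z / flux z) * (if x \<le> z \<and> z \<le> y then 1 else 0) +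
      ennreal ((1 - beta_cdf z) / flux z) * (if y \<le> z \<and> z \<le> x then 1 else 0) \<partial>lborel)"
    by (intro nn_integral_cong) (simp add: indicator_def)
  finally show ?thesis .
qed

lemma hitting_mean_measurable [measurable]:
  "(\<lambda>z. hitting_mean (fst z) (snd z)) \<in> borel_measurable (borel \<Otimes>\<^sub>M borel)"
  unfolding hitting_mean_eq by measurable

text \<open>For fixed \<open>z\<close> the pairs straddling \<open>z\<close> in either order have
  mass \<open>F (1 - F)\<close>; upward ones carry the weight \<open>F / flux\<close>, downward ones
  \<open>(1 - F) / flux\<close>, and the weights add up to \<open>1 / flux\<close>.\<close>

lemma average_hitting_mean: "(\<integral>\<^sup>+z. hitting_mean (fst z) (snd z) \<partial>(\<pi> \<Otimes>\<^sub>M \<pi>)) = ennreal eigen_sum"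
proof -
  interpret pp: pair_sigma_finite \<pi> \<pi> ..
  interpret pl: pair_sigma_finite "\<pi> \<Otimes>\<^sub>M \<pi>" "lborel :: real measure" ..
  let ?h = "\<lambda>w z. ennreal (beta_cdf z / flux z) * (if fst w \<le> z \<and> z \<le> snd w then 1 else 0) +
      ennreal ((1 - beta_cdf z) / flux z) * (if snd w \<le> z \<and> z \<le> fst w then 1 else 0)"
  have "(\<integral>\<^sup>+z. hitting_mean (fst z) (snd z) \<partial>(\<pi> \<Otimes>\<^sub>M \<pi>)) = (\<integral>\<^sup>+w. (\<integral>\<^sup>+z. ?h w z \<partial>lborel) \<partial>(\<pi> \<Otimes>\<^sub>M \<pi>))"
    by (simp add: hitting_mean_eq)
  also have "\<dots> = (\<integral>\<^sup>+z. (\<integral>\<^sup>+w. ?h w z \<partial>(\<pi> \<Otimes>\<^sub>M \<pi>)) \<partial>lborel)"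
    by (rule pl.Fubini'[symmetric]) measurable
  also have "\<dots> = (\<integral>\<^sup>+z. ennreal (beta_cdf z * (1 - beta_cdf z) / flux z) * indicator {0<..<1} z \<partial>lborel)"
  proof (intro nn_integral_cong)
    fix z :: real
    have *: "(\<integral>\<^sup>+w. (if fst w \<le> z \<and> z \<le> snd w then 1 else 0) \<partial>(\<pi> \<Otimes>\<^sub>M \<pi>)) = ennreal (beta_cdf z) * ennreal (1 - beta_cdf z)"
      "(\<integral>\<^sup>+w. (if snd w \<le> z \<and> z \<le> fst w then 1 else 0) \<partial>(\<pi> \<Otimes>\<^sub>M \<pi>)) = ennreal (1 - beta_cdf z) * ennreal (beta_cdf z)"
    proof -
      have "(\<integral>\<^sup>+w. (if fst w \<le> z \<and> z \<le> snd w then 1 else 0) \<partial>(\<pi> \<Otimes>\<^sub>M \<pi>)) = (\<integral>\<^sup>+w. indicator ({..z} \<times> {z..}) w \<partial>(\<pi> \<Otimes>\<^sub>M \<pi>))"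
        by (intro nn_integral_cong) (auto simp: indicator_def)
      also have "\<dots> = emeasure \<pi> {..z} * emeasure \<pi> {z..}"
        by (simp add: pi.emeasure_pair_measure_Times)
      finally show "(\<integral>\<^sup>+w. (if fst w \<le> z \<and> z \<le> snd w then 1 else 0) \<partial>(\<pi> \<Otimes>\<^sub>M \<pi>)) = ennreal (beta_cdf z) * ennreal (1 - beta_cdf z)"
        unfolding emeasure_\<pi>_atLeast by (simp add: beta_cdf_def pi.emeasure_eq_measure)
      have "(\<integral>\<^sup>+w. (if snd w \<le> z \<and> z \<le> fst w then 1 else 0) \<partial>(\<pi> \<Otimes>\<^sub>M \<pi>)) = (\<integral>\<^sup>+w. indicator ({z..} \<times> {..z}) w \<partial>(\<pi> \<Otimes>\<^sub>M \<pi>))"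
        by (intro nn_integral_cong) (auto simp: indicator_def)
      also have "\<dots> = emeasure \<pi> {z..} * emeasure \<pi> {..z}"
        by (simp add: pi.emeasure_pair_measure_Times)
      finally show "(\<integral>\<^sup>+w. (if snd w \<le> z \<and> z \<le> fst w then 1 else 0) \<partial>(\<pi> \<Otimes>\<^sub>M \<pi>)) = ennreal (1 - beta_cdf z) * ennreal (beta_cdf z)"
        unfolding emeasure_\<pi>_atLeast by (simp add: beta_cdf_def pi.emeasure_eq_measure)
    qed
    have F: "0 \<le> beta_cdf z" "0 \<le> 1 - beta_cdf z" "0 \<le> flux z" using beta_cdf_bounds flux_nonneg by auto
    have "(\<integral>\<^sup>+w. ?h w z \<partial>(\<pi> \<Otimes>\<^sub>M \<pi>)) = ennreal (beta_cdf z / flux z) * (ennreal (beta_cdf z) * ennreal (1 - beta_cdf z)) + 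
        ennreal ((1 - beta_cdf z) / flux z) * (ennreal (1 - beta_cdf z) * ennreal (beta_cdf z))"
      by (subst nn_integral_add, measurable, subst (1 2) nn_integral_cmult, measurable, simp add: *)
    also have "\<dots> = ennreal (beta_cdf z / flux z * (beta_cdf z * (1 - beta_cdf z)) + (1 - beta_cdf z) / flux z * ((1 - beta_cdf z) * beta_cdf z))"
      using F by (simp add: ennreal_mult ennreal_plus del: times_divide_eq_left)
    also have "beta_cdf z / flux z * (beta_cdf z * (1 - beta_cdf z)) + (1 - beta_cdf z) / flux z * ((1 - beta_cdf z) * beta_cdf z) = 
       beta_cdf z * (1 - beta_cdf z) / flux z"
      by (cases "flux z = 0") (auto simp: field_simps)
    also have "\<dots> = beta_cdf z * (1 - beta_cdf z) / flux z * indicator {0<..<1} z"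
    proof (cases "z \<in> {0<..<1}")
      case False
      have "beta_cdf z = 0 \<or> beta_cdf z = 1"
      proof (cases "z \<le> 0")
        case True
        have "measure \<pi> {..z} = measure \<pi> {}"
          using True by (intro measure_eq_AE eventually_mono[OF AE_\<pi>]) auto
        then show ?thesis by (simp add: beta_cdf_def)
      next
        case pos: False
        have "measure \<pi> {..z} = measure \<pi> (space \<pi>)"
          using pos False by (intro measure_eq_AE eventually_mono[OF AE_\<pi>]) auto
        then show ?thesis using pi.prob_space by (simp add: beta_cdf_def)
      qed
      then show ?thesis by auto
    qed auto
    finally show "(\<integral>\<^sup>+w. ?h w z \<partial>(\<pi> \<Otimes>\<^sub>M \<pi>)) = ennreal (beta_cdf z * (1 - beta_cdf z) / flux z) * indicator {0<..<1} z"
      by (auto simp: indicator_def)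
  qed
  also have "\<dots> = ennreal eigen_sum" by (rule nn_integral_hitting_density)
  finally show ?thesis .
qed

end

section \<open>Dynkin's formula\<close>

text \<open>Progressive measurability, by freezing the path on a grid of mesh
  \<open>1 / (n + 1)\<close>. Clamping times to \<open>{0..T}\<close> lets \<open>N\<close> be the
  filtration at \<open>T\<close>, which knows nothing of later times.\<close>

lemma borel_measurable_path_pair:
  fixes Y :: "real \<Rightarrow> 'w \<Rightarrow> real"
  assumes T: "0 \<le> T"
    and meas: "\<And>t. 0 \<le> t \<Longrightarrow> t \<le> T \<Longrightarrow> Y t \<in> borel_measurable N"
    and cont: "\<And>\<omega>. \<omega> \<in> space N \<Longrightarrow> continuous_on {0..T} (\<lambda>t. Y t \<omega>)"
  shows "(\<lambda>(t, \<omega>). Y (max 0 (min T t)) \<omega>) \<in> borel_measurable (borel \<Otimes>\<^sub>M N)"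
proof -
  define c where "c t = max 0 (min T t)" for t
  have c_cont: "continuous_on UNIV c" unfolding c_def by (intro continuous_intros)
  have c_meas [measurable]: "c \<in> borel_measurable borel" unfolding c_def by measurable
  have c_range: "c t \<in> {0..T}" for t using T by (auto simp: c_def)
  \<comment> \<open>The outer clamp keeps the time in \<open>{0..T}\<close> for every integer the
    floor might take, as the countable composition asks for measurability at each of them.\<close>
  define g where "g n z = Y (c (real_of_int \<lfloor>real (Suc n) * c (fst z)\<rfloor> / real (Suc n))) (snd z)" for n and z :: "real \<times> 'w"
  have "(\<lambda>z. Y (c (fst z)) (snd z)) \<in> borel_measurable (borel \<Otimes>\<^sub>M N)"
  proof (rule borel_measurable_LIMSEQ_metric)
    fix n
    show "g n \<in> borel_measurable (borel \<Otimes>\<^sub>M N)"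
      unfolding g_def
    proof (rule measurable_compose_countable[where g = "\<lambda>z. \<lfloor>real (Suc n) * c (fst z)\<rfloor>"])
      fix i :: int
      have [measurable]: "Y (c (real_of_int i / real (Suc n))) \<in> borel_measurable N"
        using c_range[of "real_of_int i / real (Suc n)"] by (intro meas) auto
      show "(\<lambda>z. Y (c (real_of_int i / real (Suc n))) (snd z)) \<in> borel_measurable (borel \<Otimes>\<^sub>M N)"
        by measurable
    qed measurable
  next
    fix z assume "z \<in> space ((borel :: real measure) \<Otimes>\<^sub>M N)"
    then have z: "snd z \<in> space N" by (auto simp: space_pair_measure)
    have "(\<lambda>n. real_of_int \<lfloor>real (Suc n) * c (fst z)\<rfloor> / real (Suc n)) \<longlonglongrightarrow> c (fst z)"
    proof (rule tendsto_sandwich[of "\<lambda>n. c (fst z) - 1 / real (Suc n)" _ _ "\<lambda>n. c (fst z)"])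
      show "\<forall>\<^sub>F n in sequentially. c (fst z) - 1 / real (Suc n) \<le> real_of_int \<lfloor>real (Suc n) * c (fst z)\<rfloor> / real (Suc n)"
      proof (rule always_eventually, rule allI)
        fix n
        have "real (Suc n) * c (fst z) - 1 \<le> real_of_int \<lfloor>real (Suc n) * c (fst z)\<rfloor>" by linarith
        then show "c (fst z) - 1 / real (Suc n) \<le> real_of_int \<lfloor>real (Suc n) * c (fst z)\<rfloor> / real (Suc n)"
          by (simp add: pos_le_divide_eq right_diff_distrib mult.commute[of _ "real (Suc n)"] del: of_nat_Suc)
      qed
      show "\<forall>\<^sub>F n in sequentially. real_of_int \<lfloor>real (Suc n) * c (fst z)\<rfloor> / real (Suc n) \<le> c (fst z)"
      proof (rule always_eventually, rule allI)
        fix n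
        have "real_of_int \<lfloor>real (Suc n) * c (fst z)\<rfloor> \<le> real (Suc n) * c (fst z)" by linarith
        then show "real_of_int \<lfloor>real (Suc n) * c (fst z)\<rfloor> / real (Suc n) \<le> c (fst z)"
          by (simp add: pos_divide_le_eq mult.commute del: of_nat_Suc)
      qed
      have "(\<lambda>n. 1 / real (Suc n)) \<longlonglongrightarrow> 0" by (rule LIMSEQ_Suc[OF lim_1_over_n])
      then have "(\<lambda>n. c (fst z) - 1 / real (Suc n)) \<longlonglongrightarrow> c (fst z) - 0" by (intro tendsto_intros)
      then show "(\<lambda>n. c (fst z) - 1 / real (Suc n)) \<longlonglongrightarrow> c (fst z)" by simp
    qed simp
    then have "(\<lambda>n. c (real_of_int \<lfloor>real (Suc n) * c (fst z)\<rfloor> / real (Suc n))) \<longlonglongrightarrow> c (c (fst z))"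
      using c_cont by (auto simp: continuous_on_sequentially o_def)
    also have "c (c (fst z)) = c (fst z)" using c_range[of "fst z"] by (auto simp: c_def)
    finally show "(\<lambda>n. g n z) \<longlonglongrightarrow> Y (c (fst z)) (snd z)"
      unfolding g_def by (intro continuous_on_tendsto_compose[OF cont[OF z]]) (use c_range in auto)
  qed
  then show ?thesis by (simp add: c_def split_beta')
qed

section \<open>Natural filtration, transition kernel and the integrated Markov property\<close>

context continuous_markov_process
begin

abbreviation filt :: "real \<Rightarrow> 'w measure" where "filt \<equiv> natural_filtration \<Omega> X"

lemma space_filt [simp]: "space (filt s) = space \<Omega>"
  unfolding natural_filtration_def by (rule space_measure_of) auto

lemma sets_filt: "sets (filt s) = sigma_sets (space \<Omega>) {X u -` B \<inter> space \<Omega> | u B. 0 \<le> u \<and> u \<le> s \<and> B \<in> sets borel}"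
  unfolding natural_filtration_def by (rule sets_measure_of) auto

lemma filt_mono: "s \<le> t \<Longrightarrow> sets (filt s) \<subseteq> sets (filt t)"
  unfolding sets_filt by (intro sigma_sets_mono') force

lemma filt_subset: "sets (filt s) \<subseteq> sets \<Omega>"
  unfolding sets_filt
  using measurable_X by (intro sets.sigma_sets_subset) (auto intro: measurable_sets)

lemma measurable_X_filt: "0 \<le> u \<Longrightarrow> u \<le> s \<Longrightarrow> X u \<in> borel_measurable (filt s)"
  by (intro measurableI) (auto simp: sets_filt)

lemma measurable_filt_mono: "f \<in> borel_measurable (filt s) \<Longrightarrow> s \<le> t \<Longrightarrow> f \<in> borel_measurable (filt t)"
  using filt_mono[of s t] by (auto simp: measurable_def)

lemma measurable_filt_\<Omega>: "f \<in> borel_measurable (filt s) \<Longrightarrow> f \<in> borel_measurable \<Omega>"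
  using filt_subset[of s] by (auto simp: measurable_def)

definition occ :: "(real \<Rightarrow> real) \<Rightarrow> real \<Rightarrow> 'w \<Rightarrow> real" where
  "occ f t \<omega> = (LINT s:{0..t}|lborel. f (X s \<omega>))"

end

locale jacobi_started = jacobi_process a b \<sigma> \<Omega> P X
  for a b \<sigma> :: real and \<Omega> :: "'w measure" and P X +
  fixes x :: real
  assumes x_in: "x \<in> {0<..<1}" and a_pos: "0 < a" and a_less_b: "a < b" and \<sigma>_nz: "\<sigma> \<noteq> 0"
begin

sublocale prob_space "P x"
  using prob_space_P x_in by blast

lemma sets_Px [measurable_cong, simp]: "sets (P x) = sets \<Omega>"
  using sets_P x_in by blast

lemma space_Px [simp]: "space (P x) = space \<Omega>"
  using sets_Px by (rule sets_eq_imp_space_eq)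

lemma X_unit: "\<omega> \<in> space \<Omega> \<Longrightarrow> 0 \<le> t \<Longrightarrow> X t \<omega> \<in> {0..1}"
  using range_X by simp

text \<open>The measures \<open>P y\<close> with \<open>y\<close> outside the state space are unconstrained, hence the case distinction.\<close>

definition kernel :: "real \<Rightarrow> real \<Rightarrow> real measure" where
  "kernel h y = (if y \<in> {0<..<1} then distr (P y) borel (X h) else return borel y)"

lemma measurable_X_P [measurable]: "y \<in> {0<..<1} \<Longrightarrow> 0 \<le> h \<Longrightarrow> X h \<in> borel_measurable (P y)"
  using measurable_X[of h] sets_P[of y] by (simp cong: measurable_cong_sets)

lemma emeasure_kernel:
  assumes "0 \<le> h" "B \<in> sets borel"
  shows "emeasure (kernel h y) B = ennreal (if y \<in> {0<..<1} then transition P X h y B else indicator B y)"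
proof (cases "y \<in> {0<..<1}")
  case True
  then interpret y: prob_space "P y" by (rule prob_space_P)
  have "X h -` B \<inter> space (P y) = {\<omega> \<in> space (P y). X h \<omega> \<in> B}" by auto
  then show ?thesis using True assms measurable_X_P[OF True]
    by (simp add: kernel_def transition_def emeasure_distr y.emeasure_eq_measure)
qed (use assms in \<open>auto simp: kernel_def indicator_def\<close>)

lemma prob_space_kernel: "0 \<le> h \<Longrightarrow> prob_space (kernel h y)"
  unfolding kernel_def
  by (auto intro!: prob_space.prob_space_distr prob_space_P prob_space_return measurable_X_P)

lemma sets_kernel [measurable_cong, simp]: "sets (kernel h y) = sets borel"
  by (simp add: kernel_def)

lemma kernel_measurable [measurable]:
  assumes "0 \<le> h"
  shows "kernel h \<in> borel \<rightarrow>\<^sub>M subprob_algebra borel"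
proof (rule measurable_subprob_algebra)
  fix B :: "real set" assume B: "B \<in> sets borel"
  have "(\<lambda>y. if y \<in> {0<..<1} then transition P X h y B else indicator B y) \<in> borel_measurable borel"
  proof (subst measurable_If_restrict_space_iff)
    have "{y. y \<in> {0<..<1}} = {0<..<1::real}" by blast
    then show "(\<lambda>y. transition P X h y B) \<in> borel_measurable (restrict_space borel {y. y \<in> {0<..<1}}) \<and>
        indicator B \<in> borel_measurable (restrict_space borel {y. y \<notin> {0<..<1}})"
      by (simp only:) (intro conjI measurable_transition assms B measurable_restrict_space1 borel_measurable_indicator)
  qed simp
  then show "(\<lambda>y. emeasure (kernel h y) B) \<in> borel_measurable borel"
    using assms B by (simp add: emeasure_kernel)
qed (auto intro: prob_space_imp_subprob_space prob_space_kernel assms)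

lemma subalgebra_filt: "subalgebra (P x) (filt s)"
  using filt_subset by (simp add: subalgebra_def)

text \<open>The Markov assumption integrated over \<open>D\<close>. The transition function may be
  replaced by the everywhere defined \<open>kernel\<close>, because \<open>X s\<close> lies in the
  state space almost surely.\<close>

lemma markov_set:
  assumes D: "D \<in> sets (filt s)" and "0 \<le> s" "0 \<le> h" "B \<in> sets borel"
  shows "emeasure (P x) (D \<inter> (X (s + h) -` B \<inter> space \<Omega>)) = (\<integral>\<^sup>+\<omega>. indicator D \<omega> * emeasure (kernel h (X s \<omega>)) B \<partial>P x)"
proof -
  interpret finite_measure_subalgebra "P x" "filt s"
    by unfold_locales (rule subalgebra_filt)
  have D': "D \<in> sets \<Omega>" using D filt_subset by auto
  have [measurable]: "X (s + h) \<in> borel_measurable \<Omega>" using assms by (intro measurable_X) auto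
  have [measurable]: "X s \<in> borel_measurable \<Omega>" using assms by (intro measurable_X) auto
  note D'[measurable] \<open>B \<in> sets borel\<close>[measurable]
  have int: "integrable (P x) (\<lambda>\<omega>. indicat_real B (X (s + h) \<omega>))"
    by (rule integrable_const_bound[where B = 1]) auto
  define k where "k \<omega> = measure (kernel h (X s \<omega>)) B" for \<omega>
  have k_em: "emeasure (kernel h (X s \<omega>)) B = ennreal (k \<omega>)" for \<omega>
  proof -
    interpret k: prob_space "kernel h (X s \<omega>)" by (rule prob_space_kernel) fact
    show ?thesis unfolding k_def by (rule k.emeasure_eq_measure)
  qed
  have k_bd: "0 \<le> k \<omega>" "k \<omega> \<le> 1" for \<omega>
  proof -
    interpret k: prob_space "kernel h (X s \<omega>)" by (rule prob_space_kernel) fact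
    show "0 \<le> k \<omega>" "k \<omega> \<le> 1" unfolding k_def by auto
  qed
  have k_meas [measurable]: "k \<in> borel_measurable \<Omega>"
  proof -
    note kernel_measurable[OF \<open>0 \<le> h\<close>, measurable]
    have "(\<lambda>y. measure (kernel h y) B) \<in> borel_measurable borel"
      by (rule measurable_compose[OF kernel_measurable[OF \<open>0 \<le> h\<close>] measurable_measure_subprob_algebra]) fact
    then show ?thesis unfolding k_def by (rule measurable_compose[rotated]) simp
  qed
  have AE_k: "AE \<omega> in P x. real_cond_exp (P x) (filt s) (\<lambda>\<omega>. indicat_real B (X (s + h) \<omega>)) \<omega> = k \<omega>"
    using markov[OF x_in \<open>0 \<le> s\<close> \<open>0 \<le> h\<close> \<open>B \<in> sets borel\<close>] AE_in_S[OF x_in \<open>0 \<le> s\<close>]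
  proof eventually_elim
    case (elim \<omega>)
    have "ennreal (k \<omega>) = ennreal (transition P X h (X s \<omega>) B)"
      using elim(2) unfolding k_em[symmetric] by (subst emeasure_kernel) (use assms in auto)
    then have "k \<omega> = transition P X h (X s \<omega>) B"
      using k_bd by (simp add: transition_def)
    then show ?case using elim by simp
  qed
  have "emeasure (P x) (D \<inter> (X (s + h) -` B \<inter> space \<Omega>)) = ennreal (\<integral>\<omega>. indicator (D \<inter> (X (s + h) -` B \<inter> space \<Omega>)) \<omega> \<partial>P x)"
    by (simp add: emeasure_eq_measure)
  also have "(\<integral>\<omega>. indicator (D \<inter> (X (s + h) -` B \<inter> space \<Omega>)) \<omega> \<partial>P x) = (\<integral>\<omega>\<in>D. indicat_real B (X (s + h) \<omega>) \<partial>P x)"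
    unfolding set_lebesgue_integral_def by (intro Bochner_Integration.integral_cong) (auto simp: indicator_def)
  also have "\<dots> = (\<integral>\<omega>\<in>D. real_cond_exp (P x) (filt s) (\<lambda>\<omega>. indicat_real B (X (s + h) \<omega>)) \<omega> \<partial>P x)"
    by (rule real_cond_exp_intA[OF int D])
  also have "\<dots> = (\<integral>\<omega>. indicator D \<omega> * k \<omega> \<partial>P x)"
    unfolding set_lebesgue_integral_def
    by (intro integral_cong_AE) (use AE_k in \<open>auto elim!: eventually_mono\<close>)
  also have "ennreal \<dots> = (\<integral>\<^sup>+\<omega>. ennreal (indicator D \<omega> * k \<omega>) \<partial>P x)"
    by (intro nn_integral_eq_integral[symmetric] integrable_const_bound[where B = 1])
      (use k_bd in \<open>auto simp: indicator_def\<close>)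
  also have "\<dots> = (\<integral>\<^sup>+\<omega>. indicator D \<omega> * emeasure (kernel h (X s \<omega>)) B \<partial>P x)"
    by (intro nn_integral_cong) (auto simp: k_em indicator_def)
  finally show ?thesis .
qed

text \<open>From sets to bounded functions by an equality of measures: under \<open>P x\<close>
  restricted to \<open>D\<close>, the law of \<open>X (s + h)\<close> is the law of
  \<open>X s\<close> composed with the kernel.\<close>

lemma markov_integral:
  fixes f :: "real \<Rightarrow> real"
  assumes D: "D \<in> sets (filt s)" and s: "0 \<le> s" and h: "0 \<le> h"
    and f [measurable]: "f \<in> borel_measurable borel" and fB: "\<And>y. \<bar>f y\<bar> \<le> C"
  shows "(\<integral>\<omega>. indicator D \<omega> * f (X (s + h) \<omega>) \<partial>P x) = (\<integral>\<omega>. indicator D \<omega> * (\<integral>y. f y \<partial>kernel h (X s \<omega>)) \<partial>P x)"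
proof -
  note kernel_measurable[OF h, measurable]
  have [measurable]: "D \<in> sets \<Omega>" using D filt_subset by auto
  have [measurable]: "X (s + h) \<in> borel_measurable \<Omega>" "X s \<in> borel_measurable \<Omega>" 
    using assms by (auto intro!: measurable_X)
  define M where "M = density (P x) (indicator D)"
  have sets_M [measurable_cong, simp]: "sets M = sets \<Omega>" by (simp add: M_def)
  have space_M [simp]: "space M = space \<Omega>" by (simp add: M_def)
  have ne: "space M \<noteq> {}" using not_empty by simp
  have "emeasure M (space M) \<le> 1"
    unfolding M_def by (subst emeasure_density) (auto simp: indicator_inter_arith[symmetric] emeasure_eq_measure)
  then interpret M: finite_measure M by (intro finite_measureI) (auto simp: top_unique)
  have eq: "distr M borel (X (s + h)) = distr M borel (X s) \<bind> kernel h"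
  proof (rule measure_eqI)
    show "sets (distr M borel (X (s + h))) = sets (distr M borel (X s) \<bind> kernel h)"
      using ne by (subst sets_bind[where N=borel]) auto
    fix B assume "B \<in> sets (distr M borel (X (s + h)))"
    then have B [measurable]: "B \<in> sets borel" by simp
    have "emeasure (distr M borel (X (s + h))) B = emeasure M (X (s + h) -` B \<inter> space \<Omega>)"
      by (subst emeasure_distr) auto
    also have "\<dots> = emeasure (P x) (D \<inter> (X (s + h) -` B \<inter> space \<Omega>))"
      unfolding M_def by (subst emeasure_density) (auto simp: indicator_inter_arith[symmetric])
    also have "\<dots> = (\<integral>\<^sup>+\<omega>. indicator D \<omega> * emeasure (kernel h (X s \<omega>)) B \<partial>P x)"
      by (rule markov_set) fact+
    also have "\<dots> = (\<integral>\<^sup>+\<omega>. emeasure (kernel h (X s \<omega>)) B \<partial>M)"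
      unfolding M_def by (subst nn_integral_density) auto
    also have "\<dots> = (\<integral>\<^sup>+y. emeasure (kernel h y) B \<partial>distr M borel (X s))"
      by (subst nn_integral_distr) auto
    also have "\<dots> = emeasure (distr M borel (X s) \<bind> kernel h) B"
      using ne by (subst emeasure_bind[where N=borel]) auto
    finally show "emeasure (distr M borel (X (s + h))) B = emeasure (distr M borel (X s) \<bind> kernel h) B" .
  qed
  have "(\<integral>\<omega>. indicator D \<omega> * f (X (s + h) \<omega>) \<partial>P x) = (\<integral>\<omega>. f (X (s + h) \<omega>) \<partial>M)"
  proof -
    have "M = density (P x) (\<lambda>\<omega>. ennreal (indicator D \<omega>))" by (simp add: M_def ennreal_indicator)
    then show ?thesis by (simp add: integral_density)
  qed
  also have "\<dots> = (\<integral>y. f y \<partial>distr M borel (X (s + h)))"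
    by (subst integral_distr) auto
  also have "\<dots> = (\<integral>z. (\<integral>y. f y \<partial>kernel h z) \<partial>distr M borel (X s))"
    unfolding eq
  proof (rule integral_bind[OF f])
    show "\<bar>f y\<bar> \<le> C" for y by (rule fB)
    show "finite_measure (distr M borel (X s))" by (intro M.finite_measure_distr) simp
    show "AE z in distr M borel (X s). emeasure (kernel h z) (space (kernel h z)) \<le> ennreal 1"
      using prob_space.emeasure_space_1[OF prob_space_kernel[OF h]] by simp
  qed simp
  also have "\<dots> = (\<integral>\<omega>. (\<integral>y. f y \<partial>kernel h (X s \<omega>)) \<partial>M)"
    by (subst integral_distr) auto
  also have "\<dots> = (\<integral>\<omega>. indicator D \<omega> * (\<integral>y. f y \<partial>kernel h (X s \<omega>)) \<partial>P x)"
  proof -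
    have "M = density (P x) (\<lambda>\<omega>. ennreal (indicator D \<omega>))" by (simp add: M_def ennreal_indicator)
    then show ?thesis by (simp add: integral_density)
  qed
  finally show ?thesis .
qed


section \<open>First-order expansion of expectations and its integrated form\<close>

definition shape_p :: real where "shape_p = 2 * a / \<sigma>\<^sup>2"
definition shape_q :: real where "shape_q = 2 * (b - a) / \<sigma>\<^sup>2"

definition gen_poly :: "real poly \<Rightarrow> real poly" where
  "gen_poly u = smult (\<sigma>\<^sup>2 / 2) (jacobi_op shape_p shape_q u)"

lemma poly_gen_poly: "poly (gen_poly u) y = (a - b * y) * poly (pderiv u) y + \<sigma>\<^sup>2 / 2 * y * (1 - y) * poly (pderiv (pderiv u)) y"
proof -
  have "\<sigma>\<^sup>2 / 2 * (shape_p - (shape_p + shape_q) * y) = a - b * y"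
    using \<sigma>_nz by (simp add: shape_p_def shape_q_def field_simps)
  then have "(\<sigma>\<^sup>2 / 2 * (shape_p - (shape_p + shape_q) * y)) * poly (pderiv u) y = (a - b * y) * poly (pderiv u) y"
    by simp
  then show ?thesis by (simp add: gen_poly_def poly_jacobi_op distrib_left mult_ac)
qed

text \<open>Uniformity in the starting point \<open>y\<close> is the essential content: the error
  then survives averaging over the law of \<open>X t\<close>.\<close>

lemma generator_poly:
  assumes "e > 0"
  shows "\<exists>d>0. \<forall>h. 0 < h \<longrightarrow> h < d \<longrightarrow> (\<forall>y\<in>{0<..<1}. \<bar>(\<integral>\<omega>. poly u (X h \<omega>) \<partial>P y) - poly u y - h * poly (gen_poly u) y\<bar> \<le> e * h)"
proof -
  have "generator_maps {0<..<1} P X (poly u)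
      (\<lambda>x. (a - b * x) * poly (pderiv u) x + \<sigma>\<^sup>2 / 2 * x * (1 - x) * poly (pderiv (pderiv u)) x)"
    by (rule generator) (auto intro!: DERIV_subset[OF poly_DERIV] continuous_intros)
  then have "\<forall>\<^sub>F h in at_right 0. \<forall>y\<in>{0<..<1}. dist (((\<integral>\<omega>. poly u (X h \<omega>) \<partial>P y) - poly u y) / h) (poly (gen_poly u) y) < e"
    unfolding generator_maps_def poly_gen_poly[symmetric] using assms by (rule uniform_limitD)
  then obtain d where d: "d > 0" "\<And>h. 0 < h \<Longrightarrow> h < d \<Longrightarrow> \<forall>y\<in>{0<..<1}. dist (((\<integral>\<omega>. poly u (X h \<omega>) \<partial>P y) - poly u y) / h) (poly (gen_poly u) y) < e"
    unfolding eventually_at_right_field by auto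
  show ?thesis
  proof (intro exI conjI allI impI ballI)
    fix h y :: real assume h: "0 < h" "h < d" and y: "y \<in> {0<..<1}"
    have "\<bar>((\<integral>\<omega>. poly u (X h \<omega>) \<partial>P y) - poly u y) / h - poly (gen_poly u) y\<bar> < e"
      using d(2)[OF h] y by (auto simp: dist_real_def)
    also have "((\<integral>\<omega>. poly u (X h \<omega>) \<partial>P y) - poly u y) / h - poly (gen_poly u) y = 
      ((\<integral>\<omega>. poly u (X h \<omega>) \<partial>P y) - poly u y - h * poly (gen_poly u) y) / h"
      using h by (simp add: field_simps)
    finally show "\<bar>(\<integral>\<omega>. poly u (X h \<omega>) \<partial>P y) - poly u y - h * poly (gen_poly u) y\<bar> \<le> e * h"
      using h by (simp add: pos_divide_less_eq)
  qed (fact d)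
qed

lemma integrable_poly_X:
  assumes D: "D \<in> sets (filt s)" and "0 \<le> t"
  shows "integrable (P x) (\<lambda>\<omega>. indicator D \<omega> * poly u (X t \<omega>))"
proof -
  obtain C where C: "0 \<le> C" "\<And>y. y \<in> {0..1} \<Longrightarrow> \<bar>poly u y\<bar> \<le> C" using poly_bounded_unit[of u] by blast
  have [measurable]: "D \<in> sets \<Omega>" using D filt_subset by auto
  have [measurable]: "X t \<in> borel_measurable \<Omega>" using assms by (auto intro!: measurable_X)
  show ?thesis
    by (rule integrable_const_bound[where B = C]) (use C X_unit assms in \<open>auto simp: indicator_def\<close>)
qed

text \<open>The Markov property moves the generator estimate to time \<open>t\<close>. The threshold
  \<open>d\<close> is chosen before \<open>t\<close>, \<open>s\<close> and \<open>D\<close>, so the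
  bound may later be based at a varying time.\<close>

lemma dynkin_increment:
  assumes "e > 0"
  shows "\<exists>d>0. \<forall>h t s D. 0 < h \<longrightarrow> h < d \<longrightarrow> 0 \<le> s \<longrightarrow> s \<le> t \<longrightarrow> D \<in> sets (filt s) \<longrightarrow>
     \<bar>(\<integral>\<omega>. indicator D \<omega> * poly u (X (t + h) \<omega>) \<partial>P x) - (\<integral>\<omega>. indicator D \<omega> * poly u (X t \<omega>) \<partial>P x)
       - h * (\<integral>\<omega>. indicator D \<omega> * poly (gen_poly u) (X t \<omega>) \<partial>P x)\<bar> \<le> e * h"
proof -
  obtain d where d: "d > 0" "\<And>h y. 0 < h \<Longrightarrow> h < d \<Longrightarrow> y \<in> {0<..<1} \<Longrightarrow> 
    \<bar>(\<integral>\<omega>. poly u (X h \<omega>) \<partial>P y) - poly u y - h * poly (gen_poly u) y\<bar> \<le> e * h"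
    using generator_poly[OF assms, of u] by blast
  obtain C where C: "0 \<le> C" "\<And>y. y \<in> {0..1} \<Longrightarrow> \<bar>poly u y\<bar> \<le> C" using poly_bounded_unit[of u] by blast
  \<comment> \<open>A polynomial is unbounded on the line, whereas \<open>markov_integral\<close>
    asks for a global bound; paths stay in \<open>{0..1}\<close>, so the truncation changes
    nothing.\<close>
  define f where "f y = indicator {0..1} y * poly u y" for y
  have f_meas [measurable]: "f \<in> borel_measurable borel" unfolding f_def by measurable
  have f_bd: "\<bar>f y\<bar> \<le> C" for y using C by (auto simp: f_def indicator_def)
  show ?thesis
  proof (intro exI[of _ d] conjI allI impI)
    fix h t s D assume h: "0 < h" "h < d" and s: "0 \<le> s" and st: "s \<le> t" and D: "D \<in> sets (filt s)"
    have t: "0 \<le> t" and h0: "0 \<le> h" and th: "0 \<le> t + h" using s st h by auto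
    have Dt: "D \<in> sets (filt t)" using filt_mono[OF st] D by auto
    have [measurable]: "D \<in> sets \<Omega>" using D filt_subset by auto
    have [measurable]: "X t \<in> borel_measurable \<Omega>" using t by (auto intro!: measurable_X)
    note kernel_measurable[OF h0, measurable]
    define K where "K \<omega> = (\<integral>y. f y \<partial>kernel h (X t \<omega>))" for \<omega>
    have K_meas [measurable]: "K \<in> borel_measurable \<Omega>"
      unfolding K_def
      by (rule measurable_compose[of "X t" _ borel "\<lambda>z. \<integral>y. f y \<partial>kernel h z"], simp)
        (rule measurable_compose[OF kernel_measurable[OF h0] integral_measurable_subprob_algebra], simp)
    have AE_K: "AE \<omega> in P x. \<bar>K \<omega> - poly u (X t \<omega>) - h * poly (gen_poly u) (X t \<omega>)\<bar> \<le> e * h"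
      using AE_in_S[OF x_in t]
    proof eventually_elim
      case (elim \<omega>)
      have "K \<omega> = (\<integral>\<omega>'. f (X h \<omega>') \<partial>P (X t \<omega>))"
        using elim h0 unfolding K_def kernel_def by (simp add: integral_distr measurable_X_P)
      also have "\<dots> = (\<integral>\<omega>'. poly u (X h \<omega>') \<partial>P (X t \<omega>))"
      proof (intro Bochner_Integration.integral_cong refl)
        fix \<omega>' assume "\<omega>' \<in> space (P (X t \<omega>))"
        then have "\<omega>' \<in> space \<Omega>" using sets_eq_imp_space_eq[OF sets_P[OF elim]] by simp
        then show "f (X h \<omega>') = poly u (X h \<omega>')" using X_unit[of \<omega>' h] h0 by (simp add: f_def)
      qed
      finally show ?case using d(2)[OF h elim] by simp
    qed
    have intK: "integrable (P x) (\<lambda>\<omega>. indicator D \<omega> * K \<omega>)"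
    proof (rule integrable_const_bound[where B = C])
      have "\<bar>K \<omega>\<bar> \<le> C" for \<omega>
      proof -
        interpret k: prob_space "kernel h (X t \<omega>)" by (rule prob_space_kernel) fact
        have "\<bar>K \<omega>\<bar> \<le> (\<integral>y. C \<partial>kernel h (X t \<omega>))"
          unfolding K_def
          by (rule order_trans[OF integral_abs_bound], rule integral_mono)
            (use f_bd C in \<open>auto intro!: k.integrable_const_bound[where B = C]\<close>)
        then show ?thesis using k.prob_space by simp
      qed
      then show "AE \<omega> in P x. norm (indicator D \<omega> * K \<omega>) \<le> C" using C by (auto simp: indicator_def)
    qed simp
    note i1 = integrable_poly_X[OF D t, of u] and i2 = integrable_poly_X[OF D t, of "gen_poly u"]
    have "(\<integral>\<omega>. indicator D \<omega> * poly u (X (t + h) \<omega>) \<partial>P x) = (\<integral>\<omega>. indicator D \<omega> * f (X (t + h) \<omega>) \<partial>P x)"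
      using X_unit[OF _ th] by (intro Bochner_Integration.integral_cong) (auto simp: f_def)
    also have "\<dots> = (\<integral>\<omega>. indicator D \<omega> * K \<omega> \<partial>P x)"
      unfolding K_def by (rule markov_integral[OF Dt t h0 f_meas f_bd])
    finally have "(\<integral>\<omega>. indicator D \<omega> * poly u (X (t + h) \<omega>) \<partial>P x) - (\<integral>\<omega>. indicator D \<omega> * poly u (X t \<omega>) \<partial>P x)
       - h * (\<integral>\<omega>. indicator D \<omega> * poly (gen_poly u) (X t \<omega>) \<partial>P x) = 
       (\<integral>\<omega>. indicator D \<omega> * K \<omega> - indicator D \<omega> * poly u (X t \<omega>) - h * (indicator D \<omega> * poly (gen_poly u) (X t \<omega>)) \<partial>P x)"
      using intK i1 i2 by simp
    also have "\<bar>\<dots>\<bar> \<le> (\<integral>\<omega>. e * h \<partial>P x)"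
    proof (rule order_trans[OF integral_abs_bound], rule integral_mono_AE)
      show "AE \<omega> in P x. \<bar>indicator D \<omega> * K \<omega> - indicator D \<omega> * poly u (X t \<omega>) - h * (indicator D \<omega> * poly (gen_poly u) (X t \<omega>))\<bar> \<le> e * h"
        using AE_K by eventually_elim (use assms h0 in \<open>auto simp: indicator_def\<close>)
    qed (use intK i1 i2 in auto)
    finally show "\<bar>(\<integral>\<omega>. indicator D \<omega> * poly u (X (t + h) \<omega>) \<partial>P x) - (\<integral>\<omega>. indicator D \<omega> * poly u (X t \<omega>) \<partial>P x)
       - h * (\<integral>\<omega>. indicator D \<omega> * poly (gen_poly u) (X t \<omega>) \<partial>P x)\<bar> \<le> e * h"
      using prob_space by simp
  qed (fact d)
qed

lemma continuous_expectation:
  assumes D: "D \<in> sets (filt s)"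
  shows "continuous_on {0..} (\<lambda>t. \<integral>\<omega>. indicator D \<omega> * poly u (X t \<omega>) \<partial>P x)"
  unfolding continuous_on_sequentially
proof (intro allI ballI impI, elim conjE)
  fix \<tau> :: "nat \<Rightarrow> real" and t :: real
  assume t: "t \<in> {0..}" and \<tau>: "\<forall>n. \<tau> n \<in> {0..}" and lim: "\<tau> \<longlonglongrightarrow> t"
  obtain C where C: "0 \<le> C" "\<And>y. y \<in> {0..1} \<Longrightarrow> \<bar>poly u y\<bar> \<le> C" using poly_bounded_unit[of u] by blast
  have [measurable]: "D \<in> sets \<Omega>" using D filt_subset by auto
  have [measurable]: "X t \<in> borel_measurable \<Omega>" "X (\<tau> n) \<in> borel_measurable \<Omega>" for n
    using t \<tau> by (auto intro!: measurable_X)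
  have "(\<lambda>n. \<integral>\<omega>. indicator D \<omega> * poly u (X (\<tau> n) \<omega>) \<partial>P x) \<longlonglongrightarrow> (\<integral>\<omega>. indicator D \<omega> * poly u (X t \<omega>) \<partial>P x)"
  proof (rule integral_dominated_convergence[where w = "\<lambda>_. C"])
    show "AE \<omega> in P x. (\<lambda>n. indicator D \<omega> * poly u (X (\<tau> n) \<omega>)) \<longlonglongrightarrow> indicator D \<omega> * poly u (X t \<omega>)"
    proof (rule AE_I2)
      fix \<omega> assume "\<omega> \<in> space (P x)"
      then have "continuous_on {0..} (\<lambda>t. X t \<omega>)" using continuous_paths by simp
      then have "(\<lambda>n. X (\<tau> n) \<omega>) \<longlonglongrightarrow> X t \<omega>"
        by (rule continuous_on_tendsto_compose[OF _ lim]) (use t \<tau> in auto)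
      then show "(\<lambda>n. indicator D \<omega> * poly u (X (\<tau> n) \<omega>)) \<longlonglongrightarrow> indicator D \<omega> * poly u (X t \<omega>)"
        by (intro tendsto_mult tendsto_const tendsto_poly)
    qed
    show "AE \<omega> in P x. norm (indicator D \<omega> * poly u (X (\<tau> n) \<omega>)) \<le> C" for n
      using C X_unit \<tau> by (intro AE_I2) (auto simp: indicator_def)
  qed auto
  then show "((\<lambda>t. \<integral>\<omega>. indicator D \<omega> * poly u (X t \<omega>) \<partial>P x) \<circ> \<tau>) \<longlonglongrightarrow> (\<integral>\<omega>. indicator D \<omega> * poly u (X t \<omega>) \<partial>P x)"
    by (simp add: o_def)
qed

text \<open>Each estimate of \<open>dynkin_increment\<close> looks forward from its base time. For
  the left difference quotient at \<open>r\<close> that base is the moving point, and continuity of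
  the integrand carries the value back to \<open>r\<close>.\<close>

lemma dynkin_has_integral:
  assumes D: "D \<in> sets (filt s)" and s: "0 \<le> s" "s \<le> t"
  shows "((\<lambda>r. \<integral>\<omega>. indicator D \<omega> * poly (gen_poly u) (X r \<omega>) \<partial>P x) has_integral
     (\<integral>\<omega>. indicator D \<omega> * poly u (X t \<omega>) \<partial>P x) - (\<integral>\<omega>. indicator D \<omega> * poly u (X s \<omega>) \<partial>P x)) {s..t}"
proof (rule fundamental_theorem_of_calculus[OF s(2)])
  define \<phi> where "\<phi> r = (\<integral>\<omega>. indicator D \<omega> * poly u (X r \<omega>) \<partial>P x)" for r
  define \<psi> where "\<psi> r = (\<integral>\<omega>. indicator D \<omega> * poly (gen_poly u) (X r \<omega>) \<partial>P x)" for r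
  have cont: "continuous_on {0..} \<psi>" unfolding \<psi>_def by (rule continuous_expectation[OF D])
  fix r assume r: "r \<in> {s..t}"
  have "((\<lambda>r'. (\<phi> r' - \<phi> r) / (r' - r)) \<longlongrightarrow> \<psi> r) (at r within {s..t})"
    unfolding tendsto_iff
  proof (intro allI impI)
    fix e :: real assume e: "e > 0"
    have e3: "e / 3 > 0" using e by simp
    obtain d1 where d1: "d1 > 0" and d1': "\<forall>h t s D. 0 < h \<longrightarrow> h < d1 \<longrightarrow> 0 \<le> s \<longrightarrow> s \<le> t \<longrightarrow> D \<in> sets (filt s) \<longrightarrow>
     \<bar>(\<integral>\<omega>. indicator D \<omega> * poly u (X (t + h) \<omega>) \<partial>P x) - (\<integral>\<omega>. indicator D \<omega> * poly u (X t \<omega>) \<partial>P x)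
       - h * (\<integral>\<omega>. indicator D \<omega> * poly (gen_poly u) (X t \<omega>) \<partial>P x)\<bar> \<le> e / 3 * h"
      using dynkin_increment[OF e3, of u] by (elim exE conjE)
    have d1_bound: "\<bar>\<phi> (v + h) - \<phi> v - h * \<psi> v\<bar> \<le> e / 3 * h" if "0 < h" "h < d1" "s \<le> v" for h v
      using d1'[rule_format, OF that(1,2) s(1) that(3) D] unfolding \<phi>_def \<psi>_def .
    have r0: "r \<in> {0..}" using r s by simp
    obtain d2 where d2: "d2 > 0" "\<And>v. v \<in> {0..} \<Longrightarrow> dist v r < d2 \<Longrightarrow> dist (\<psi> v) (\<psi> r) < e / 3"
      using cont[unfolded continuous_on_iff, rule_format, OF r0 e3] by blast
    have "\<bar>(\<phi> r' - \<phi> r) / (r' - r) - \<psi> r\<bar> < e" if r': "r' \<in> {s..t}" "r' \<noteq> r" "dist r' r < min d1 d2" for r'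
    proof -
      define v h where "v = min r r'" and "h = \<bar>r' - r\<bar>"
      have h: "0 < h" "h < d1" "s \<le> v" "v \<in> {0..}" "dist v r < d2"
      proof -
        have "\<bar>r' - r\<bar> < d1" "\<bar>r' - r\<bar> < d2" "r \<ge> s" using r' r by (auto simp: dist_real_def)
        then show "0 < h" "h < d1" "s \<le> v" "v \<in> {0..}" "dist v r < d2"
          using r' s d2(1) by (auto simp: h_def v_def dist_real_def min_def)
      qed
      have "(\<phi> r' - \<phi> r) / (r' - r) - \<psi> v = (\<phi> (v + h) - \<phi> v - h * \<psi> v) / h"
        using r' by (cases "r \<le> r'") (auto simp: v_def h_def min_def field_simps)
      then have "\<bar>(\<phi> r' - \<phi> r) / (r' - r) - \<psi> v\<bar> = \<bar>\<phi> (v + h) - \<phi> v - h * \<psi> v\<bar> / h"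
        using h by simp
      also have "\<dots> \<le> e / 3" using d1_bound[OF h(1-3)] h by (simp add: pos_divide_le_eq)
      finally have "\<bar>(\<phi> r' - \<phi> r) / (r' - r) - \<psi> v\<bar> \<le> e / 3" .
      moreover have "\<bar>\<psi> v - \<psi> r\<bar> < e / 3" using d2(2)[OF h(4,5)] by (simp add: dist_real_def)
      ultimately show ?thesis using e by linarith
    qed
    then show "\<forall>\<^sub>F r' in at r within {s..t}. dist ((\<phi> r' - \<phi> r) / (r' - r)) (\<psi> r) < e"
      unfolding eventually_at dist_real_def using d1 d2(1) by (intro exI[of _ "min d1 d2"]) auto
  qed
  then have "(\<phi> has_real_derivative \<psi> r) (at r within {s..t})"
    by (simp add: has_field_derivative_iff)
  then show "((\<lambda>r. \<integral>\<omega>. indicator D \<omega> * poly u (X r \<omega>) \<partial>P x) has_vector_derivative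
      (\<integral>\<omega>. indicator D \<omega> * poly (gen_poly u) (X r \<omega>) \<partial>P x)) (at r within {s..t})"
    unfolding has_real_derivative_iff_has_vector_derivative \<phi>_def \<psi>_def .
qed




section \<open>Time integrals along paths and the Dynkin martingale\<close>

lemma path_clip_measurable:
  assumes "0 \<le> t"
  shows "(\<lambda>(r, \<omega>). X (max 0 (min t r)) \<omega>) \<in> borel_measurable (borel \<Otimes>\<^sub>M filt t)"
  using assms
  by (intro borel_measurable_path_pair measurable_X_filt) (auto intro: continuous_on_subset[OF continuous_paths])

lemma occ_measurable_filt:
  assumes "0 \<le> t" and [measurable]: "f \<in> borel_measurable borel"
  shows "occ f t \<in> borel_measurable (filt t)"
proof -
  note path_clip_measurable[OF assms(1), measurable]
  have "(\<lambda>(r, \<omega>). X (max 0 (min t r)) \<omega>) \<circ> (\<lambda>(\<omega>, r). (r, \<omega>)) \<in> borel_measurable (filt t \<Otimes>\<^sub>M borel)"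
    by (rule measurable_comp[OF measurable_pair_swap'] path_clip_measurable assms)+
  then have [measurable]: "(\<lambda>(\<omega>, r). X (max 0 (min t r)) \<omega>) \<in> borel_measurable (filt t \<Otimes>\<^sub>M borel)"
    by (simp add: o_def split_beta')
  have "(\<lambda>\<omega>. LINT r|lborel. indicator {0..t} r * f ((\<lambda>(\<omega>, r). X (max 0 (min t r)) \<omega>) (\<omega>, r))) \<in> borel_measurable (filt t)"
    by measurable
  also have "(\<lambda>\<omega>. LINT r|lborel. indicator {0..t} r * f ((\<lambda>(\<omega>, r). X (max 0 (min t r)) \<omega>) (\<omega>, r))) = occ f t"
    unfolding occ_def set_lebesgue_integral_def
    by (intro ext Bochner_Integration.integral_cong) (auto simp: indicator_def)
  finally show ?thesis .
qed

lemma path_set_integrable: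
  fixes f :: "real \<Rightarrow> real"
  assumes \<omega>: "\<omega> \<in> space \<Omega>" and [measurable]: "f \<in> borel_measurable borel"
    and C: "\<And>y. y \<in> {0..1} \<Longrightarrow> \<bar>f y\<bar> \<le> C" and s: "0 \<le> s"
  shows "set_integrable lborel {s..t} (\<lambda>r. f (X r \<omega>))"
  unfolding set_integrable_def
proof (rule integrableI_bounded_set[where A = "{s..t}" and B = C])
  \<comment> \<open>The clamp extends the path to negative times, where nothing is assumed about
    it.\<close>
  have "continuous_on UNIV (\<lambda>r. X (max 0 r) \<omega>)"
    by (rule continuous_on_compose2[OF continuous_paths[OF \<omega>]]) (auto intro!: continuous_intros)
  then have [measurable]: "(\<lambda>r. X (max 0 r) \<omega>) \<in> borel_measurable borel"
    by (rule borel_measurable_continuous_onI)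
  have "(\<lambda>r. indicator {s..t} r *\<^sub>R f (X (max 0 r) \<omega>)) \<in> borel_measurable lborel" by measurable
  also have "(\<lambda>r. indicator {s..t} r *\<^sub>R f (X (max 0 r) \<omega>)) = (\<lambda>r. indicator {s..t} r *\<^sub>R f (X r \<omega>))"
    using s by (auto simp: indicator_def)
  finally show "(\<lambda>r. indicator {s..t} r *\<^sub>R f (X r \<omega>)) \<in> borel_measurable lborel" .
  show "AE r in lborel. r \<in> {s..t} \<longrightarrow> norm (indicator {s..t} r *\<^sub>R f (X r \<omega>)) \<le> C"
    using C X_unit[OF \<omega>] s by (intro AE_I2) auto
qed (auto simp: emeasure_lborel_Icc_eq)

lemma occ_diff:
  fixes f :: "real \<Rightarrow> real"
  assumes \<omega>: "\<omega> \<in> space \<Omega>" and f: "f \<in> borel_measurable borel"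
    and C: "\<And>y. y \<in> {0..1} \<Longrightarrow> \<bar>f y\<bar> \<le> C" and s: "0 \<le> s" "s \<le> t"
  shows "occ f t \<omega> - occ f s \<omega> = (LINT r:{s..t}|lborel. f (X r \<omega>))"
proof -
  note int = path_set_integrable[OF \<omega> f C]
  have "integral {0..s} (\<lambda>r. f (X r \<omega>)) + integral {s..t} (\<lambda>r. f (X r \<omega>)) = integral {0..t} (\<lambda>r. f (X r \<omega>))"
    using s by (intro Henstock_Kurzweil_Integration.integral_combine set_borel_integral_eq_integral int) auto
  moreover have "(LINT r:{p..q}|lborel. f (X r \<omega>)) = integral {p..q} (\<lambda>r. f (X r \<omega>))" if "0 \<le> p" for p q
    by (rule set_borel_integral_eq_integral(2)[OF int[OF _ that]])
  ultimately show ?thesis using s by (simp add: occ_def)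
qed

lemma occ_0:
  fixes f :: "real \<Rightarrow> real"
  assumes "\<omega> \<in> space \<Omega>" "f \<in> borel_measurable borel" "\<And>y. y \<in> {0..1} \<Longrightarrow> \<bar>f y\<bar> \<le> C"
  shows "occ f 0 \<omega> = 0"
  using occ_diff[OF assms, of 0 0] by (simp add: occ_def)

lemma path_integral_bounds:
  assumes \<omega>: "\<omega> \<in> space \<Omega>" and f: "f \<in> borel_measurable borel"
    and m: "\<And>y. y \<in> {0..1} \<Longrightarrow> m \<le> f y \<and> f y \<le> M" and s: "0 \<le> s" "s \<le> t"
  shows "m * (t - s) \<le> (LINT r:{s..t}|lborel. f (X r \<omega>))" "(LINT r:{s..t}|lborel. f (X r \<omega>)) \<le> M * (t - s)"
proof -
  have int: "set_integrable lborel {s..t} (\<lambda>r. f (X r \<omega>))"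
    by (rule path_set_integrable[OF \<omega> f, where C = "max \<bar>m\<bar> \<bar>M\<bar>"]) (use m s in fastforce)+
  have c: "set_integrable lborel {s..t} (\<lambda>r. c)" "(LINT r:{s..t}|lborel. c) = c * (t - s)" for c :: real
    using s by (auto simp: set_integrable_def set_lebesgue_integral_def)
  have "(LINT r:{s..t}|lborel. m) \<le> (LINT r:{s..t}|lborel. f (X r \<omega>))"
    by (intro set_integral_mono c int) (use m X_unit[OF \<omega>] s in auto)
  then show "m * (t - s) \<le> (LINT r:{s..t}|lborel. f (X r \<omega>))" by (simp add: c)
  have "(LINT r:{s..t}|lborel. f (X r \<omega>)) \<le> (LINT r:{s..t}|lborel. M)"
    by (intro set_integral_mono c int) (use m X_unit[OF \<omega>] s in auto)
  then show "(LINT r:{s..t}|lborel. f (X r \<omega>)) \<le> M * (t - s)" by (simp add: c)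
qed

definition mart :: "real poly \<Rightarrow> real \<Rightarrow> 'w \<Rightarrow> real" where
  "mart u t \<omega> = poly u (X t \<omega>) - occ (poly (gen_poly u)) t \<omega>"

lemma mart_measurable_filt:
  assumes "0 \<le> t" shows "mart u t \<in> borel_measurable (filt t)"
proof -
  have [measurable]: "X t \<in> borel_measurable (filt t)" "occ (poly (gen_poly u)) t \<in> borel_measurable (filt t)"
    using assms by (auto intro!: measurable_X_filt occ_measurable_filt)
  show ?thesis unfolding mart_def by measurable
qed

text \<open>Fubini exchanges time and expectation, after which the compensator is exactly the
  integral evaluated by \<open>dynkin_has_integral\<close>.\<close>

lemma martingale:
  assumes D: "D \<in> sets (filt s)" and s: "0 \<le> s" "s \<le> t"
  shows "(\<integral>\<omega>. indicator D \<omega> * (mart u t \<omega> - mart u s \<omega>) \<partial>P x) = 0"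
proof -
  have t: "0 \<le> t" using s by simp
  obtain C where C: "0 \<le> C" "\<And>y. y \<in> {0..1} \<Longrightarrow> \<bar>poly (gen_poly u) y\<bar> \<le> C" using poly_bounded_unit[of "gen_poly u"] by blast
  have D' [measurable]: "D \<in> sets \<Omega>" using D filt_subset by auto
  interpret pp: pair_sigma_finite lborel "P x" ..
  let ?h = "\<lambda>r \<omega>. indicator {s..t} r * (indicator D \<omega> * poly (gen_poly u) (X r \<omega>))"
  have int: "integrable (lborel \<Otimes>\<^sub>M P x) (\<lambda>(r, \<omega>). ?h r \<omega>)"
  proof (rule integrableI_bounded_set[where A = "{s..t} \<times> space \<Omega>" and B = C])
    have "(\<lambda>(r, \<omega>). X (max 0 (min t r)) \<omega>) \<in> borel_measurable (borel \<Otimes>\<^sub>M \<Omega>)"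
      using t by (intro borel_measurable_path_pair measurable_X) (auto intro: continuous_on_subset[OF continuous_paths])
    also have "borel_measurable (borel \<Otimes>\<^sub>M \<Omega>) = borel_measurable (lborel \<Otimes>\<^sub>M P x)"
      by (intro measurable_cong_sets sets_pair_measure_cong) auto
    finally have [measurable]: "(\<lambda>z. X (max 0 (min t (fst z))) (snd z)) \<in> borel_measurable (lborel \<Otimes>\<^sub>M P x)"
      by (simp add: split_beta')
    have "(\<lambda>z. indicator {s..t} (fst z) * (indicator D (snd z) * poly (gen_poly u) (X (max 0 (min t (fst z))) (snd z)))) 
      \<in> borel_measurable (lborel \<Otimes>\<^sub>M P x)" by measurable
    also have "(\<lambda>z. indicator {s..t} (fst z) * (indicator D (snd z) * poly (gen_poly u) (X (max 0 (min t (fst z))) (snd z)))) = (\<lambda>(r, \<omega>). ?h r \<omega>)"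
      using s by (auto simp: indicator_def)
    finally show "(\<lambda>(r, \<omega>). ?h r \<omega>) \<in> borel_measurable (lborel \<Otimes>\<^sub>M P x)" .
    show "emeasure (lborel \<Otimes>\<^sub>M P x) ({s..t} \<times> space \<Omega>) < \<infinity>"
      using s by (subst emeasure_pair_measure_Times) (auto simp: emeasure_eq_measure ennreal_mult[symmetric])
    show "{s..t} \<times> space \<Omega> \<in> sets (lborel \<Otimes>\<^sub>M P x)" by auto
    show "AE z in lborel \<Otimes>\<^sub>M P x. z \<in> {s..t} \<times> space \<Omega> \<longrightarrow> norm (case z of (r, \<omega>) \<Rightarrow> ?h r \<omega>) \<le> C"
      using C X_unit s by (intro AE_I2) (auto simp: indicator_def)
    show "AE z in lborel \<Otimes>\<^sub>M P x. z \<notin> {s..t} \<times> space \<Omega> \<longrightarrow> (case z of (r, \<omega>) \<Rightarrow> ?h r \<omega>) = 0"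
      by (intro AE_I2) (auto simp: space_pair_measure indicator_def)
  qed
  let ?\<psi> = "\<lambda>r. \<integral>\<omega>. indicator D \<omega> * poly (gen_poly u) (X r \<omega>) \<partial>P x"
  have cont: "continuous_on {s..t} ?\<psi>"
    by (rule continuous_on_subset[OF continuous_expectation[OF D]]) (use s in auto)
  have "(\<integral>\<omega>. indicator D \<omega> * (LINT r:{s..t}|lborel. poly (gen_poly u) (X r \<omega>)) \<partial>P x) = (\<integral>\<omega>. (LINT r|lborel. ?h r \<omega>) \<partial>P x)"
    unfolding set_lebesgue_integral_def by (simp add: mult.left_commute)
  also have "\<dots> = (LINT r|lborel. (\<integral>\<omega>. ?h r \<omega> \<partial>P x))"
    by (rule pp.Fubini_integral[OF int])
  also have "\<dots> = (LINT r:{s..t}|lborel. ?\<psi> r)"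
    unfolding set_lebesgue_integral_def by simp
  also have "\<dots> = integral {s..t} ?\<psi>"
    by (intro set_borel_integral_eq_integral borel_integrable_atLeastAtMost' cont)
  also have "\<dots> = (\<integral>\<omega>. indicator D \<omega> * poly u (X t \<omega>) \<partial>P x) - (\<integral>\<omega>. indicator D \<omega> * poly u (X s \<omega>) \<partial>P x)"
    by (rule integral_unique[OF dynkin_has_integral[OF D s]])
  finally have eq: "(\<integral>\<omega>. indicator D \<omega> * (LINT r:{s..t}|lborel. poly (gen_poly u) (X r \<omega>)) \<partial>P x) =
     (\<integral>\<omega>. indicator D \<omega> * poly u (X t \<omega>) \<partial>P x) - (\<integral>\<omega>. indicator D \<omega> * poly u (X s \<omega>) \<partial>P x)" .
  have i3: "integrable (P x) (\<lambda>\<omega>. indicator D \<omega> * (LINT r:{s..t}|lborel. poly (gen_poly u) (X r \<omega>)))"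
    using pp.integrable_snd[OF int] unfolding set_lebesgue_integral_def by (simp add: mult.left_commute)
  have "(\<integral>\<omega>. indicator D \<omega> * (mart u t \<omega> - mart u s \<omega>) \<partial>P x) = 
    (\<integral>\<omega>. indicator D \<omega> * poly u (X t \<omega>) - indicator D \<omega> * poly u (X s \<omega>) - 
       indicator D \<omega> * (LINT r:{s..t}|lborel. poly (gen_poly u) (X r \<omega>)) \<partial>P x)"
  proof (intro Bochner_Integration.integral_cong refl)
    fix \<omega> assume "\<omega> \<in> space (P x)"
    then have "occ (poly (gen_poly u)) t \<omega> - occ (poly (gen_poly u)) s \<omega> = (LINT r:{s..t}|lborel. poly (gen_poly u) (X r \<omega>))"
      by (intro occ_diff[OF _ borel_measurable_poly C(2) s]) auto
    then show "indicator D \<omega> * (mart u t \<omega> - mart u s \<omega>) = indicator D \<omega> * poly u (X t \<omega>) - indicator D \<omega> * poly u (X s \<omega>) - 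
       indicator D \<omega> * (LINT r:{s..t}|lborel. poly (gen_poly u) (X r \<omega>))"
      by (simp add: mart_def right_diff_distrib[symmetric])
  qed
  also have "\<dots> = 0"
    using integrable_poly_X[OF D t, of u] integrable_poly_X[OF D s(1), of u] i3 by (simp add: eq)
  finally show ?thesis .
qed

end

section \<open>Exponential moments of occupation times\<close>

text \<open>The left side is the height at 0 of the chord of \<open>exp (\<theta> * y)\<close> over
  \<open>[L, U]\<close>, that is, the largest exponential moment of a centred variable with values
  there.\<close>

lemma hoeffding_chord:
  fixes L U \<theta> :: real
  assumes "L \<le> 0" "0 \<le> U" "L < U" "0 \<le> \<theta>"
  shows "(U * exp (\<theta> * L) - L * exp (\<theta> * U)) / (U - L) \<le> exp (\<theta>\<^sup>2 * (U - L)\<^sup>2 / 8)"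
proof -
  \<comment> \<open>These bring the chord to the normal form of the one-variable inequality behind
    Hoeffding's lemma: \<open>p\<close> is the weight of \<open>U\<close> in the centred two-point
    law on \<open>L\<close> and \<open>U\<close>, \<open>h\<close> the scaled length.\<close>
  define p h where "p = - L / (U - L)" and "h = \<theta> * (U - L)"
  have p: "0 \<le> p" and h: "0 \<le> h" using assms by (auto simp: p_def h_def divide_nonpos_pos)
  have pos: "1 + p * (exp h - 1) > 0" using p h by (intro add_pos_nonneg mult_nonneg_nonneg) auto
  have "- h * p = \<theta> * L" using assms by (simp add: p_def h_def)
  then have "(U * exp (\<theta> * L) - L * exp (\<theta> * U)) / (U - L) = exp (- h * p) * (1 + p * (exp h - 1))"
    using assms by (simp add: p_def h_def field_simps exp_add[symmetric])
  also have "\<dots> = exp (- h * p + ln (1 + p * (exp h - 1)))"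
    using pos by (simp only: exp_add exp_ln)
  also have "\<dots> \<le> exp (h\<^sup>2 / 8)"
    using Hoeffdings_lemma_aux[OF h p] by simp
  also have "h\<^sup>2 = \<theta>\<^sup>2 * (U - L)\<^sup>2" by (simp add: h_def power_mult_distrib)
  finally show ?thesis .
qed

text \<open>Convexity, with the chord written as intercept plus slope times \<open>y\<close>, so
  that a centred \<open>y\<close> loses the slope term on integration.\<close>

lemma exp_le_chord:
  fixes L U \<theta> y :: real
  assumes "L \<le> y" "y \<le> U" "L < U" "0 \<le> \<theta>"
  shows "exp (\<theta> * y) \<le> (U * exp (\<theta> * L) - L * exp (\<theta> * U)) / (U - L) + (exp (\<theta> * U) - exp (\<theta> * L)) / (U - L) * y"
proof -
  define t where "t = (y - L) / (U - L)"
  have t: "0 \<le> t" "t \<le> 1" using assms by (auto simp: t_def)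
  have y: "(1 - t) *\<^sub>R L + t *\<^sub>R U = y" 
  proof -
    have "t * (U - L) = y - L" using assms by (simp add: t_def)
    then show ?thesis by (simp add: algebra_simps)
  qed
  have "exp (\<theta> * ((1 - t) *\<^sub>R L + t *\<^sub>R U)) \<le> (1 - t) * exp (\<theta> * L) + t * exp (\<theta> * U)"
    using convex_onD[OF convex_on_exp[OF assms(4)] t, of L U] by simp
  also have "\<dots> = (U * exp (\<theta> * L) - L * exp (\<theta> * U)) / (U - L) + (exp (\<theta> * U) - exp (\<theta> * L)) / (U - L) * y"
    using assms by (simp add: t_def divide_simps) (simp add: algebra_simps)
  finally show ?thesis unfolding y .
qed

section \<open>Hoeffding bounds for the martingale increments\<close>

context jacobi_started begin

lemma shape_pos: "0 < shape_p" "0 < shape_q"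
  using a_pos a_less_b \<sigma>_nz by (auto simp: shape_p_def shape_q_def)

sublocale beta: beta_params shape_p shape_q
  by unfold_locales (rule shape_pos)+

lemma mart_measurable [measurable]: "0 \<le> t \<Longrightarrow> mart u t \<in> borel_measurable \<Omega>"
  by (rule measurable_filt_\<Omega>[OF mart_measurable_filt])

lemma mart_bounded:
  assumes "0 \<le> t" shows "\<exists>C\<ge>0. \<forall>\<omega>\<in>space \<Omega>. \<forall>r\<in>{0..t}. \<bar>mart u r \<omega>\<bar> \<le> C"
proof -
  obtain A where A: "0 \<le> A" "\<And>y. y \<in> {0..1} \<Longrightarrow> \<bar>poly u y\<bar> \<le> A" using poly_bounded_unit[of u] by blast
  obtain C where C: "0 \<le> C" "\<And>y. y \<in> {0..1} \<Longrightarrow> \<bar>poly (gen_poly u) y\<bar> \<le> C" using poly_bounded_unit[of "gen_poly u"] by blast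
  have "\<bar>mart u r \<omega>\<bar> \<le> A + C * t" if \<omega>: "\<omega> \<in> space \<Omega>" and r: "r \<in> {0..t}" for \<omega> r
  proof -
    have b: "\<And>y. y \<in> {0..1} \<Longrightarrow> - C \<le> poly (gen_poly u) y \<and> poly (gen_poly u) y \<le> C" using C(2) by (simp add: abs_le_iff) (smt (verit))
    have "\<bar>occ (poly (gen_poly u)) r \<omega>\<bar> \<le> C * (r - 0)"
      using path_integral_bounds[OF \<omega> borel_measurable_poly b, of 0 r] r unfolding occ_def by auto
    also have "\<dots> \<le> C * t" using r C by (auto intro!: mult_left_mono)
    finally show ?thesis using A(2)[OF X_unit[OF \<omega>, of r]] r unfolding mart_def by auto
  qed
  then show ?thesis using A C assms by (intro exI[of _ "A + C * t"]) auto
qed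

text \<open>Orthogonality to events extends to bounded weights known at time \<open>s\<close> by
  identifying the conditional expectation of the increment as 0.\<close>

lemma martingale_orthogonal:
  assumes W: "W \<in> borel_measurable (filt s)" and WB: "\<And>\<omega>. \<omega> \<in> space \<Omega> \<Longrightarrow> \<bar>W \<omega>\<bar> \<le> B" and s: "0 \<le> s" "s \<le> t"
  shows "(\<integral>\<omega>. W \<omega> * (mart u t \<omega> - mart u s \<omega>) \<partial>P x) = 0"
proof -
  interpret fs: finite_measure_subalgebra "P x" "filt s"
    by unfold_locales (rule subalgebra_filt)
  obtain C where C: "0 \<le> C" "\<And>\<omega> r. \<omega> \<in> space \<Omega> \<Longrightarrow> r \<in> {0..t} \<Longrightarrow> \<bar>mart u r \<omega>\<bar> \<le> C" using mart_bounded[of t u] s by auto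
  let ?Y = "\<lambda>\<omega>. mart u t \<omega> - mart u s \<omega>"
  have [measurable]: "mart u t \<in> borel_measurable \<Omega>" "mart u s \<in> borel_measurable \<Omega>" using s by auto
  have [measurable]: "W \<in> borel_measurable \<Omega>" using W by (rule measurable_filt_\<Omega>)
  have Y: "\<bar>?Y \<omega>\<bar> \<le> 2 * C" if "\<omega> \<in> space \<Omega>" for \<omega>
    using C(2)[OF that, of t] C(2)[OF that, of s] s by auto
  have intY: "integrable (P x) ?Y"
    by (rule integrable_const_bound[where B = "2 * C"]) (use Y in auto)
  have intWY: "integrable (P x) (\<lambda>\<omega>. W \<omega> * ?Y \<omega>)"
  proof (rule integrable_const_bound[where B = "B * (2 * C)"])
    show "AE \<omega> in P x. norm (W \<omega> * ?Y \<omega>) \<le> B * (2 * C)"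
    proof (rule AE_I2)
      fix \<omega> assume "\<omega> \<in> space (P x)"
      then have "\<omega> \<in> space \<Omega>" by simp
      from WB[OF this] Y[OF this] show "norm (W \<omega> * ?Y \<omega>) \<le> B * (2 * C)"
        by (simp add: abs_mult mult_mono')
    qed
  qed simp
  have AE0: "AE \<omega> in P x. real_cond_exp (P x) (filt s) ?Y \<omega> = 0"
  proof (rule fs.real_cond_exp_charact)
    fix D assume D: "D \<in> sets (filt s)"
    show "(\<integral>\<omega>\<in>D. ?Y \<omega> \<partial>P x) = (\<integral>\<omega>\<in>D. 0 \<partial>P x)"
      using martingale[OF D s, of u] by (simp add: set_lebesgue_integral_def)
  qed (use intY in auto)
  have "(\<integral>\<omega>. W \<omega> * ?Y \<omega> \<partial>P x) = (\<integral>\<omega>. W \<omega> * real_cond_exp (P x) (filt s) ?Y \<omega> \<partial>P x)"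
    by (rule fs.real_cond_exp_intg(2)[symmetric]) (use intWY W in auto)
  also have "\<dots> = (\<integral>\<omega>. 0 \<partial>P x)"
    by (rule integral_cong_AE) (use AE0 in \<open>auto elim!: eventually_mono\<close>)
  finally show ?thesis by simp
qed

text \<open>Hoeffding's lemma for a random interval \<open>[L, L + R]\<close> known at time
  \<open>s\<close>. The intercept of the chord is bounded pointwise; its slope, multiplied by
  \<open>V\<close>, is a bounded weight known at \<open>s\<close>, so the slope term integrates to
  0. \<open>V\<close> will carry the exponential accumulated so far.\<close>

lemma conditional_hoeffding:
  assumes V: "V \<in> borel_measurable (filt s)" and VB: "\<And>\<omega>. \<omega> \<in> space \<Omega> \<Longrightarrow> 0 \<le> V \<omega> \<and> V \<omega> \<le> B" 
    and s: "0 \<le> s" "s \<le> t" and \<theta>: "0 \<le> \<theta>" and R: "0 < R"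
    and L: "L \<in> borel_measurable (filt s)" 
    and L0: "\<And>\<omega>. \<omega> \<in> space \<Omega> \<Longrightarrow> L \<omega> \<le> 0 \<and> 0 \<le> L \<omega> + R"
    and Y: "\<And>\<omega>. \<omega> \<in> space \<Omega> \<Longrightarrow> L \<omega> \<le> mart u t \<omega> - mart u s \<omega> \<and> mart u t \<omega> - mart u s \<omega> \<le> L \<omega> + R"
  shows "(\<integral>\<omega>. V \<omega> * exp (\<theta> * (mart u t \<omega> - mart u s \<omega>)) \<partial>P x) \<le> exp (\<theta>\<^sup>2 * R\<^sup>2 / 8) * (\<integral>\<omega>. V \<omega> \<partial>P x)"
proof -
  let ?Y = "\<lambda>\<omega>. mart u t \<omega> - mart u s \<omega>"
  define W where "W \<omega> = V \<omega> * ((exp (\<theta> * (L \<omega> + R)) - exp (\<theta> * L \<omega>)) / R)" for \<omega>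
  have [measurable]: "mart u t \<in> borel_measurable \<Omega>" "mart u s \<in> borel_measurable \<Omega>" using s by auto
  have V' [measurable]: "V \<in> borel_measurable \<Omega>" using V by (rule measurable_filt_\<Omega>)
  have L' [measurable]: "L \<in> borel_measurable \<Omega>" using L by (rule measurable_filt_\<Omega>)
  have W: "W \<in> borel_measurable (filt s)"
    unfolding W_def using V L by (intro borel_measurable_times borel_measurable_divide borel_measurable_diff borel_measurable_exp
      borel_measurable_add borel_measurable_const) auto
  have exps: "0 \<le> exp (\<theta> * (L \<omega> + R)) - exp (\<theta> * L \<omega>)" "exp (\<theta> * (L \<omega> + R)) \<le> exp (\<theta> * R)" if "\<omega> \<in> space \<Omega>" for \<omega>
    using \<theta> R L0[OF that] by (auto intro!: mult_left_mono)
  have WB: "\<bar>W \<omega>\<bar> \<le> B * (exp (\<theta> * R) / R)" if "\<omega> \<in> space \<Omega>" for \<omega>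
  proof -
    have "\<bar>W \<omega>\<bar> = V \<omega> * ((exp (\<theta> * (L \<omega> + R)) - exp (\<theta> * L \<omega>)) / R)"
      using VB[OF that] exps[OF that] R by (simp add: W_def abs_mult)
    also have "\<dots> \<le> B * (exp (\<theta> * R) / R)"
      using VB[OF that] exps[OF that] R 
      by (intro mult_mono divide_right_mono) (auto intro: order_trans[OF _ exps(2)[OF that]])
    finally show ?thesis .
  qed
  have int: "integrable (P x) (\<lambda>\<omega>. V \<omega> * exp (\<theta> * ?Y \<omega>))"
  proof (rule integrable_const_bound[where B = "B * exp (\<theta> * R)"])
    show "AE \<omega> in P x. norm (V \<omega> * exp (\<theta> * ?Y \<omega>)) \<le> B * exp (\<theta> * R)"
    proof (rule AE_I2)
      fix \<omega> assume "\<omega> \<in> space (P x)"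
      then have \<omega>: "\<omega> \<in> space \<Omega>" by simp
      have "?Y \<omega> \<le> R" using Y[OF \<omega>] L0[OF \<omega>] by auto
      then show "norm (V \<omega> * exp (\<theta> * ?Y \<omega>)) \<le> B * exp (\<theta> * R)"
        using VB[OF \<omega>] \<theta> by (auto simp: abs_mult intro!: mult_mono mult_left_mono)
    qed
  qed simp
  have intV: "integrable (P x) V"
    by (rule integrable_const_bound[where B = B]) (use VB in \<open>auto intro!: AE_I2\<close>)
  obtain C where C: "0 \<le> C" "\<And>\<omega> r. \<omega> \<in> space \<Omega> \<Longrightarrow> r \<in> {0..t} \<Longrightarrow> \<bar>mart u r \<omega>\<bar> \<le> C" using mart_bounded[of t u] s by auto
  have [measurable]: "W \<in> borel_measurable \<Omega>" using W by (rule measurable_filt_\<Omega>)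
  have intWY: "integrable (P x) (\<lambda>\<omega>. W \<omega> * ?Y \<omega>)"
  proof (rule integrable_const_bound[where B = "B * (exp (\<theta> * R) / R) * (2 * C)"])
    show "AE \<omega> in P x. norm (W \<omega> * ?Y \<omega>) \<le> B * (exp (\<theta> * R) / R) * (2 * C)"
    proof (rule AE_I2)
      fix \<omega> assume "\<omega> \<in> space (P x)"
      then have \<omega>: "\<omega> \<in> space \<Omega>" by simp
      have "\<bar>?Y \<omega>\<bar> \<le> 2 * C" using C(2)[OF \<omega>, of t] C(2)[OF \<omega>, of s] s by auto
      with WB[OF \<omega>] show "norm (W \<omega> * ?Y \<omega>) \<le> B * (exp (\<theta> * R) / R) * (2 * C)"
        unfolding real_norm_def abs_mult by (intro mult_mono') auto
    qed
  qed simp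
  have "(\<integral>\<omega>. V \<omega> * exp (\<theta> * ?Y \<omega>) \<partial>P x) \<le> (\<integral>\<omega>. exp (\<theta>\<^sup>2 * R\<^sup>2 / 8) * V \<omega> + W \<omega> * ?Y \<omega> \<partial>P x)"
  proof (rule integral_mono[OF int])
    fix \<omega> assume "\<omega> \<in> space (P x)"
    then have \<omega>: "\<omega> \<in> space \<Omega>" by simp
    have "exp (\<theta> * ?Y \<omega>) \<le> ((L \<omega> + R) * exp (\<theta> * L \<omega>) - L \<omega> * exp (\<theta> * (L \<omega> + R))) / ((L \<omega> + R) - L \<omega>)
        + (exp (\<theta> * (L \<omega> + R)) - exp (\<theta> * L \<omega>)) / ((L \<omega> + R) - L \<omega>) * ?Y \<omega>"
      using Y[OF \<omega>] R \<theta> by (intro exp_le_chord) auto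
    also have "\<dots> \<le> exp (\<theta>\<^sup>2 * ((L \<omega> + R) - L \<omega>)\<^sup>2 / 8) + (exp (\<theta> * (L \<omega> + R)) - exp (\<theta> * L \<omega>)) / ((L \<omega> + R) - L \<omega>) * ?Y \<omega>"
      using L0[OF \<omega>] R \<theta> by (intro add_right_mono hoeffding_chord) auto
    finally have "exp (\<theta> * ?Y \<omega>) \<le> exp (\<theta>\<^sup>2 * R\<^sup>2 / 8) + (exp (\<theta> * (L \<omega> + R)) - exp (\<theta> * L \<omega>)) / R * ?Y \<omega>"
      by simp
    then have "V \<omega> * exp (\<theta> * ?Y \<omega>) \<le> V \<omega> * (exp (\<theta>\<^sup>2 * R\<^sup>2 / 8) + (exp (\<theta> * (L \<omega> + R)) - exp (\<theta> * L \<omega>)) / R * ?Y \<omega>)"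
      using VB[OF \<omega>] by (intro mult_left_mono) auto
    then show "V \<omega> * exp (\<theta> * ?Y \<omega>) \<le> exp (\<theta>\<^sup>2 * R\<^sup>2 / 8) * V \<omega> + W \<omega> * ?Y \<omega>"
      by (simp add: W_def distrib_left mult_ac)
  qed (use intV intWY in auto)
  also have "\<dots> = exp (\<theta>\<^sup>2 * R\<^sup>2 / 8) * (\<integral>\<omega>. V \<omega> \<partial>P x)"
    using intV intWY martingale_orthogonal[OF W WB s] by simp
  finally show ?thesis .
qed

text \<open>Induction over grid steps, each costing one factor from
  \<open>conditional_hoeffding\<close>. Over a step, \<open>u\<close> along the path contributes a
  range of length \<open>K\<close> and the compensator one of length \<open>h\<close>, since the
  generator of \<open>u\<close> has values in \<open>[c - 1, c]\<close>.\<close>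

lemma mgf_martingale:
  assumes f: "\<And>y. y \<in> {0..1} \<Longrightarrow> 0 \<le> poly f y \<and> poly f y \<le> 1"
    and u: "gen_poly u = [:c:] - f" and c: "0 \<le> c" "c \<le> 1"
    and m: "\<And>y. y \<in> {0..1} \<Longrightarrow> m \<le> poly u y \<and> poly u y \<le> m + K"
    and h: "0 < h" and \<theta>: "0 \<le> \<theta>"
  shows "(\<integral>\<omega>. exp (\<theta> * (mart u (real k * h) \<omega> - mart u 0 \<omega>)) \<partial>P x) \<le> exp (real k * (\<theta>\<^sup>2 * (K + h)\<^sup>2 / 8))"
proof (induction k)
  case 0
  then show ?case using prob_space by simp
next
  case (Suc k)
  let ?s = "real k * h" and ?t = "real (Suc k) * h"
  have s: "0 \<le> ?s" "?s \<le> ?t" and t: "0 \<le> ?t" using h by (auto simp: mult_right_mono)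
  have ts: "?t - ?s = h" by (simp add: algebra_simps)
  have K: "0 \<le> K" using m[of 0] by auto
  define V where "V \<omega> = exp (\<theta> * (mart u ?s \<omega> - mart u 0 \<omega>))" for \<omega>
  \<comment> \<open>A lower bound for the increment given \<open>X ?s\<close>: the endpoint value at
    its bound \<open>m\<close>, the compensator at its maximum \<open>c * h\<close>. As
    \<open>0 \<le> c \<le> 1\<close>, the interval \<open>[L, L + K + h]\<close> contains 0.\<close>
  define L where "L \<omega> = m - poly u (X ?s \<omega>) - c * h" for \<omega>
  have [measurable]: "mart u ?s \<in> borel_measurable (filt ?s)" "mart u 0 \<in> borel_measurable (filt ?s)" "X ?s \<in> borel_measurable (filt ?s)"
    using s by (auto intro: mart_measurable_filt measurable_X_filt measurable_filt_mono[OF mart_measurable_filt[OF order_refl]])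
  have V: "V \<in> borel_measurable (filt ?s)" and L: "L \<in> borel_measurable (filt ?s)"
    unfolding V_def L_def by measurable
  obtain C where C: "0 \<le> C" "\<And>\<omega> r. \<omega> \<in> space \<Omega> \<Longrightarrow> r \<in> {0..?s} \<Longrightarrow> \<bar>mart u r \<omega>\<bar> \<le> C" using mart_bounded[OF s(1), of u] by auto
  have VB: "0 \<le> V \<omega> \<and> V \<omega> \<le> exp (\<theta> * (2 * C))" if "\<omega> \<in> space \<Omega>" for \<omega>
  proof -
    have "mart u ?s \<omega> - mart u 0 \<omega> \<le> 2 * C"
      using C(2)[OF that, of ?s] C(2)[OF that, of 0] s by (auto simp: abs_le_iff)
    then show ?thesis using \<theta> by (auto simp: V_def intro!: mult_left_mono)
  qed
  have fC: "\<bar>poly (gen_poly u) y\<bar> \<le> 1" if "y \<in> {0..1}" for y using f[OF that] c unfolding u by auto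
  have incr: "L \<omega> \<le> mart u ?t \<omega> - mart u ?s \<omega> \<and> mart u ?t \<omega> - mart u ?s \<omega> \<le> L \<omega> + (K + h)"
    and L0: "L \<omega> \<le> 0 \<and> 0 \<le> L \<omega> + (K + h)" if \<omega>: "\<omega> \<in> space \<Omega>" for \<omega>
  proof -
    have "mart u ?t \<omega> - mart u ?s \<omega> = poly u (X ?t \<omega>) - poly u (X ?s \<omega>) - (LINT r:{?s..?t}|lborel. poly (gen_poly u) (X r \<omega>))"
      using occ_diff[OF \<omega> borel_measurable_poly fC s] by (simp add: mart_def)
    moreover have "(c - 1) * h \<le> (LINT r:{?s..?t}|lborel. poly (gen_poly u) (X r \<omega>))" "(LINT r:{?s..?t}|lborel. poly (gen_poly u) (X r \<omega>)) \<le> c * h"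
      using path_integral_bounds[OF \<omega> borel_measurable_poly, of "c - 1" "gen_poly u" c, OF _ s] f unfolding ts u by auto
    moreover note m[OF X_unit[OF \<omega> t]]
    ultimately show "L \<omega> \<le> mart u ?t \<omega> - mart u ?s \<omega> \<and> mart u ?t \<omega> - mart u ?s \<omega> \<le> L \<omega> + (K + h)"
      unfolding L_def left_diff_distrib by linarith
    have "0 \<le> c * h" "c * h \<le> h" using c h by (auto simp: mult_left_le_one_le)
    then show "L \<omega> \<le> 0 \<and> 0 \<le> L \<omega> + (K + h)"
      using m[OF X_unit[OF \<omega> s(1)]] unfolding L_def by linarith
  qed
  have "(\<integral>\<omega>. exp (\<theta> * (mart u ?t \<omega> - mart u 0 \<omega>)) \<partial>P x) = (\<integral>\<omega>. V \<omega> * exp (\<theta> * (mart u ?t \<omega> - mart u ?s \<omega>)) \<partial>P x)"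
    unfolding V_def exp_add[symmetric] by (simp add: algebra_simps)
  also have "\<dots> \<le> exp (\<theta>\<^sup>2 * (K + h)\<^sup>2 / 8) * (\<integral>\<omega>. V \<omega> \<partial>P x)"
    using K h by (intro conditional_hoeffding[OF V VB s \<theta> _ L L0 incr]) auto
  also have "\<dots> \<le> exp (\<theta>\<^sup>2 * (K + h)\<^sup>2 / 8) * exp (real k * (\<theta>\<^sup>2 * (K + h)\<^sup>2 / 8))"
    using Suc.IH unfolding V_def by (intro mult_left_mono) auto
  also have "\<dots> = exp (real (Suc k) * (\<theta>\<^sup>2 * (K + h)\<^sup>2 / 8))"
    by (simp add: exp_add[symmetric] algebra_simps)
  finally show ?case .
qed

section \<open>Exponential moments for polynomial observables\<close>

definition hit_avg :: real where "hit_avg = 2 / \<sigma>\<^sup>2 * beta.eigen_sum"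

lemma hit_avg_nonneg: "0 \<le> hit_avg"
  using beta.eigen_sum_nonneg by (simp add: hit_avg_def)

lemma occ_bounds:
  assumes "\<omega> \<in> space \<Omega>" "f \<in> borel_measurable borel" "\<And>y. y \<in> {0..1} \<Longrightarrow> 0 \<le> f y \<and> f y \<le> 1" "0 \<le> t"
  shows "0 \<le> occ f t \<omega>" "occ f t \<omega> \<le> t"
  using path_integral_bounds[OF assms(1,2), of 0 1 0 t] assms(3,4) unfolding occ_def by auto

lemma occ_measurable: 
  assumes "0 \<le> t" "f \<in> borel_measurable borel"
  shows "occ f t \<in> borel_measurable \<Omega>"
  using measurable_filt_\<Omega>[OF occ_measurable_filt[OF assms]] .

text \<open>With \<open>gen_poly u = c - f\<close>, the centred occupation time is the martingale
  increment minus \<open>u (X t) - u (X 0)\<close>. The boundary term costs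
  \<open>exp (\<theta> * hit_avg)\<close>, the martingale at most \<open>t + 1\<close> Hoeffding
  factors of range at most \<open>hit_avg + 1\<close>.\<close>

lemma mgf_poly:
  assumes f: "\<And>y. y \<in> {0..1} \<Longrightarrow> 0 \<le> poly f y \<and> poly f y \<le> 1"
    and t: "0 < t" and \<theta>: "0 \<le> \<theta>"
  shows "(\<integral>\<omega>. exp (\<theta> * (occ (poly f) t \<omega> - t * (\<integral>y. poly f y \<partial>beta.\<pi>))) \<partial>P x)
     \<le> exp (\<theta> * hit_avg + \<theta>\<^sup>2 * ((t + 1) * (hit_avg + 1)\<^sup>2) / 8)"
proof -
  obtain g c where g: "jacobi_op shape_p shape_q g = f - [:c:]"
    using poisson_equation_solvable[OF shape_pos] by blast
  \<comment> \<open>The factor undoes the \<open>\<sigma>\<^sup>2 / 2\<close> in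
    \<open>gen_poly\<close>, and the sign turns \<open>f - c\<close> into
    \<open>c - f\<close>.\<close>
  define u where "u = smult (- 2 / \<sigma>\<^sup>2) g"
  have gen_u: "gen_poly u = [:c:] - f"
    using \<sigma>_nz unfolding gen_poly_def u_def jacobi_op_smult g by simp
  have c: "c = (\<integral>y. poly f y \<partial>beta.\<pi>)"
    using beta.poisson_derivative_bound(1)[OF f g, of 0] by simp
  have f_AE: "AE y in beta.\<pi>. 0 \<le> poly f y \<and> poly f y \<le> 1"
    by (rule eventually_mono[OF beta.AE_\<pi>]) (use f in auto)
  have c0: "0 \<le> c"
    unfolding c by (intro integral_nonneg_AE eventually_mono[OF f_AE]) auto
  have "c \<le> (\<integral>y. 1 \<partial>beta.\<pi>)"
    unfolding c by (intro integral_mono_AE eventually_mono[OF f_AE]) auto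
  then have c1: "c \<le> 1" using beta.pi.prob_space by simp
  have osc: "\<bar>poly u y - poly u z\<bar> \<le> hit_avg" if "y \<in> {0..1}" "z \<in> {0..1}" for y z
  proof -
    have "poly u y - poly u z = (- 2 / \<sigma>\<^sup>2) * (poly g y - poly g z)"
      unfolding u_def by (simp only: poly_smult right_diff_distrib)
    then have "\<bar>poly u y - poly u z\<bar> = 2 / \<sigma>\<^sup>2 * \<bar>poly g y - poly g z\<bar>"
      by (simp only: abs_mult) simp
    also have "\<dots> \<le> 2 / \<sigma>\<^sup>2 * beta.eigen_sum"
      using beta.poisson_solution_oscillation[OF f g, of z y] that by (intro mult_left_mono) auto
    finally show ?thesis by (simp add: hit_avg_def)
  qed
  have "\<exists>z\<in>{0..1}. \<forall>y\<in>{0..1}. poly u z \<le> poly u y"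
    by (intro continuous_attains_inf continuous_intros) auto
  then obtain z where z: "z \<in> {0..1}" "\<And>y. y \<in> {0..1} \<Longrightarrow> poly u z \<le> poly u y"
    by blast
  have m: "poly u z \<le> poly u y \<and> poly u y \<le> poly u z + hit_avg" if "y \<in> {0..1}" for y
    using z(2)[OF that] osc[OF that z(1)] by auto
  \<comment> \<open>The fewest steps of length at most 1; rounding up costs at most one step, which
    is the origin of the factor \<open>t + 1\<close>.\<close>
  define n where "n = nat \<lceil>t\<rceil>"
  have n: "real n \<ge> t" "real n \<le> t + 1" "real n > 0" unfolding n_def using t by linarith+
  define h where "h = t / real n"
  have h: "0 < h" "h \<le> 1" "real n * h = t" using n t by (auto simp: h_def)
  have fC: "\<bar>poly (gen_poly u) y\<bar> \<le> 1" if "y \<in> {0..1}" for y using f[OF that] c0 c1 unfolding gen_u by auto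
  have t0: "0 \<le> t" using t by simp
  have [measurable]: "occ (poly f) t \<in> borel_measurable \<Omega>" by (intro occ_measurable t0 borel_measurable_poly)
  have [measurable]: "mart u t \<in> borel_measurable \<Omega>" "mart u 0 \<in> borel_measurable \<Omega>" using t0 by auto
  obtain C where C: "0 \<le> C" "\<And>\<omega> r. \<omega> \<in> space \<Omega> \<Longrightarrow> r \<in> {0..t} \<Longrightarrow> \<bar>mart u r \<omega>\<bar> \<le> C" using mart_bounded[OF t0, of u] by auto
  have "(\<integral>\<omega>. exp (\<theta> * (occ (poly f) t \<omega> - t * c)) \<partial>P x) \<le> (\<integral>\<omega>. exp (\<theta> * hit_avg) * exp (\<theta> * (mart u t \<omega> - mart u 0 \<omega>)) \<partial>P x)"
  proof (rule integral_mono)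
    show "integrable (P x) (\<lambda>\<omega>. exp (\<theta> * (occ (poly f) t \<omega> - t * c)))"
    proof (rule integrable_const_bound[where B = "exp (\<theta> * t)"])
      show "AE \<omega> in P x. norm (exp (\<theta> * (occ (poly f) t \<omega> - t * c))) \<le> exp (\<theta> * t)"
      proof (rule AE_I2)
        fix \<omega> assume "\<omega> \<in> space (P x)"
        then have "occ (poly f) t \<omega> \<le> t" by (intro occ_bounds f t0 borel_measurable_poly) auto
        moreover have "0 \<le> t * c" using t c0 by simp
        ultimately have "occ (poly f) t \<omega> - t * c \<le> t" by linarith
        then show "norm (exp (\<theta> * (occ (poly f) t \<omega> - t * c))) \<le> exp (\<theta> * t)"
          using \<theta> by (auto intro!: mult_left_mono)
      qed
    qed simp
    show "integrable (P x) (\<lambda>\<omega>. exp (\<theta> * hit_avg) * exp (\<theta> * (mart u t \<omega> - mart u 0 \<omega>)))"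
    proof (intro integrable_mult_right integrable_const_bound[where B = "exp (\<theta> * (2 * C))"])
      show "AE \<omega> in P x. norm (exp (\<theta> * (mart u t \<omega> - mart u 0 \<omega>))) \<le> exp (\<theta> * (2 * C))"
      proof (rule AE_I2)
        fix \<omega> assume "\<omega> \<in> space (P x)"
        then have \<omega>: "\<omega> \<in> space \<Omega>" by simp
        have "mart u t \<omega> - mart u 0 \<omega> \<le> 2 * C"
          using C(2)[OF \<omega>, of t] C(2)[OF \<omega>, of 0] t0 by (auto simp: abs_le_iff)
        then show "norm (exp (\<theta> * (mart u t \<omega> - mart u 0 \<omega>))) \<le> exp (\<theta> * (2 * C))"
          using \<theta> by (auto intro!: mult_left_mono)
      qed
    qed simp
    fix \<omega> assume "\<omega> \<in> space (P x)"
    then have \<omega>: "\<omega> \<in> space \<Omega>" by simp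
    have bounds: "0 \<le> poly f y \<and> poly f y \<le> 1" if "y \<in> {0..1}" for y using f[OF that] .
    have int: "set_integrable lborel {0..t} (\<lambda>r. poly f (X r \<omega>))"
      by (rule path_set_integrable[OF \<omega> borel_measurable_poly, where C = 1]) (use f in auto)
    have "occ (poly (gen_poly u)) t \<omega> = (LINT r:{0..t}|lborel. c - poly f (X r \<omega>))"
      by (simp add: occ_def gen_u)
    also have "\<dots> = c * t - occ (poly f) t \<omega>"
      using int t0 unfolding occ_def
      by (subst set_integral_diff) (auto simp: set_integrable_def set_lebesgue_integral_def)
    finally have "mart u t \<omega> - mart u 0 \<omega> = poly u (X t \<omega>) - poly u (X 0 \<omega>) + (occ (poly f) t \<omega> - t * c)"
      using occ_0[OF \<omega> borel_measurable_poly fC] by (simp add: mart_def mult.commute)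
    moreover have "\<bar>poly u (X t \<omega>) - poly u (X 0 \<omega>)\<bar> \<le> hit_avg" by (intro osc X_unit \<omega> t0 order_refl)
    ultimately have "occ (poly f) t \<omega> - t * c \<le> hit_avg + (mart u t \<omega> - mart u 0 \<omega>)" by linarith
    then have "\<theta> * (occ (poly f) t \<omega> - t * c) \<le> \<theta> * (hit_avg + (mart u t \<omega> - mart u 0 \<omega>))"
      using \<theta> by (rule mult_left_mono)
    then show "exp (\<theta> * (occ (poly f) t \<omega> - t * c)) \<le> exp (\<theta> * hit_avg) * exp (\<theta> * (mart u t \<omega> - mart u 0 \<omega>))"
      by (simp add: exp_add[symmetric] distrib_left)
  qed
  also have "\<dots> = exp (\<theta> * hit_avg) * (\<integral>\<omega>. exp (\<theta> * (mart u (real n * h) \<omega> - mart u 0 \<omega>)) \<partial>P x)"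
    by (simp add: h(3))
  also have "\<dots> \<le> exp (\<theta> * hit_avg) * exp (real n * (\<theta>\<^sup>2 * (hit_avg + h)\<^sup>2 / 8))"
    by (intro mult_left_mono mgf_martingale[OF f gen_u c0 c1 m h(1) \<theta>]) auto
  also have "\<dots> \<le> exp (\<theta> * hit_avg + \<theta>\<^sup>2 * ((t + 1) * (hit_avg + 1)\<^sup>2) / 8)"
  proof -
    have "real n * (hit_avg + h)\<^sup>2 \<le> (t + 1) * (hit_avg + 1)\<^sup>2"
      using n h hit_avg_nonneg t by (intro mult_mono power_mono) auto
    then have "\<theta>\<^sup>2 * (real n * (hit_avg + h)\<^sup>2) \<le> \<theta>\<^sup>2 * ((t + 1) * (hit_avg + 1)\<^sup>2)"
      by (intro mult_left_mono) auto
    then show ?thesis by (simp add: exp_add[symmetric] mult_ac)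
  qed
  finally show ?thesis unfolding c .
qed

end

section \<open>Hitting times\<close>

text \<open>Only cells that begin strictly before \<theta> are counted, so the sum ends at the first
  grid point not before \<theta>, at most \<open>h\<close> late, unless the horizon
  \<open>n * h\<close> comes first.\<close>

lemma stopped_sum_telescope:
  fixes Z :: "real \<Rightarrow> real"
  assumes "0 \<le> \<theta>" "0 < h"
  shows "\<exists>v. (\<Sum>k<n. if real k * h < \<theta> then Z (real (Suc k) * h) - Z (real k * h) else 0) = Z v - Z 0 \<and>
    min \<theta> (real n * h) \<le> v \<and> v \<le> min (\<theta> + h) (real n * h)"
proof (induction n)
  case 0
  then show ?case using assms by (intro exI[of _ 0]) auto
next
  case (Suc n)
  then obtain v where v: "(\<Sum>k<n. if real k * h < \<theta> then Z (real (Suc k) * h) - Z (real k * h) else 0) = Z v - Z 0"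
    "min \<theta> (real n * h) \<le> v" "v \<le> min (\<theta> + h) (real n * h)" by blast
  have e: "real (Suc n) * h = real n * h + h" by (simp add: algebra_simps)
  show ?case
  proof (cases "real n * h < \<theta>")
    case True
    then have "v = real n * h" using v by auto
    then show ?thesis
      using v(1) True assms by (intro exI[of _ "real (Suc n) * h"]) (auto simp: e simp del: of_nat_Suc)
  next
    case False
    then show ?thesis
      using v assms by (intro exI[of _ v]) (auto simp: e min_def simp del: of_nat_Suc split: if_splits)
  qed
qed

section \<open>Hitting times as stopping times, optional stopping and mean hitting times\<close>

context jacobi_started begin

text \<open>By continuity the times at which the path is at \<open>y\<close> form a closed set, so
  the infimum is attained; over the empty set it is \<open>\<top>\<close>.\<close>

lemma hitting_time_cases:
  assumes \<omega>: "\<omega> \<in> space \<Omega>"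
  obtains "hitting_time X y \<omega> = \<top>" "\<And>r. 0 \<le> r \<Longrightarrow> X r \<omega> \<noteq> y"
  | m where "0 \<le> m" "hitting_time X y \<omega> = ennreal m" "X m \<omega> = y" "\<And>r. 0 \<le> r \<Longrightarrow> r < m \<Longrightarrow> X r \<omega> \<noteq> y"
proof (cases "\<exists>r\<ge>0. X r \<omega> = y")
  case False
  then have "{t. 0 \<le> t \<and> X t \<omega> = y} = {}" by auto
  then have "hitting_time X y \<omega> = \<top>" by (simp add: hitting_time_def)
  then show ?thesis using that(1) False by blast
next
  case True
  define S where "S = {t \<in> {0..}. X t \<omega> = y}"
  have S: "S \<noteq> {}" "bdd_below S"
    unfolding S_def using True by (auto intro!: bdd_belowI[of _ 0])
  have "closed S"
    unfolding S_def by (intro continuous_closed_preimage_constant continuous_paths \<omega>) simp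
  have m: "Inf S \<in> S" by (rule closed_contains_Inf) fact+
  have le: "Inf S \<le> r" if "r \<in> S" for r using that S by (intro cInf_lower)
  have "hitting_time X y \<omega> = ennreal (Inf S)"
    unfolding hitting_time_def
    by (rule antisym, rule INF_lower) (use m le in \<open>auto simp: S_def intro!: INF_greatest ennreal_leI\<close>)
  moreover have "X r \<omega> \<noteq> y" if "0 \<le> r" "r < Inf S" for r
    using le[of r] that by (auto simp: S_def)
  ultimately show ?thesis using that(2)[of "Inf S"] m by (auto simp: S_def)
qed

lemma less_hitting_time_iff:
  assumes \<omega>: "\<omega> \<in> space \<Omega>" and s: "0 \<le> s"
  shows "ennreal s < hitting_time X y \<omega> \<longleftrightarrow> (\<forall>r\<in>{0..s}. X r \<omega> \<noteq> y)"
  using hitting_time_cases[OF \<omega>, of y]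
proof cases
  case 1
  then show ?thesis by (auto simp: ennreal_less_top)
next
  case (2 m)
  show ?thesis
  proof
    assume "ennreal s < hitting_time X y \<omega>"
    then have "s < m" using 2 s by (simp add: ennreal_less_iff)
    then show "\<forall>r\<in>{0..s}. X r \<omega> \<noteq> y" using 2(4) by auto
  next
    assume "\<forall>r\<in>{0..s}. X r \<omega> \<noteq> y"
    then have "\<not> m \<le> s" using 2(1,3) by auto
    then have "s < m" by simp
    then show "ennreal s < hitting_time X y \<omega>" using 2 s by (simp add: ennreal_less_iff)
  qed
qed

text \<open>Avoiding \<open>y\<close> on the compact interval \<open>{0..s}\<close> means keeping a
  positive distance from it, and by continuity that distance can be tested at rational times. The
  strict inequality keeps the event in the filtration at \<open>s\<close> itself.\<close>

lemma hitting_time_set: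
  assumes s: "0 \<le> s"
  shows "{\<omega> \<in> space \<Omega>. ennreal s < hitting_time X y \<omega>} \<in> sets (filt s)"
proof -
  \<comment> \<open>The clamp turns every rational into an admissible time not later than
    \<open>s\<close>.\<close>
  define cl where "cl q = max 0 (min s q)" for q
  have cl: "cl q \<in> {0..s}" for q using s by (auto simp: cl_def)
  have cl_id: "cl r = r" if "r \<in> {0..s}" for r using that by (auto simp: cl_def)
  have X_cl: "X (cl (of_rat q)) \<in> borel_measurable (filt s)" for q
    using cl[of "of_rat q"] by (intro measurable_X_filt) auto
  have "{\<omega> \<in> space (filt s). \<exists>m::nat. \<forall>q::rat. 1 / real (Suc m) \<le> \<bar>X (cl (of_rat q)) \<omega> - y\<bar>} \<in> sets (filt s)"
    by (intro sets.sets_Collect_countable_Ex sets.sets_Collect_countable_All borel_measurable_le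
        borel_measurable_const borel_measurable_abs borel_measurable_diff X_cl)
  also have "{\<omega> \<in> space (filt s). \<exists>m::nat. \<forall>q::rat. 1 / real (Suc m) \<le> \<bar>X (cl (of_rat q)) \<omega> - y\<bar>} = 
     {\<omega> \<in> space \<Omega>. ennreal s < hitting_time X y \<omega>}"
  proof -
    have "(\<exists>m::nat. \<forall>q::rat. 1 / real (Suc m) \<le> \<bar>X (cl (of_rat q)) \<omega> - y\<bar>) \<longleftrightarrow> ennreal s < hitting_time X y \<omega>"
      if \<omega>: "\<omega> \<in> space \<Omega>" for \<omega>
    proof -
      have "continuous_on UNIV cl" unfolding cl_def by (intro continuous_intros)
    then have "continuous_on UNIV (\<lambda>q. X (cl q) \<omega>)"
      by (rule continuous_on_compose2[OF continuous_paths[OF \<omega>]]) (use cl in auto)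
    then have cont: "continuous_on UNIV (\<lambda>q. \<bar>X (cl q) \<omega> - y\<bar>)"
      by (intro continuous_intros)
    show ?thesis
      unfolding less_hitting_time_iff[OF \<omega> s]
    proof
      assume "\<exists>m::nat. \<forall>q::rat. 1 / real (Suc m) \<le> \<bar>X (cl (of_rat q)) \<omega> - y\<bar>"
      then obtain m :: nat where m: "\<And>q::rat. 1 / real (Suc m) \<le> \<bar>X (cl (of_rat q)) \<omega> - y\<bar>" by blast
      have "closed {q. 1 / real (Suc m) \<le> \<bar>X (cl q) \<omega> - y\<bar>}"
        by (intro closed_Collect_le continuous_on_const cont)
      then have "closure \<rat> \<subseteq> {q. 1 / real (Suc m) \<le> \<bar>X (cl q) \<omega> - y\<bar>}"
        using m by (intro closure_minimal) (auto simp: Rats_def)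
      then have "1 / real (Suc m) \<le> \<bar>X (cl q) \<omega> - y\<bar>" for q
        unfolding Rats_closure_real by auto
      then have pos: "0 < \<bar>X (cl q) \<omega> - y\<bar>" for q
        by (rule less_le_trans[rotated]) simp
      show "\<forall>r\<in>{0..s}. X r \<omega> \<noteq> y"
      proof
        fix r assume "r \<in> {0..s}"
        then show "X r \<omega> \<noteq> y" using pos[of r] by (simp add: cl_id)
      qed
    next
      assume no: "\<forall>r\<in>{0..s}. X r \<omega> \<noteq> y"
      have "\<exists>r\<in>{0..s}. \<forall>q\<in>{0..s}. \<bar>X (cl r) \<omega> - y\<bar> \<le> \<bar>X (cl q) \<omega> - y\<bar>"
        using s by (intro continuous_attains_inf continuous_on_subset[OF cont]) auto
      then obtain r where r: "r \<in> {0..s}" "\<And>q. q \<in> {0..s} \<Longrightarrow> \<bar>X (cl r) \<omega> - y\<bar> \<le> \<bar>X (cl q) \<omega> - y\<bar>" by blast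
      have "0 < \<bar>X (cl r) \<omega> - y\<bar>" using no r(1) by (simp add: cl_id)
      then obtain m :: nat where m: "1 / real (Suc m) < \<bar>X (cl r) \<omega> - y\<bar>"
        by (rule nat_approx_posE)
      have "1 / real (Suc m) \<le> \<bar>X (cl q) \<omega> - y\<bar>" for q
        using r(2)[OF cl[of q]] m cl_id[OF cl[of q]] by simp
      then show "\<exists>m::nat. \<forall>q::rat. 1 / real (Suc m) \<le> \<bar>X (cl (of_rat q)) \<omega> - y\<bar>" by blast
    qed
    qed
    then show ?thesis unfolding space_filt by blast
  qed
  finally show ?thesis .
qed

lemma hitting_time_measurable [measurable]: "hitting_time X y \<in> borel_measurable \<Omega>"
proof (rule borel_measurableI_greater)
  fix c :: ennreal
  show "{\<omega> \<in> space \<Omega>. c < hitting_time X y \<omega>} \<in> sets \<Omega>"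
  proof (cases c)
    case (real r)
    then show ?thesis using hitting_time_set[of r y] filt_subset[of r] by auto
  next
    case top
    then show ?thesis by simp
  qed
qed

definition stop :: "real \<Rightarrow> real \<Rightarrow> 'w \<Rightarrow> real" where
  "stop y T \<omega> = enn2real (min (hitting_time X y \<omega>) (ennreal T))"

lemma stop_measurable [measurable]: "stop y T \<in> borel_measurable \<Omega>"
  unfolding stop_def by measurable

lemma stop_bounds: "0 \<le> T \<Longrightarrow> stop y T \<omega> \<in> {0..T}"
  unfolding stop_def using enn2real_mono[of "min (hitting_time X y \<omega>) (ennreal T)" "ennreal T"]
  by simp

lemma ennreal_stop: "ennreal (stop y T \<omega>) = min (hitting_time X y \<omega>) (ennreal T)"
  unfolding stop_def by (intro ennreal_enn2real) (simp add: min_less_iff_disj)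

lemma less_stop_iff:
  assumes "0 \<le> s" "0 \<le> T"
  shows "s < stop y T \<omega> \<longleftrightarrow> s < T \<and> ennreal s < hitting_time X y \<omega>"
proof -
  have "s < stop y T \<omega> \<longleftrightarrow> ennreal s < ennreal (stop y T \<omega>)"
    using assms by (simp add: ennreal_less_iff)
  then show ?thesis
    unfolding ennreal_stop using assms by (auto simp: ennreal_less_iff)
qed

lemma occ_tendsto:
  assumes \<omega>: "\<omega> \<in> space \<Omega>" and f: "f \<in> borel_measurable borel"
    and C: "\<And>y. y \<in> {0..1} \<Longrightarrow> \<bar>f y\<bar> \<le> C" and v: "\<And>n. 0 \<le> v n" "0 \<le> l" "v \<longlonglongrightarrow> l"
  shows "(\<lambda>n. occ f (v n) \<omega>) \<longlonglongrightarrow> occ f l \<omega>"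
proof -
  have lip: "\<bar>occ f t \<omega> - occ f s \<omega>\<bar> \<le> C * (t - s)" if "0 \<le> s" "s \<le> t" for s t
  proof -
    have b: "- C \<le> f y \<and> f y \<le> C" if "y \<in> {0..1}" for y using C[OF that] by (auto simp: abs_le_iff)
    have "occ f t \<omega> - occ f s \<omega> = (LINT r:{s..t}|lborel. f (X r \<omega>))" by (rule occ_diff[OF \<omega> f C that])
    then show ?thesis
      using path_integral_bounds[OF \<omega> f b that] by (simp add: abs_le_iff)
  qed
  have "(\<lambda>n. occ f (v n) \<omega> - occ f l \<omega>) \<longlonglongrightarrow> 0"
  proof (rule Lim_null_comparison)
    show "\<forall>\<^sub>F n in sequentially. norm (occ f (v n) \<omega> - occ f l \<omega>) \<le> C * \<bar>v n - l\<bar>"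
    proof (rule always_eventually, rule allI)
      fix n show "norm (occ f (v n) \<omega> - occ f l \<omega>) \<le> C * \<bar>v n - l\<bar>"
        using lip[of l "v n"] lip[of "v n" l] v by (cases "l \<le> v n") auto
    qed
    have "(\<lambda>n. C * \<bar>v n - l\<bar>) \<longlonglongrightarrow> C * \<bar>l - l\<bar>" by (intro tendsto_intros v)
    then show "(\<lambda>n. C * \<bar>v n - l\<bar>) \<longlonglongrightarrow> 0" by simp
  qed
  then show ?thesis by (simp add: LIM_zero_iff)
qed

text \<open>On the grid of mesh \<open>T / (n + 1)\<close> each increment is weighted by the event
  that \<open>y\<close> has not been hit by the start of the cell; this event belongs to the
  filtration there, so every summand has mean 0. The sums telescope to the martingale at most one
  cell after the stopping time, and dominated convergence concludes.\<close>

lemma optional_stopping: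
  assumes T: "0 < T"
  shows "(\<lambda>\<omega>. mart u (stop y T \<omega>) \<omega>) \<in> borel_measurable \<Omega>"
    and "(\<integral>\<omega>. mart u (stop y T \<omega>) \<omega> - mart u 0 \<omega> \<partial>P x) = 0"
proof -
  have T0: "0 \<le> T" using T by simp
  obtain C where C: "0 \<le> C" "\<And>\<omega> r. \<omega> \<in> space \<Omega> \<Longrightarrow> r \<in> {0..T} \<Longrightarrow> \<bar>mart u r \<omega>\<bar> \<le> C" using mart_bounded[OF T0, of u] by auto
  obtain B where B: "0 \<le> B" "\<And>y. y \<in> {0..1} \<Longrightarrow> \<bar>poly (gen_poly u) y\<bar> \<le> B" using poly_bounded_unit[of "gen_poly u"] by blast
  define h where "h n = T / real (Suc n)" for n
  have h: "0 < h n" "real (Suc n) * h n = T" for n using T by (auto simp: h_def)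
  define D where "D n k = {\<omega> \<in> space \<Omega>. ennreal (real k * h n) < hitting_time X y \<omega>}" for n k
  have D: "D n k \<in> sets (filt (real k * h n))" for n k
    unfolding D_def using h by (intro hitting_time_set) (simp add: less_imp_le)
  have D' [measurable]: "D n k \<in> sets \<Omega>" for n k using D filt_subset by blast
  define Sn where "Sn n \<omega> = (\<Sum>k<Suc n. indicat_real (D n k) \<omega> * (mart u (real (Suc k) * h n) \<omega> - mart u (real k * h n) \<omega>))" for n \<omega>
  have [measurable]: "mart u (real k * h n) \<in> borel_measurable \<Omega>" for k n
    using h[of n] by (intro mart_measurable) (simp add: less_imp_le)
  have Sn_meas [measurable]: "Sn n \<in> borel_measurable \<Omega>" for n unfolding Sn_def by measurable
  have Sn: "\<exists>v. Sn n \<omega> = mart u v \<omega> - mart u 0 \<omega> \<and> stop y T \<omega> \<le> v \<and> v \<le> stop y T \<omega> + h n \<and> v \<le> T" if \<omega>: "\<omega> \<in> space \<Omega>" for n \<omega>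
  proof -
    have "indicat_real (D n k) \<omega> * (mart u (real (Suc k) * h n) \<omega> - mart u (real k * h n) \<omega>) = 
      (if real k * h n < stop y T \<omega> then mart u (real (Suc k) * h n) \<omega> - mart u (real k * h n) \<omega> else 0)" if "k < Suc n" for k
    proof -
      have "real k * h n < real (Suc n) * h n" using h that by (intro mult_strict_right_mono) auto
      then have "real k * h n < T" by (simp only: h(2))
      moreover have "0 \<le> real k * h n" using h[of n] by (simp add: less_imp_le)
      ultimately have "real k * h n < stop y T \<omega> \<longleftrightarrow> \<omega> \<in> D n k"
        using less_stop_iff[of "real k * h n" T y \<omega>] T0 \<omega> by (simp add: D_def)
      then show ?thesis by simp
    qed
    then have "Sn n \<omega> = (\<Sum>k<Suc n. if real k * h n < stop y T \<omega> then mart u (real (Suc k) * h n) \<omega> - mart u (real k * h n) \<omega> else 0)"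
      unfolding Sn_def by (intro sum.cong) auto
    then show ?thesis
      using stopped_sum_telescope[of "stop y T \<omega>" "h n" "\<lambda>v. mart u v \<omega>" "Suc n"] stop_bounds[OF T0, of y \<omega>] h(1)[of n]
      unfolding h(2) by auto
  qed
  have lim: "(\<lambda>n. Sn n \<omega>) \<longlonglongrightarrow> mart u (stop y T \<omega>) \<omega> - mart u 0 \<omega>" if \<omega>: "\<omega> \<in> space \<Omega>" for \<omega>
  proof -
    obtain v where v: "\<And>n. Sn n \<omega> = mart u (v n) \<omega> - mart u 0 \<omega>" "\<And>n. stop y T \<omega> \<le> v n" "\<And>n. v n \<le> stop y T \<omega> + h n"
      using Sn[OF \<omega>] by metis
    have s0: "0 \<le> stop y T \<omega>" using stop_bounds[OF T0, of y \<omega>] by simp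
    have v0: "0 \<le> v n" for n using s0 v(2)[of n] by linarith
    have "h \<longlonglongrightarrow> 0" unfolding h_def by real_asymp
    then have "(\<lambda>n. stop y T \<omega> + h n) \<longlonglongrightarrow> stop y T \<omega> + 0" by (intro tendsto_intros)
    then have vl: "v \<longlonglongrightarrow> stop y T \<omega>"
      by (intro tendsto_sandwich[of "\<lambda>_. stop y T \<omega>" v _ "\<lambda>n. stop y T \<omega> + h n"]) (use v in auto)
    have "(\<lambda>n. X (v n) \<omega>) \<longlonglongrightarrow> X (stop y T \<omega>) \<omega>"
      by (rule continuous_on_tendsto_compose[OF continuous_paths[OF \<omega>] vl]) (use s0 v0 in auto)
    then show ?thesis unfolding v(1) mart_def
      by (intro tendsto_diff tendsto_const tendsto_poly occ_tendsto[OF \<omega> borel_measurable_poly B(2) v0 s0 vl])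
  qed
  \<comment> \<open>Measurability of the stopped martingale is inherited from the grid sums as their
    pointwise limit.\<close>
  have meas: "(\<lambda>\<omega>. mart u (stop y T \<omega>) \<omega> - mart u 0 \<omega>) \<in> borel_measurable \<Omega>"
    by (rule borel_measurable_LIMSEQ_real[OF lim]) auto
  have [measurable]: "mart u 0 \<in> borel_measurable \<Omega>" by (rule mart_measurable) simp
  have "(\<lambda>\<omega>. (mart u (stop y T \<omega>) \<omega> - mart u 0 \<omega>) + mart u 0 \<omega>) \<in> borel_measurable \<Omega>"
    using meas by measurable
  then show "(\<lambda>\<omega>. mart u (stop y T \<omega>) \<omega>) \<in> borel_measurable \<Omega>" by simp
  have "(\<lambda>n. \<integral>\<omega>. Sn n \<omega> \<partial>P x) \<longlonglongrightarrow> (\<integral>\<omega>. mart u (stop y T \<omega>) \<omega> - mart u 0 \<omega> \<partial>P x)"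
  proof (rule integral_dominated_convergence[where w = "\<lambda>_. 2 * C"])
    show "AE \<omega> in P x. (\<lambda>n. Sn n \<omega>) \<longlonglongrightarrow> mart u (stop y T \<omega>) \<omega> - mart u 0 \<omega>"
      using lim by (intro AE_I2) simp
    show "AE \<omega> in P x. norm (Sn n \<omega>) \<le> 2 * C" for n
    proof (rule AE_I2)
      fix \<omega> assume "\<omega> \<in> space (P x)"
      then have \<omega>: "\<omega> \<in> space \<Omega>" by simp
      obtain v where v: "Sn n \<omega> = mart u v \<omega> - mart u 0 \<omega>" "stop y T \<omega> \<le> v" "v \<le> T" using Sn[OF \<omega>, of n] by blast
      then have "v \<in> {0..T}" using stop_bounds[OF T0, of y \<omega>] by auto
      then show "norm (Sn n \<omega>) \<le> 2 * C" unfolding v(1) real_norm_def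
        using C(2)[OF \<omega>, of v] C(2)[OF \<omega>, of 0] T0 by auto
    qed
  qed (use meas in auto)
  moreover have "(\<integral>\<omega>. Sn n \<omega> \<partial>P x) = 0" for n
  proof -
    have "(\<integral>\<omega>. Sn n \<omega> \<partial>P x) = (\<Sum>k<Suc n. \<integral>\<omega>. indicat_real (D n k) \<omega> * (mart u (real (Suc k) * h n) \<omega> - mart u (real k * h n) \<omega>) \<partial>P x)"
      unfolding Sn_def
    proof (rule Bochner_Integration.integral_sum)
      fix k assume "k \<in> {..<Suc n}"
      then have "real (Suc k) * h n \<le> real (Suc n) * h n" "real k * h n \<le> real (Suc n) * h n"
        using h(1)[of n] by (auto intro!: mult_right_mono)
      then have r: "real (Suc k) * h n \<in> {0..T}" "real k * h n \<in> {0..T}"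
        unfolding h(2) using h(1)[of n] by (auto intro!: mult_nonneg_nonneg)
      show "integrable (P x) (\<lambda>\<omega>. indicat_real (D n k) \<omega> * (mart u (real (Suc k) * h n) \<omega> - mart u (real k * h n) \<omega>))"
      proof (rule integrable_const_bound[where B = "2 * C"])
        show "AE \<omega> in P x. norm (indicat_real (D n k) \<omega> * (mart u (real (Suc k) * h n) \<omega> - mart u (real k * h n) \<omega>)) \<le> 2 * C"
        proof (rule AE_I2)
          fix \<omega> assume "\<omega> \<in> space (P x)"
          then have \<omega>: "\<omega> \<in> space \<Omega>" by simp
          show "norm (indicat_real (D n k) \<omega> * (mart u (real (Suc k) * h n) \<omega> - mart u (real k * h n) \<omega>)) \<le> 2 * C"
            using C(2)[OF \<omega> r(1)] C(2)[OF \<omega> r(2)] C(1) by (auto simp: indicator_def simp del: of_nat_Suc)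
        qed
      qed (simp del: of_nat_Suc)
    qed
    also have "\<dots> = 0"
      using h(1)[of n] by (intro sum.neutral ballI martingale[OF D]) (auto intro!: mult_right_mono)
    finally show ?thesis .
  qed
  ultimately show "(\<integral>\<omega>. mart u (stop y T \<omega>) \<omega> - mart u 0 \<omega> \<partial>P x) = 0"
    by (simp add: LIMSEQ_const_iff)
qed


text \<open>A path that starts in \<open>J\<close> and leaves it must pass through \<open>y\<close>,
  by the intermediate value theorem.\<close>

lemma stays_before_stop:
  assumes \<omega>: "\<omega> \<in> space \<Omega>" and X0: "X 0 \<omega> = x" and T: "0 \<le> T"
    and side: "x \<le> y \<and> J = {0..y} \<or> y \<le> x \<and> J = {y..1}"
    and r: "0 \<le> r" "r \<le> stop y T \<omega>"
  shows "X r \<omega> \<in> J"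
proof (rule ccontr)
  assume nJ: "X r \<omega> \<notin> J"
  have cont: "continuous_on {0..r} (\<lambda>t. X t \<omega>)"
    by (rule continuous_on_subset[OF continuous_paths[OF \<omega>]]) auto
  have unit: "X r \<omega> \<in> {0..1}" by (rule X_unit[OF \<omega> r(1)])
  have "\<exists>v. 0 \<le> v \<and> v \<le> r \<and> X v \<omega> = y"
    using side
  proof
    assume "x \<le> y \<and> J = {0..y}"
    then show ?thesis using nJ unit X0 r(1) by (intro IVT'[OF _ _ _ cont]) auto
  next
    assume "y \<le> x \<and> J = {y..1}"
    then show ?thesis using nJ unit X0 r(1) by (intro IVT2'[OF _ _ _ cont]) auto
  qed
  then obtain v where v: "0 \<le> v" "v \<le> r" "X v \<omega> = y" by blast
  have "y \<in> J" using side v X_unit[OF \<omega> v(1)] by auto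
  then have "v < r" using v nJ by (cases "v = r") auto
  then have "v < stop y T \<omega>" using r by simp
  then have "ennreal v < hitting_time X y \<omega>" using less_stop_iff[OF v(1) T] by simp
  then show False using less_hitting_time_iff[OF \<omega> v(1)] v by auto
qed

text \<open>Until the stopping time the path stays in \<open>J\<close>, where the generator of
  \<open>u\<close> is within \<delta> of 1, so the compensator is the elapsed time up to a relative
  error \<delta>; optional stopping turns this into expectations.\<close>

lemma stopped_estimate:
  assumes T: "0 < T" and \<delta>: "0 \<le> \<delta>"
    and side: "x \<le> y \<and> J = {0..y} \<or> y \<le> x \<and> J = {y..1}"
    and u: "\<And>z. z \<in> J \<Longrightarrow> \<bar>poly (gen_poly u) z - 1\<bar> \<le> \<delta>"
  shows "integrable (P x) (stop y T)"
    and "(\<lambda>\<omega>. poly u (X (stop y T \<omega>) \<omega>)) \<in> borel_measurable \<Omega>"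
    and "\<bar>(\<integral>\<omega>. poly u (X (stop y T \<omega>) \<omega>) \<partial>P x) - poly u x - (\<integral>\<omega>. stop y T \<omega> \<partial>P x)\<bar> \<le> \<delta> * (\<integral>\<omega>. stop y T \<omega> \<partial>P x)"
proof -
  have T0: "0 \<le> T" using T by simp
  show int_stop: "integrable (P x) (stop y T)"
    by (rule integrable_const_bound[where B = T]) (use stop_bounds[OF T0, of y] in auto)
  have [measurable]: "(\<lambda>(t, \<omega>). X (max 0 (min T t)) \<omega>) \<in> borel_measurable (borel \<Otimes>\<^sub>M \<Omega>)"
    using T0 by (intro borel_measurable_path_pair measurable_X) (auto intro: continuous_on_subset[OF continuous_paths])
  have "(\<lambda>\<omega>. (\<lambda>(t, \<omega>). X (max 0 (min T t)) \<omega>) (stop y T \<omega>, \<omega>)) \<in> borel_measurable \<Omega>"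
    by measurable
  also have "(\<lambda>\<omega>. (\<lambda>(t, \<omega>). X (max 0 (min T t)) \<omega>) (stop y T \<omega>, \<omega>)) = (\<lambda>\<omega>. X (stop y T \<omega>) \<omega>)"
    using stop_bounds[OF T0, of y] by (auto simp: fun_eq_iff)
  finally have X_stop [measurable]: "(\<lambda>\<omega>. X (stop y T \<omega>) \<omega>) \<in> borel_measurable \<Omega>" .
  then show uX_meas [measurable]: "(\<lambda>\<omega>. poly u (X (stop y T \<omega>) \<omega>)) \<in> borel_measurable \<Omega>"
    by measurable
  obtain A where A: "0 \<le> A" "\<And>y. y \<in> {0..1} \<Longrightarrow> \<bar>poly u y\<bar> \<le> A" using poly_bounded_unit[of u] by blast
  obtain B where B: "0 \<le> B" "\<And>y. y \<in> {0..1} \<Longrightarrow> \<bar>poly (gen_poly u) y\<bar> \<le> B" using poly_bounded_unit[of "gen_poly u"] by blast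
  obtain C where C: "0 \<le> C" "\<And>\<omega> r. \<omega> \<in> space \<Omega> \<Longrightarrow> r \<in> {0..T} \<Longrightarrow> \<bar>mart u r \<omega>\<bar> \<le> C" using mart_bounded[OF T0, of u] by auto
  have s0: "0 \<le> stop y T \<omega>" for \<omega> using stop_bounds[OF T0, of y \<omega>] by simp
  have int_u: "integrable (P x) (\<lambda>\<omega>. poly u (X (stop y T \<omega>) \<omega>))"
  proof (rule integrable_const_bound[where B = A])
    show "AE \<omega> in P x. norm (poly u (X (stop y T \<omega>) \<omega>)) \<le> A"
      using A(2) X_unit s0 by (intro AE_I2) simp
  qed simp
  note [measurable] = optional_stopping(1)[OF T, of u y]
  have [measurable]: "mart u 0 \<in> borel_measurable \<Omega>" by (rule mart_measurable) simp
  have int_m: "integrable (P x) (\<lambda>\<omega>. mart u (stop y T \<omega>) \<omega>)" "integrable (P x) (\<lambda>\<omega>. mart u 0 \<omega>)"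
    by (rule integrable_const_bound[where B = C]; use C(2) stop_bounds[OF T0, of y] T0 in \<open>auto intro!: AE_I2\<close>)+
  define I where "I \<omega> = occ (poly (gen_poly u)) (stop y T \<omega>) \<omega>" for \<omega>
  have I_eq: "I \<omega> = poly u (X (stop y T \<omega>) \<omega>) - mart u (stop y T \<omega>) \<omega>" for \<omega>
    by (simp add: I_def mart_def)
  have int_I: "integrable (P x) I" unfolding I_eq[abs_def] by (intro Bochner_Integration.integrable_diff int_u int_m)
  have "(\<integral>\<omega>. mart u 0 \<omega> \<partial>P x) = (\<integral>\<omega>. poly u x \<partial>P x)"
  proof (rule integral_cong_AE)
    show "AE \<omega> in P x. mart u 0 \<omega> = poly u x"
      using start[OF x_in] AE_space
    proof eventually_elim
      case (elim \<omega>)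
      then show ?case using occ_0[OF _ borel_measurable_poly B(2), of \<omega>] by (simp add: mart_def)
    qed
  qed simp_all
  then have m0: "(\<integral>\<omega>. mart u 0 \<omega> \<partial>P x) = poly u x" using prob_space by simp
  have "(\<integral>\<omega>. I \<omega> \<partial>P x) = (\<integral>\<omega>. poly u (X (stop y T \<omega>) \<omega>) \<partial>P x) - (\<integral>\<omega>. mart u (stop y T \<omega>) \<omega> \<partial>P x)"
    unfolding I_eq by (rule Bochner_Integration.integral_diff[OF int_u int_m(1)])
  also have "(\<integral>\<omega>. mart u (stop y T \<omega>) \<omega> \<partial>P x) = poly u x"
    using optional_stopping(2)[OF T, of u y] int_m m0 by simp
  finally have "(\<integral>\<omega>. poly u (X (stop y T \<omega>) \<omega>) \<partial>P x) - poly u x - (\<integral>\<omega>. stop y T \<omega> \<partial>P x) = (\<integral>\<omega>. I \<omega> - stop y T \<omega> \<partial>P x)"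
    using int_I int_stop by simp
  also have "\<bar>\<dots>\<bar> \<le> (\<integral>\<omega>. \<delta> * stop y T \<omega> \<partial>P x)"
  proof (rule order_trans[OF integral_abs_bound], rule integral_mono_AE)
    show "AE \<omega> in P x. \<bar>I \<omega> - stop y T \<omega>\<bar> \<le> \<delta> * stop y T \<omega>"
      using start[OF x_in] AE_space
    proof eventually_elim
      case (elim \<omega>)
      then have \<omega>: "\<omega> \<in> space \<Omega>" by simp
      let ?\<theta> = "stop y T \<omega>"
      have int: "set_integrable lborel {0..?\<theta>} (\<lambda>r. poly (gen_poly u) (X r \<omega>))"
        by (rule path_set_integrable[OF \<omega> borel_measurable_poly B(2)]) simp_all
      have c: "set_integrable lborel {0..?\<theta>} (\<lambda>r. c)" "(LINT r:{0..?\<theta>}|lborel. c) = c * ?\<theta>" for c :: real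
        using s0 by (auto simp: set_integrable_def set_lebesgue_integral_def)
      have near: "\<bar>poly (gen_poly u) (X r \<omega>) - 1\<bar> \<le> \<delta>" if "r \<in> {0..?\<theta>}" for r
        using that by (intro u stays_before_stop[OF \<omega> elim(1) T0 side]) auto
      have "(LINT r:{0..?\<theta>}|lborel. 1 - \<delta>) \<le> (LINT r:{0..?\<theta>}|lborel. poly (gen_poly u) (X r \<omega>))"
        by (intro set_integral_mono int c) (use near in \<open>force simp: abs_le_iff\<close>)
      moreover have "(LINT r:{0..?\<theta>}|lborel. poly (gen_poly u) (X r \<omega>)) \<le> (LINT r:{0..?\<theta>}|lborel. 1 + \<delta>)"
        by (intro set_integral_mono int c) (use near in \<open>force simp: abs_le_iff\<close>)
      ultimately show ?case
        unfolding c I_def occ_def by (simp add: abs_le_iff algebra_simps)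
    qed
  qed (use int_I int_stop in auto)
  finally show "\<bar>(\<integral>\<omega>. poly u (X (stop y T \<omega>) \<omega>) \<partial>P x) - poly u x - (\<integral>\<omega>. stop y T \<omega> \<partial>P x)\<bar> \<le> \<delta> * (\<integral>\<omega>. stop y T \<omega> \<partial>P x)"
    by simp
qed

text \<open>The cap \<open>T\<close> is sent to infinity. As \<delta> < 1, the error can be absorbed
  and the capped times have uniformly bounded means, so the hitting time is integrable and almost
  surely finite; only then is it known that the stopped path ends at \<open>y\<close>.\<close>

lemma hitting_estimate:
  assumes \<delta>: "0 \<le> \<delta>" "\<delta> < 1"
    and side: "x \<le> y \<and> J = {0..y} \<or> y \<le> x \<and> J = {y..1}"
    and u: "\<And>z. z \<in> J \<Longrightarrow> \<bar>poly (gen_poly u) z - 1\<bar> \<le> \<delta>"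
  defines "E \<equiv> (\<integral>\<^sup>+\<omega>. hitting_time X y \<omega> \<partial>P x)"
  shows "E < \<infinity>" "\<bar>poly u y - poly u x - enn2real E\<bar> \<le> \<delta> * enn2real E"
proof -
  obtain A where A: "0 \<le> A" "\<And>y. y \<in> {0..1} \<Longrightarrow> \<bar>poly u y\<bar> \<le> A" using poly_bounded_unit[of u] by blast
  define \<theta> where "\<theta> n = stop y (real (Suc n))" for n
  have pos: "0 < real (Suc n)" "0 \<le> real (Suc n)" for n by auto
  have \<theta>0: "0 \<le> \<theta> n \<omega>" for n \<omega> using stop_bounds[OF pos(2), of y n \<omega>] by (simp add: \<theta>_def)
  note est = stopped_estimate[OF pos(1) \<delta>(1) side u, folded \<theta>_def]
  define e where "e n = (\<integral>\<omega>. \<theta> n \<omega> \<partial>P x)" for n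
  have e0: "0 \<le> e n" for n unfolding e_def by (intro integral_nonneg_AE AE_I2 \<theta>0)
  have e_le: "e n \<le> 2 * A / (1 - \<delta>)" for n
  proof -
    have "\<bar>\<integral>\<omega>. poly u (X (\<theta> n \<omega>) \<omega>) \<partial>P x\<bar> \<le> (\<integral>\<omega>. A \<partial>P x)"
    proof (rule order_trans[OF integral_abs_bound], rule integral_mono)
      have b: "\<bar>poly u (X (\<theta> n \<omega>) \<omega>)\<bar> \<le> A" if "\<omega> \<in> space (P x)" for \<omega>
        using A(2)[OF X_unit[OF _ \<theta>0]] that by simp
      then show "\<bar>poly u (X (\<theta> n \<omega>) \<omega>)\<bar> \<le> A" if "\<omega> \<in> space (P x)" for \<omega> using that .
      have [measurable]: "(\<lambda>\<omega>. poly u (X (\<theta> n \<omega>) \<omega>)) \<in> borel_measurable \<Omega>" by (rule est(2))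
      show "integrable (P x) (\<lambda>\<omega>. \<bar>poly u (X (\<theta> n \<omega>) \<omega>)\<bar>)"
        by (rule integrable_const_bound[where B = A]) (use b in \<open>auto intro!: AE_I2\<close>)
    qed simp
    then have "\<bar>\<integral>\<omega>. poly u (X (\<theta> n \<omega>) \<omega>) \<partial>P x\<bar> \<le> A" using prob_space by simp
    moreover have "\<bar>poly u x\<bar> \<le> A" using A(2)[of x] x_in by simp
    moreover have "\<bar>(\<integral>\<omega>. poly u (X (\<theta> n \<omega>) \<omega>) \<partial>P x) - poly u x - e n\<bar> \<le> \<delta> * e n"
      using est(3)[of n] unfolding e_def .
    ultimately have "e n - \<delta> * e n \<le> 2 * A" by linarith
    then have "e n * (1 - \<delta>) \<le> 2 * A" by (simp add: algebra_simps)
    then show ?thesis using \<delta> by (simp add: pos_le_divide_eq)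
  qed
  have nn_e: "(\<integral>\<^sup>+\<omega>. ennreal (\<theta> n \<omega>) \<partial>P x) = ennreal (e n)" for n
    unfolding e_def by (rule nn_integral_eq_integral[OF est(1)]) (auto intro!: AE_I2 \<theta>0)
  have ens: "ennreal (\<theta> n \<omega>) = min (hitting_time X y \<omega>) (ennreal (real (Suc n)))" for n \<omega>
    by (simp only: \<theta>_def ennreal_stop)
  have lim_\<theta>: "(\<lambda>n. ennreal (\<theta> n \<omega>)) \<longlonglongrightarrow> hitting_time X y \<omega>" for \<omega>
  proof -
    have "(\<lambda>n. ennreal (real (Suc n))) \<longlonglongrightarrow> \<top>"
      using LIMSEQ_Suc[OF of_nat_tendsto_top_ennreal] by (simp add: ennreal_of_nat_eq_real_of_nat)
    then have "(\<lambda>n. min (hitting_time X y \<omega>) (ennreal (real (Suc n)))) \<longlonglongrightarrow> min (hitting_time X y \<omega>) \<top>"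
      by (intro tendsto_min tendsto_const)
    then show ?thesis by (simp add: ens)
  qed
  have meas_\<theta> [measurable]: "\<theta> n \<in> borel_measurable \<Omega>" for n unfolding \<theta>_def by simp
  have E_lim: "(\<lambda>n. ennreal (e n)) \<longlonglongrightarrow> E"
  proof -
    have "(\<lambda>n. \<integral>\<^sup>+\<omega>. ennreal (\<theta> n \<omega>) \<partial>P x) \<longlonglongrightarrow> E"
      unfolding E_def
    proof (rule nn_integral_LIMSEQ[OF _ _ lim_\<theta>])
      show "incseq (\<lambda>n \<omega>. ennreal (\<theta> n \<omega>))"
        unfolding incseq_def le_fun_def ens by (intro allI impI min.mono ennreal_leI order_refl) simp
    qed simp
    then show ?thesis by (simp add: nn_e)
  qed
  have "E \<le> ennreal (2 * A / (1 - \<delta>))"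
    by (rule LIMSEQ_le_const2[OF E_lim]) (use e_le in \<open>auto intro: ennreal_leI\<close>)
  then show fin: "E < \<infinity>" using ennreal_less_top le_less_trans by fastforce
  have e_lim: "e \<longlonglongrightarrow> enn2real E"
  proof -
    have "ennreal (enn2real E) = E" using fin by simp
    then have "(\<lambda>n. ennreal (e n)) \<longlonglongrightarrow> ennreal (enn2real E)" using E_lim by simp
    then have "(\<lambda>n. enn2real (ennreal (e n))) \<longlonglongrightarrow> enn2real E" by (rule tendsto_enn2real) simp
    then show ?thesis using e0 by simp
  qed
  have AE_fin: "AE \<omega> in P x. hitting_time X y \<omega> \<noteq> \<infinity>"
    by (rule nn_integral_noteq_infinite) (use fin in \<open>auto simp: E_def\<close>)
  have "(\<lambda>n. \<integral>\<omega>. poly u (X (\<theta> n \<omega>) \<omega>) \<partial>P x) \<longlonglongrightarrow> (\<integral>\<omega>. poly u y \<partial>P x)"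
  proof (rule integral_dominated_convergence[where w = "\<lambda>_. A"])
    show "(\<lambda>\<omega>. poly u (X (\<theta> n \<omega>) \<omega>)) \<in> borel_measurable (P x)" for n
      using est(2)[of n] by simp
    show "AE \<omega> in P x. norm (poly u (X (\<theta> n \<omega>) \<omega>)) \<le> A" for n
      using A(2) X_unit \<theta>0 by (intro AE_I2) simp
    show "AE \<omega> in P x. (\<lambda>n. poly u (X (\<theta> n \<omega>) \<omega>)) \<longlonglongrightarrow> poly u y"
      using AE_fin AE_space
    proof eventually_elim
      case (elim \<omega>)
      then have \<omega>: "\<omega> \<in> space \<Omega>" by simp
      show ?case
        using hitting_time_cases[OF \<omega>, of y]
      proof cases
        case 1
        then show ?thesis using elim by simp
      next
        case (2 m)
        obtain N :: nat where N: "m \<le> real N" using real_arch_simple by blast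
        have "\<theta> n \<omega> = m" if "n \<ge> N" for n
        proof -
          have "m \<le> real (Suc n)" using N that by simp
          then have "ennreal (\<theta> n \<omega>) = ennreal m"
            unfolding ens 2(2) by (intro min_absorb1 ennreal_leI)
          then show ?thesis using \<theta>0 2(1) by simp
        qed
        then have "\<forall>\<^sub>F n in sequentially. poly u (X (\<theta> n \<omega>) \<omega>) = poly u y"
          using 2(3) by (intro eventually_sequentiallyI[of N]) auto
        then show ?thesis by (rule tendsto_eventually)
      qed
    qed
  qed simp_all
  then have u_lim: "(\<lambda>n. \<integral>\<omega>. poly u (X (\<theta> n \<omega>) \<omega>) \<partial>P x) \<longlonglongrightarrow> poly u y"
    using prob_space by simp
  show "\<bar>poly u y - poly u x - enn2real E\<bar> \<le> \<delta> * enn2real E"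
  proof (rule LIMSEQ_le)
    show "(\<lambda>n. \<bar>(\<integral>\<omega>. poly u (X (\<theta> n \<omega>) \<omega>) \<partial>P x) - poly u x - e n\<bar>) \<longlonglongrightarrow> \<bar>poly u y - poly u x - enn2real E\<bar>"
      by (intro tendsto_intros u_lim e_lim)
    show "(\<lambda>n. \<delta> * e n) \<longlonglongrightarrow> \<delta> * enn2real E"
      by (intro tendsto_intros e_lim)
    show "\<exists>N. \<forall>n\<ge>N. \<bar>(\<integral>\<omega>. poly u (X (\<theta> n \<omega>) \<omega>) \<partial>P x) - poly u x - e n\<bar> \<le> \<delta> * e n"
      using est(3) unfolding e_def by blast
  qed
qed

text \<open>Applies \<open>hitting_estimate\<close> along the approximating polynomials: as their
  error tends to 0, the increments from \<open>x\<close> to \<open>y\<close> determine the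
  mean.\<close>

lemma expected_hitting_time:
  assumes y: "y \<in> {0<..<1}"
  shows "(\<integral>\<^sup>+\<omega>. hitting_time X y \<omega> \<partial>P x) = ennreal (2 / \<sigma>\<^sup>2) * beta.hitting_mean x y"
proof -
  define J where "J = (if x \<le> y then {0..y} else {y..1})"
  have side: "x \<le> y \<and> J = {0..y} \<or> y \<le> x \<and> J = {y..1}" by (auto simp: J_def)
  have "\<exists>u \<delta>. \<delta> \<longlonglongrightarrow> 0 \<and> (\<forall>n. \<forall>z\<in>J. \<bar>poly (jacobi_op shape_p shape_q (u n)) z - 1\<bar> \<le> \<delta> n) \<and>
    (\<lambda>n::nat. ennreal (poly (u n) y - poly (u n) x)) \<longlonglongrightarrow> beta.hitting_mean x y"
    using beta.mean_up_approximation[of x y] beta.mean_down_approximation[of y x] x_in y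
    by (auto simp: J_def beta.hitting_mean_def)
  then obtain u \<delta> where u: "\<delta> \<longlonglongrightarrow> 0" "\<And>n z. z \<in> J \<Longrightarrow> \<bar>poly (jacobi_op shape_p shape_q (u n)) z - 1\<bar> \<le> \<delta> n"
    "(\<lambda>n::nat. ennreal (poly (u n) y - poly (u n) x)) \<longlonglongrightarrow> beta.hitting_mean x y" by blast
  define v where "v n = smult (2 / \<sigma>\<^sup>2) (u n)" for n
  have gen_v: "gen_poly (v n) = jacobi_op shape_p shape_q (u n)" for n
    using \<sigma>_nz by (simp add: gen_poly_def v_def jacobi_op_smult)
  have "x \<in> J" using x_in by (auto simp: J_def)
  then have \<delta>0: "0 \<le> \<delta> n" for n using u(2)[of x n] by linarith
  define E where "E = (\<integral>\<^sup>+\<omega>. hitting_time X y \<omega> \<partial>P x)"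
  have ev: "\<forall>\<^sub>F n in sequentially. \<delta> n < 1" using u(1) by (rule order_tendstoD) simp
  have est: "E < \<infinity>" "\<bar>poly (v n) y - poly (v n) x - enn2real E\<bar> \<le> \<delta> n * enn2real E" if "\<delta> n < 1" for n
    using hitting_estimate[OF \<delta>0 that side, of "v n"] u(2) unfolding E_def gen_v by auto
  obtain n0 where "\<delta> n0 < 1" using ev by (auto simp: eventually_sequentially)
  then have fin: "E < \<infinity>" by (rule est(1))
  have "(\<lambda>n. (poly (v n) y - poly (v n) x) - enn2real E) \<longlonglongrightarrow> 0"
  proof (rule Lim_null_comparison)
    show "\<forall>\<^sub>F n in sequentially. norm ((poly (v n) y - poly (v n) x) - enn2real E) \<le> \<delta> n * enn2real E"
      using ev by eventually_elim (use est(2) in simp)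
    show "(\<lambda>n. \<delta> n * enn2real E) \<longlonglongrightarrow> 0" using tendsto_mult_right[OF u(1), of "enn2real E"] by simp
  qed
  then have "(\<lambda>n. poly (v n) y - poly (v n) x) \<longlonglongrightarrow> enn2real E" by (simp add: LIM_zero_iff)
  then have "(\<lambda>n. \<sigma>\<^sup>2 / 2 * (poly (v n) y - poly (v n) x)) \<longlonglongrightarrow> \<sigma>\<^sup>2 / 2 * enn2real E" by (rule tendsto_mult_left)
  also have "(\<lambda>n. \<sigma>\<^sup>2 / 2 * (poly (v n) y - poly (v n) x)) = (\<lambda>n. poly (u n) y - poly (u n) x)"
    using \<sigma>_nz by (simp add: v_def right_diff_distrib)
  finally have "(\<lambda>n. ennreal (poly (u n) y - poly (u n) x)) \<longlonglongrightarrow> ennreal (\<sigma>\<^sup>2 / 2 * enn2real E)"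
    by (rule tendsto_ennrealI)
  then have "beta.hitting_mean x y = ennreal (\<sigma>\<^sup>2 / 2 * enn2real E)"
    by (rule LIMSEQ_unique[OF u(3)])
  then have "ennreal (2 / \<sigma>\<^sup>2) * beta.hitting_mean x y = ennreal (2 / \<sigma>\<^sup>2 * (\<sigma>\<^sup>2 / 2 * enn2real E))"
    by (simp only: ennreal_mult' enn2real_nonneg) (simp add: ennreal_mult'[symmetric])
  also have "\<dots> = E" using \<sigma>_nz fin by simp
  finally show ?thesis by (simp add: E_def)
qed

end

section \<open>From polynomials to Borel sets\<close>

text \<open>Borel functions are reached from continuous ones by pointwise limits everywhere, so no reference
  measure for the law of the occupation time is needed.\<close>

inductive baire_unit :: "(real \<Rightarrow> real) \<Rightarrow> bool" where
  continuous: "continuous_on UNIV f \<Longrightarrow> (\<And>x. 0 \<le> f x \<and> f x \<le> 1) \<Longrightarrow> baire_unit f"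
| limit: "(\<And>n::nat. baire_unit (f n)) \<Longrightarrow> (\<And>x. (\<lambda>n. f n x) \<longlonglongrightarrow> g x) \<Longrightarrow> baire_unit g"

lemma baire_unit_range:
  assumes "baire_unit f" shows "0 \<le> f x \<and> f x \<le> 1"
  using assms
proof (induction f)
  case (limit f g)
  then show ?case
    using LIMSEQ_le_const[OF limit.hyps(2)[of x], of 0] LIMSEQ_le_const2[OF limit.hyps(2)[of x], of 1] by blast
qed auto

lemma baire_unit_measurable:
  assumes "baire_unit f" shows "f \<in> borel_measurable borel"
  using assms
proof (induction f)
  case (continuous f)
  then show ?case by (intro borel_measurable_continuous_onI)
next
  case (limit f g)
  then show ?case by (intro borel_measurable_LIMSEQ_real[of borel f g]) auto
qed

lemma baire_unit_compl:
  assumes "baire_unit f" shows "baire_unit (\<lambda>x. 1 - f x)"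
  using assms
proof (induction f)
  case (continuous f)
  then show ?case by (intro baire_unit.continuous continuous_intros) auto
next
  case (limit f g)
  show ?case
    by (rule baire_unit.limit[of "\<lambda>n x. 1 - f n x"], rule limit.IH) (intro tendsto_intros limit.hyps)
qed

text \<open>Nested induction: for continuous \<open>f\<close> an induction over \<open>g\<close>,
  then limits in \<open>f\<close> with \<open>g\<close> fixed.\<close>

lemma baire_unit_mult:
  assumes "baire_unit f" "baire_unit g" shows "baire_unit (\<lambda>x. f x * g x)"
  using assms
proof (induction f)
  case f: (continuous f)
  from f.prems show ?case
  proof (induction g)
    case g: (continuous g)
    then show ?case using f.hyps by (intro baire_unit.continuous continuous_intros) (auto intro: mult_le_one)
  next
    case (limit h g)
    show ?case
      by (rule baire_unit.limit[of "\<lambda>n x. f x * h n x"], rule limit.IH) (intro tendsto_intros limit.hyps)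
  qed
next
  case (limit h f)
  show ?case
    by (rule baire_unit.limit[of "\<lambda>n x. h n x * g x"], rule limit.IH, rule limit.prems) (intro tendsto_intros limit.hyps)
qed

lemma baire_unit_closed:
  assumes "closed C" shows "baire_unit (indicator C)"
\<comment> \<open>The distance to the empty set is 0 by convention, so the approximants used below
  would tend to 1 instead of 0.\<close>
proof (cases "C = {}")
  case True
  then show ?thesis by (intro baire_unit.continuous) (auto simp: indicator_def)
next
  case False
  show ?thesis
  proof (rule baire_unit.limit)
    show "baire_unit (\<lambda>x. max 0 (1 - real n * infdist x C))" for n
      by (intro baire_unit.continuous continuous_intros) (auto simp: infdist_nonneg)
    show "(\<lambda>n. max 0 (1 - real n * infdist x C)) \<longlonglongrightarrow> indicator C x" for x
    proof (cases "x \<in> C")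
      case True
      then show ?thesis by simp
    next
      case x: False
      then have d: "infdist x C > 0"
        using in_closed_iff_infdist_zero[OF assms False, of x] infdist_nonneg[of x C] by simp
      obtain N :: nat where N: "1 / infdist x C \<le> real N" using real_arch_simple by blast
      have "max 0 (1 - real n * infdist x C) = 0" if "n \<ge> N" for n
      proof -
        have "1 / infdist x C \<le> real n" using N that by simp
        then show ?thesis using d by (simp add: pos_divide_le_eq)
      qed
      then have "\<forall>\<^sub>F n in sequentially. max 0 (1 - real n * infdist x C) = indicator C x"
        using x by (intro eventually_sequentiallyI[of N]) auto
      then show ?thesis by (rule tendsto_eventually)
    qed
  qed
qed

lemma baire_unit_indicator:
  assumes "A \<in> sets borel" shows "baire_unit (indicator A)"
proof -
  have "A \<in> sigma_sets UNIV (Collect closed)"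
    using assms by (simp add: borel_eq_closed sets_measure_of)
  then show ?thesis
  proof (induction A)
    case (Basic A)
    then show ?case by (intro baire_unit_closed) simp
  next
    case Empty
    show ?case by (rule baire_unit_closed) simp
  next
    case (Compl A)
    have "(indicator (UNIV - A) :: real \<Rightarrow> real) = (\<lambda>x. 1 - indicator A x)" by (auto simp: indicator_def)
    then show ?case using baire_unit_compl[OF Compl.IH] by simp
  next
    case (Union A)
    \<comment> \<open>The product is the indicator of the complement of a finite union; it keeps the
      approximants in the class without making the sets disjoint.\<close>
    have prod: "baire_unit (\<lambda>x. \<Prod>i<n. 1 - indicator (A i) x)" for n :: nat
    proof (induction n)
      case 0
      then show ?case by (intro baire_unit.continuous) auto
    next
      case (Suc n)
      then show ?case using baire_unit_mult[OF Suc baire_unit_compl[OF Union.IH[of n]]] by simp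
    qed
    show ?case
    proof (rule baire_unit.limit)
      show "baire_unit (\<lambda>x. 1 - (\<Prod>i<n. 1 - indicator (A i) x))" for n :: nat
        by (rule baire_unit_compl[OF prod])
      show "(\<lambda>n. 1 - (\<Prod>i<n. 1 - indicator (A i) x)) \<longlonglongrightarrow> (indicator (\<Union> (range A)) x :: real)" for x
      proof (cases "\<exists>k. x \<in> A k")
        case True
        then obtain k where k: "x \<in> A k" by blast
        have "1 - (\<Prod>i<n. 1 - indicator (A i) x) = (indicator (\<Union> (range A)) x :: real)" if "n \<ge> Suc k" for n
        proof -
          have "(\<Prod>i<n. 1 - indicator (A i) x) = (0::real)"
            using that k by (intro prod_zero) (auto intro!: bexI[of _ k])
          moreover have "x \<in> \<Union> (range A)" using k by blast
          ultimately show ?thesis by simp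
        qed
        then have "\<forall>\<^sub>F n in sequentially. 1 - (\<Prod>i<n. 1 - indicator (A i) x) = (indicator (\<Union> (range A)) x :: real)"
          by (rule eventually_sequentiallyI)
        then show ?thesis by (rule tendsto_eventually)
      qed auto
    qed
  qed
qed

lemma poly_approximation_unit:
  fixes f :: "real \<Rightarrow> real"
  assumes f: "continuous_on {0..1} f" "\<And>x. x \<in> {0..1} \<Longrightarrow> 0 \<le> f x \<and> f x \<le> 1"
  shows "\<exists>h. (\<forall>n::nat. \<forall>x\<in>{0..1}. 0 \<le> poly (h n) x \<and> poly (h n) x \<le> 1) \<and> (\<forall>x\<in>{0..1}. (\<lambda>n. poly (h n) x) \<longlonglongrightarrow> f x)"
proof -
  define d where "d n = 1 / real (Suc n)" for n
  have d: "0 < d n" for n by (simp add: d_def)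
  have "\<exists>g. \<forall>x\<in>{0..1}. \<bar>f x - poly g x\<bar> < d n" for n
  proof -
    obtain g where g: "real_polynomial_function g" "\<And>x. x \<in> {0..1} \<Longrightarrow> \<bar>f x - g x\<bar> < d n"
      using Stone_Weierstrass_real_polynomial_function[OF compact_Icc f(1) d[of n]] by blast
    obtain a N where "g = (\<lambda>x. \<Sum>i\<le>N::nat. a i * x ^ i)" using real_polynomial_function_imp_sum[OF g(1)] by blast
    then have "poly (\<Sum>i\<le>N. monom (a i) i) x = g x" for x by (simp add: poly_sum poly_monom)
    then show ?thesis using g(2) by metis
  qed
  then obtain g where g: "\<And>n x. x \<in> {0..1} \<Longrightarrow> \<bar>f x - poly (g n) x\<bar> < d n" by metis
  \<comment> \<open>An approximant with error \<open>d n\<close> has values in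
    \<open>[- d n, 1 + d n]\<close>; this affine map brings it back into the unit interval and tends
    to the identity.\<close>
  define h where "h n = smult (1 / (1 + 2 * d n)) (g n + [:d n:])" for n
  have h: "poly (h n) x = (poly (g n) x + d n) / (1 + 2 * d n)" for n x by (simp add: h_def)
  have dl: "d \<longlonglongrightarrow> 0" unfolding d_def by real_asymp
  show ?thesis
  proof (intro exI[of _ h] conjI allI ballI)
    fix n x assume x: "x \<in> {0..1::real}"
    have "0 \<le> poly (g n) x + d n" "poly (g n) x + d n \<le> 1 + 2 * d n"
      using g[OF x, of n] f(2)[OF x] by (auto simp: abs_less_iff)
    then show "0 \<le> poly (h n) x" "poly (h n) x \<le> 1" using d[of n] by (auto simp: h)
  next
    fix x assume x: "x \<in> {0..1::real}"
    have "(\<lambda>n. poly (g n) x - f x) \<longlonglongrightarrow> 0"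
      by (rule Lim_null_comparison[OF _ dl]) (use g[OF x] in \<open>auto simp: abs_minus_commute less_imp_le\<close>)
    then have "(\<lambda>n. poly (g n) x) \<longlonglongrightarrow> f x" by (simp add: LIM_zero_iff)
    then have "(\<lambda>n. (poly (g n) x + d n) / (1 + 2 * d n)) \<longlonglongrightarrow> (f x + 0) / (1 + 2 * 0)"
      by (intro tendsto_intros dl) auto
    then show "(\<lambda>n. poly (h n) x) \<longlonglongrightarrow> f x" by (simp add: h)
  qed
qed

section \<open>Transfer of the exponential bound to Borel sets, and Chernoff's inequality\<close>

context jacobi_started begin

text \<open>A predicate of the observable, so that it can be carried through the induction over
  \<open>baire_unit\<close> with \<theta> and \<open>t\<close> fixed.\<close>

definition mgf_bound :: "real \<Rightarrow> real \<Rightarrow> (real \<Rightarrow> real) \<Rightarrow> bool" where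
  "mgf_bound \<theta> t f \<longleftrightarrow> (\<integral>\<omega>. exp (\<theta> * (occ f t \<omega> - t * (\<integral>y. f y \<partial>beta.\<pi>))) \<partial>P x)
     \<le> exp (\<theta> * hit_avg + \<theta>\<^sup>2 * ((t + 1) * (hit_avg + 1)\<^sup>2) / 8)"

lemma exp_occ_bound:
  assumes \<omega>: "\<omega> \<in> space \<Omega>" and f: "f \<in> borel_measurable borel" "\<And>y. y \<in> {0..1} \<Longrightarrow> 0 \<le> f y \<and> f y \<le> 1"
    and t: "0 < t" and \<theta>: "0 \<le> \<theta>"
  shows "norm (exp (\<theta> * (occ f t \<omega> - t * (\<integral>y. f y \<partial>beta.\<pi>)))) \<le> exp (\<theta> * t)"
proof -
  have "0 \<le> (\<integral>y. f y \<partial>beta.\<pi>)"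
    by (intro integral_nonneg_AE eventually_mono[OF beta.AE_\<pi>]) (use f in auto)
  then have "0 \<le> t * (\<integral>y. f y \<partial>beta.\<pi>)" using t by simp
  moreover have "occ f t \<omega> \<le> t" using occ_bounds[OF \<omega> f] t by auto
  ultimately show ?thesis using \<theta> by (auto intro!: mult_left_mono)
qed

text \<open>Dominated convergence three times: along each path, under the Beta law, and under
  \<open>P x\<close>. The right-hand side of the bound does not involve the observable.\<close>

lemma mgf_bound_limit:
  assumes f: "\<And>n. f n \<in> borel_measurable borel" "\<And>n y. y \<in> {0..1} \<Longrightarrow> 0 \<le> f n y \<and> f n y \<le> 1"
    and g: "g \<in> borel_measurable borel"
    and lim: "\<And>y. y \<in> {0..1} \<Longrightarrow> (\<lambda>n. f n y) \<longlonglongrightarrow> g y"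
    and bound: "\<And>n::nat. mgf_bound \<theta> t (f n)" and t: "0 < t" and \<theta>: "0 \<le> \<theta>"
  shows "mgf_bound \<theta> t g"
proof -
  have t0: "0 \<le> t" using t by simp
  have fa: "\<bar>f n y\<bar> \<le> 1" if "y \<in> {0..1}" for n y using f(2)[OF that, of n] by simp
  have ga: "\<bar>g y\<bar> \<le> 1" if "y \<in> {0..1}" for y
    by (rule LIMSEQ_le_const2[OF tendsto_rabs[OF lim[OF that]]]) (use fa[OF that] in blast)
  note f(1)[measurable] g[measurable]
  have occ_lim: "(\<lambda>n. occ (f n) t \<omega>) \<longlonglongrightarrow> occ g t \<omega>" if \<omega>: "\<omega> \<in> space \<Omega>" for \<omega>
    unfolding occ_def set_lebesgue_integral_def
  proof (rule integral_dominated_convergence[where w = "indicator {0..t}"])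
    show "(\<lambda>r. indicator {0..t} r *\<^sub>R f n (X r \<omega>)) \<in> borel_measurable lborel" for n
      using path_set_integrable[OF \<omega> f(1)[of n] fa[of _ n], of 0 t] unfolding set_integrable_def
      by (intro borel_measurable_integrable) auto
    show "(\<lambda>r. indicator {0..t} r *\<^sub>R g (X r \<omega>)) \<in> borel_measurable lborel"
      using path_set_integrable[OF \<omega> g ga, of 0 t] unfolding set_integrable_def
      by (intro borel_measurable_integrable) auto
    show "integrable lborel (indicat_real {0..t})" using t0 by simp
    show "AE r in lborel. (\<lambda>n. indicator {0..t} r *\<^sub>R f n (X r \<omega>)) \<longlonglongrightarrow> indicator {0..t} r *\<^sub>R g (X r \<omega>)"
      using lim X_unit[OF \<omega>] by (intro AE_I2) (auto simp: indicator_def)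
    show "AE r in lborel. norm (indicator {0..t} r *\<^sub>R f n (X r \<omega>)) \<le> indicat_real {0..t} r" for n
      using fa X_unit[OF \<omega>] by (intro AE_I2) (auto simp: indicator_def)
  qed
  have pi_lim: "(\<lambda>n. \<integral>y. f n y \<partial>beta.\<pi>) \<longlonglongrightarrow> (\<integral>y. g y \<partial>beta.\<pi>)"
    by (rule integral_dominated_convergence[where w = "\<lambda>_. 1"])
      (auto intro!: eventually_mono[OF beta.AE_\<pi>] lim fa)
  have [measurable]: "occ (f n) t \<in> borel_measurable \<Omega>" "occ g t \<in> borel_measurable \<Omega>" for n
    by (intro occ_measurable t0 f g)+
  have "(\<lambda>n. \<integral>\<omega>. exp (\<theta> * (occ (f n) t \<omega> - t * (\<integral>y. f n y \<partial>beta.\<pi>))) \<partial>P x) \<longlonglongrightarrow>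
     (\<integral>\<omega>. exp (\<theta> * (occ g t \<omega> - t * (\<integral>y. g y \<partial>beta.\<pi>))) \<partial>P x)"
  proof (rule integral_dominated_convergence[where w = "\<lambda>_. exp (\<theta> * t)"])
    show "AE \<omega> in P x. (\<lambda>n. exp (\<theta> * (occ (f n) t \<omega> - t * (\<integral>y. f n y \<partial>beta.\<pi>)))) \<longlonglongrightarrow>
        exp (\<theta> * (occ g t \<omega> - t * (\<integral>y. g y \<partial>beta.\<pi>)))"
      by (intro AE_I2 tendsto_intros pi_lim occ_lim) simp
    show "AE \<omega> in P x. norm (exp (\<theta> * (occ (f n) t \<omega> - t * (\<integral>y. f n y \<partial>beta.\<pi>)))) \<le> exp (\<theta> * t)" for n
      by (intro AE_I2 exp_occ_bound f t \<theta>) simp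
  qed simp_all
  then show ?thesis
    using bound unfolding mgf_bound_def by (intro LIMSEQ_le_const2) auto
qed

lemma mgf_bound_baire:
  assumes "baire_unit f" and t: "0 < t" and \<theta>: "0 \<le> \<theta>"
  shows "mgf_bound \<theta> t f"
  using assms(1)
proof (induction f)
  case (continuous f)
  have "continuous_on {0..1} f" by (rule continuous_on_subset[OF continuous.hyps(1)]) simp
  then obtain h where h: "\<And>n y. y \<in> {0..1} \<Longrightarrow> 0 \<le> poly (h n) y \<and> poly (h n) y \<le> 1"
    "\<And>y. y \<in> {0..1} \<Longrightarrow> (\<lambda>n::nat. poly (h n) y) \<longlonglongrightarrow> f y"
    using poly_approximation_unit[of f] continuous.hyps(2) by blast
  show ?case
  proof (rule mgf_bound_limit[where f = "\<lambda>n. poly (h n)", OF borel_measurable_poly h(1) _ h(2) _ t \<theta>])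
    show "f \<in> borel_measurable borel" by (rule borel_measurable_continuous_onI) fact
    show "mgf_bound \<theta> t (poly (h n))" for n
      unfolding mgf_bound_def by (rule mgf_poly[OF h(1) t \<theta>])
  qed
next
  case (limit f g)
  have g: "baire_unit g" by (rule baire_unit.limit[OF limit.hyps])
  show ?case
    by (rule mgf_bound_limit[of f, OF baire_unit_measurable[OF limit.hyps(1)] baire_unit_range[OF limit.hyps(1)]
          baire_unit_measurable[OF g] limit.hyps(2) limit.IH t \<theta>])
qed

text \<open>Chernoff's bound; the boundary term in the exponent lowers the effective level
  \<open>t * \<epsilon>\<close> by \<open>hit_avg\<close>.\<close>

lemma occupation_concentration:
  assumes A: "A \<in> sets borel" and t: "0 < t" and D: "hit_avg < t * \<epsilon>"
  shows "measure (P x) {\<omega> \<in> space \<Omega>. t * \<epsilon> \<le> occ (indicator A) t \<omega> - t * (\<integral>y. indicator A y \<partial>beta.\<pi>)}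
     \<le> exp (- 2 * (t * \<epsilon> - hit_avg)\<^sup>2 / ((t + 1) * (hit_avg + 1)\<^sup>2))"
proof -
  define V where "V = (t + 1) * (hit_avg + 1)\<^sup>2"
  define d where "d = t * \<epsilon> - hit_avg"
  \<comment> \<open>The minimiser of \<open>- \<theta> * d + \<theta>\<^sup>2 * V / 8\<close>, with
    minimum \<open>- 2 * d\<^sup>2 / V\<close>.\<close>
  define \<theta> where "\<theta> = 4 * d / V"
  have V: "0 < V" using t hit_avg_nonneg by (auto simp: V_def intro!: mult_pos_pos)
  have d: "0 < d" using D by (simp add: d_def)
  have \<theta>: "0 \<le> \<theta>" using V d by (simp add: \<theta>_def)
  define Y where "Y \<omega> = occ (indicator A) t \<omega> - t * (\<integral>y. indicator A y \<partial>beta.\<pi>)" for \<omega>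
  have ind: "indicat_real A \<in> borel_measurable borel" using A by simp
  have [measurable]: "occ (indicator A) t \<in> borel_measurable \<Omega>" using t by (intro occ_measurable ind) simp
  have [measurable]: "Y \<in> borel_measurable \<Omega>" unfolding Y_def by measurable
  have int: "integrable (P x) (\<lambda>\<omega>. exp (\<theta> * Y \<omega>))"
  proof (rule integrable_const_bound[where B = "exp (\<theta> * t)"])
    show "AE \<omega> in P x. norm (exp (\<theta> * Y \<omega>)) \<le> exp (\<theta> * t)"
      unfolding Y_def by (intro AE_I2 exp_occ_bound ind t \<theta>) (auto simp: indicator_def)
  qed simp
  have "measure (P x) {\<omega> \<in> space \<Omega>. t * \<epsilon> \<le> Y \<omega>} = (\<integral>\<omega>. indicator {\<omega> \<in> space \<Omega>. t * \<epsilon> \<le> Y \<omega>} \<omega> \<partial>P x)"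
    by simp
  also have "\<dots> \<le> (\<integral>\<omega>. exp (- \<theta> * (t * \<epsilon>)) * exp (\<theta> * Y \<omega>) \<partial>P x)"
  proof (rule integral_mono)
    show "integrable (P x) (\<lambda>\<omega>. exp (- \<theta> * (t * \<epsilon>)) * exp (\<theta> * Y \<omega>))" using int by simp
    show "integrable (P x) (indicat_real {\<omega> \<in> space \<Omega>. t * \<epsilon> \<le> Y \<omega>})"
      by (intro integrable_real_indicator) (auto simp: emeasure_eq_measure)
    show "indicat_real {\<omega> \<in> space \<Omega>. t * \<epsilon> \<le> Y \<omega>} \<omega> \<le> exp (- \<theta> * (t * \<epsilon>)) * exp (\<theta> * Y \<omega>)" for \<omega>
      using \<theta> by (auto simp: indicator_def exp_add[symmetric] mult_left_mono)
  qed
  also have "\<dots> = exp (- \<theta> * (t * \<epsilon>)) * (\<integral>\<omega>. exp (\<theta> * Y \<omega>) \<partial>P x)" by simp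
  also have "\<dots> \<le> exp (- \<theta> * (t * \<epsilon>)) * exp (\<theta> * hit_avg + \<theta>\<^sup>2 * V / 8)"
    using mgf_bound_baire[OF baire_unit_indicator[OF A] t \<theta>] unfolding mgf_bound_def Y_def V_def
    by (intro mult_left_mono) auto
  also have "\<dots> = exp (- \<theta> * d + \<theta>\<^sup>2 * V / 8)"
    by (simp add: exp_add[symmetric] d_def algebra_simps)
  also have "- \<theta> * d + \<theta>\<^sup>2 * V / 8 = - 2 * d\<^sup>2 / V"
    using V by (simp add: \<theta>_def field_simps power2_eq_square)
  finally show ?thesis unfolding Y_def d_def V_def .
qed

end

theorem corollary1p1:
  fixes a b \<sigma> t_av :: real
    and \<Omega> :: "'w measure"
    and P :: "real \<Rightarrow> 'w measure"
    and X :: "real \<Rightarrow> 'w \<Rightarrow> real"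
    and \<pi> :: "real measure"
  assumes "0 < a" and "a < b" and "\<sigma> \<noteq> 0"
    and "jacobi_process a b \<sigma> \<Omega> P X"
    and "\<pi> = jacobi_distribution a b \<sigma>"
    and "stationary_distribution {0<..<1} P X \<pi>"
    and "uniformly_ergodic {0<..<1} P X \<pi>"
    and "t_av = 2 / \<sigma>\<^sup>2 * (\<Sum>i. 1 / (real (Suc i) * (real (Suc i) - 1 + 2 * b / \<sigma>\<^sup>2)))"
  shows "average_hitting_time {0<..<1} P X \<pi> = ennreal t_av \<and>
    (\<forall>\<epsilon>>0. \<forall>t>4 * t_av / \<epsilon>. \<forall>x\<in>{0<..<1}. \<forall>A\<in>sets borel. A \<subseteq> {0<..<1} \<longrightarrow>
      measure (P x) {\<omega> \<in> space (P x).
          1 / t * (LINT s:{0..t}|lborel. indicat_real A (X s \<omega>))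
            - (LINT y|\<pi>. indicat_real A y) \<ge> \<epsilon>}
      \<le> exp (- 2 * (t * \<epsilon> - 4 * t_av)\<^sup>2 / ((t + 1) * (4 * t_av + 1)\<^sup>2)))"
proof -
  define p q where "p = 2 * a / \<sigma>\<^sup>2" and "q = 2 * (b - a) / \<sigma>\<^sup>2"
  interpret bp: beta_params p q
    using assms(1-3) by unfold_locales (auto simp: p_def q_def)
  have started: "jacobi_started a b \<sigma> \<Omega> P X x" if "x \<in> {0<..<1}" for x
    using assms that by (simp add: jacobi_started_def jacobi_started_axioms_def)
  \<comment> \<open>The shape constants do not depend on the starting point; \<open>1/2\<close> is
    an arbitrary one at which the locale facts are available.\<close>
  have pq: "jacobi_started.shape_p a \<sigma> = p" "jacobi_started.shape_q a b \<sigma> = q" 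
    using jacobi_started.shape_p_def[OF started, of "1/2"] jacobi_started.shape_q_def[OF started, of "1/2"]
    by (simp_all add: p_def q_def)
  have pi: "\<pi> = bp.\<pi>"
  proof -
    have "2 * b / \<sigma>\<^sup>2 - 2 * a / \<sigma>\<^sup>2 - 1 = q - 1" "2 * a / \<sigma>\<^sup>2 - 1 = p - 1"
      by (simp_all add: p_def q_def diff_divide_distrib right_diff_distrib)
    then show ?thesis
      unfolding assms(5) jacobi_distribution_def bp.\<pi>_def bp.rho_def Let_def
      by (simp add: Beta_commute[of q p])
  qed
  have eigen_sum: "t_av = 2 / \<sigma>\<^sup>2 * bp.eigen_sum"
    unfolding assms(8) bp.eigen_sum_def by (simp add: p_def q_def right_diff_distrib diff_divide_distrib add.assoc)
  have t_av0: "0 \<le> t_av" unfolding eigen_sum using bp.eigen_sum_nonneg by simp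
  show ?thesis
  proof (intro conjI allI impI ballI)
    interpret pair_prob_space \<pi> \<pi> unfolding pi ..
    have S: "emeasure \<pi> {0<..<1} = 1"
      unfolding pi by (rule bp.pi.emeasure_eq_1_AE[OF _ bp.AE_\<pi>]) simp
    have "emeasure (\<pi> \<Otimes>\<^sub>M \<pi>) ({0<..<1} \<times> {0<..<1}) = 1"
      using S unfolding pi by (subst bp.pi.emeasure_pair_measure_Times) simp_all
    then have AE_S: "AE z in \<pi> \<Otimes>\<^sub>M \<pi>. z \<in> {0<..<1} \<times> {0<..<1}"
      by (intro AE_prob_1) (simp add: emeasure_eq_measure)
    have inner: "(\<integral>\<^sup>+\<omega>. hitting_time X y \<omega> \<partial>P x) = ennreal (2 / \<sigma>\<^sup>2) * bp.hitting_mean x y"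
      if "x \<in> {0<..<1}" "y \<in> {0<..<1}" for x y
      using jacobi_started.expected_hitting_time[OF started[OF that(1)] that(2)] unfolding pq .
    have "average_hitting_time {0<..<1} P X \<pi> =
      (\<integral>\<^sup>+z. ennreal (2 / \<sigma>\<^sup>2) * bp.hitting_mean (fst z) (snd z) * indicator ({0<..<1} \<times> {0<..<1}) z \<partial>(\<pi> \<Otimes>\<^sub>M \<pi>))"
      unfolding average_hitting_time_def
      by (intro nn_integral_cong) (auto simp: inner indicator_def)
    also have "\<dots> = (\<integral>\<^sup>+z. ennreal (2 / \<sigma>\<^sup>2) * bp.hitting_mean (fst z) (snd z) \<partial>(\<pi> \<Otimes>\<^sub>M \<pi>))"
      by (intro nn_integral_cong_AE eventually_mono[OF AE_S]) simp
    also have "\<dots> = ennreal (2 / \<sigma>\<^sup>2) * (\<integral>\<^sup>+z. bp.hitting_mean (fst z) (snd z) \<partial>(\<pi> \<Otimes>\<^sub>M \<pi>))"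
      unfolding pi by (intro nn_integral_cmult) measurable
    also have "\<dots> = ennreal t_av"
      unfolding pi bp.average_hitting_mean eigen_sum by (rule ennreal_mult''[symmetric], rule bp.eigen_sum_nonneg)
    finally show "average_hitting_time {0<..<1} P X \<pi> = ennreal t_av" .
  next
    fix \<epsilon> t x A
    assume \<epsilon>: "0 < \<epsilon>" and t: "4 * t_av / \<epsilon> < t" and x: "x \<in> {0<..<1::real}" and A: "A \<in> sets borel" "A \<subseteq> {0<..<1::real}"
    interpret jacobi_started a b \<sigma> \<Omega> P X x using x by (rule started)
    have tav: "hit_avg = t_av" unfolding hit_avg_def pq eigen_sum ..
    show "measure (P x) {\<omega> \<in> space (P x).
          1 / t * (LINT s:{0..t}|lborel. indicat_real A (X s \<omega>))
            - (LINT y|\<pi>. indicat_real A y) \<ge> \<epsilon>}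
      \<le> exp (- 2 * (t * \<epsilon> - 4 * t_av)\<^sup>2 / ((t + 1) * (4 * t_av + 1)\<^sup>2))"
    proof -
      have "0 \<le> 4 * t_av / \<epsilon>" using t_av0 \<epsilon> by simp
      then have t0: "0 < t" using t by linarith
      have t\<epsilon>: "4 * t_av < t * \<epsilon>" using t \<epsilon> by (simp add: pos_divide_less_eq)
      have "\<epsilon> \<le> 1 / t * (LINT s:{0..t}|lborel. indicat_real A (X s \<omega>)) - (LINT y|\<pi>. indicat_real A y) \<longleftrightarrow>
          t * \<epsilon> \<le> occ (indicator A) t \<omega> - t * (\<integral>y. indicator A y \<partial>bp.\<pi>)" for \<omega>
        unfolding occ_def pi using t0 by (simp add: field_simps)
      then have "measure (P x) {\<omega> \<in> space (P x).
          1 / t * (LINT s:{0..t}|lborel. indicat_real A (X s \<omega>)) - (LINT y|\<pi>. indicat_real A y) \<ge> \<epsilon>} =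
        measure (P x) {\<omega> \<in> space \<Omega>. t * \<epsilon> \<le> occ (indicator A) t \<omega> - t * (\<integral>y. indicator A y \<partial>bp.\<pi>)}"
        by simp
      also have "\<dots> \<le> exp (- 2 * (t * \<epsilon> - t_av)\<^sup>2 / ((t + 1) * (t_av + 1)\<^sup>2))"
        using occupation_concentration[OF A(1) t0, of \<epsilon>] t\<epsilon> t_av0 unfolding tav pq by simp
      also have "\<dots> \<le> exp (- 2 * (t * \<epsilon> - 4 * t_av)\<^sup>2 / ((t + 1) * (4 * t_av + 1)\<^sup>2))"
      proof -
        \<comment> \<open>The quotient \<open>(t * \<epsilon> - c) / (c + 1)\<close> decreases in
          \<open>c\<close> and is still positive at \<open>c = 4 * t_av\<close>, so squaring keeps
          the order.\<close>
        have "(t * \<epsilon> - 4 * t_av) / (4 * t_av + 1) \<le> (t * \<epsilon> - t_av) / (t_av + 1)"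
          using t\<epsilon> t_av0 by (intro frac_le) auto
        then have "((t * \<epsilon> - 4 * t_av) / (4 * t_av + 1))\<^sup>2 \<le> ((t * \<epsilon> - t_av) / (t_av + 1))\<^sup>2"
          using t\<epsilon> t_av0 by (intro power_mono divide_nonneg_nonneg) auto
        then have "2 / (t + 1) * ((t * \<epsilon> - 4 * t_av) / (4 * t_av + 1))\<^sup>2 \<le> 2 / (t + 1) * ((t * \<epsilon> - t_av) / (t_av + 1))\<^sup>2"
          using t0 by (intro mult_left_mono) auto
        then show ?thesis by (simp add: power_divide)
      qed
      finally show ?thesis .
    qed
  qed
qed

end
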